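(* The operator $\mathcal W$ on $\mathcal H$ is bounded and self-adjoint with probability $1$. Let $f\in L^2[0,1]$ be any fixed nonzero function and let $\mu_f$ be the spectral measure of $\mathcal W$ at $f$, normalized to be a probability measure. Then $\mu_f$ is almost surely the semicircular law.
   Context: The semicircular law is the probability measure with density $\frac1{2\pi}\sqrt{4-x^2}$ on $[-2,2]$; its $l$-th moment is denoted $\beta_l$, so $\beta_{2l+1}=0$ and $\beta_{2l}=\frac1{l+1}\binom{2l}{l}$. $(P_i)_{i\in\mathbb N}$, $P_i=(a_i,b_i]$, enumerates the intervals $(a,b]$ with $0\le a<b\le1$ and $a,b\in\mathbb Q$. A Brownian sheet $B(x,y)$ on $[0,1]^2$ is a (continuous) centered Gaussian process with $\mathrm{Cov}[B(x_1,y_1),B(x_2,y_2)]=\min\{x_1,x_2\}\min\{y_1,y_2\}$. Let $(B_m)_{m\ge1}$ be independent Brownian sheets, and for $l\ge1$ put $$C_l(x,y)=\sum_{1\le m\le l,\ l-m\text{ even}}\frac{m+1}{l+1}\binom{l+1}{\frac{l-m}2}B_m(x,y),\qquad \Gamma_l(x,y)=\tfrac1{\sqrt2}\bigl(C_l(x,y)+C_l(y,x)\bigr).$$ Set functions: vectors are (random) real-valued functions on half-open intervals $(a,b]\subseteq[0,1]$, with pointwise linear combinations. A function $f\in L^2[0,1]$ is viewed as the set function $(a,b]\mapsto\frac1{b-a}\int_a^bf(x)\,dx$. For a function $F$ on $[0,1]$, $\frac{dF}{\sqrt{dx}}$ is the set function $\frac{dF}{\sqrt{dx}}((a,b])=\frac{F(b)-F(a)}{\sqrt{b-a}}$.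 The inner product is $$\langle F,G\rangle=\lim_{\|\mathcal P\|\to0}\sum_{j}F((t_{j-1},t_j])\,G((t_{j-1},t_j])\,(t_j-t_{j-1})$$ over partitions $\mathcal P=\{0=t_0<\dots<t_r=1\}$, $\|\mathcal P\|=\max_j(t_j-t_{j-1})$, the limit being in probability. Set functions whose difference $D$ satisfies $\langle D,D\rangle=0$ are identified. Let $\psi_{k,i}:=\frac{d(\Gamma_k(x,b_i)-\Gamma_k(x,a_i))}{\sqrt{dx}}$ for $k,i\in\mathbb N$. The Hilbert space is $\mathcal H=\overline{\mathrm{Sp}}\{\mathbb I_{P_i},\psi_{k,i}:i,k\in\mathbb N\}$ (closed span). The linear operator $\mathcal W:\mathcal H\to\mathcal H$ is defined by $$\mathcal W(\mathbb I_{P_i})=\psi_{1,i},\qquad \mathcal W(\psi_{k,i})=\beta_{k+1}\mathbb I_{P_i}+\psi_{k+1,i}-\beta_k\psi_{1,i}.$$ The spectral measure at $f$, normalized, is the probability measure $\mu_f$ with $\int t^l\,d\mu_f(t)=\langle f,\mathcal W^lf\rangle/\|f\|^2$ for all $l\ge0$ (the usual spectral measure $\langle f,E(\cdot)f\rangle$ divided by $\|f\|^2$). *)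

theory Defs
  imports "HOL-Probability.Probability"
begin

definition semicircle_law :: "real measure" where
  "semicircle_law =
     density lborel (\<lambda>x. ennreal (indicator {-2..2} x * (1 / (2 * pi) * sqrt (4 - x\<^sup>2))))"

definition \<beta> :: "nat \<Rightarrow> real" where
  "\<beta> l = (LINT x|semicircle_law. x ^ l)"

definition centered_gaussian :: "real \<Rightarrow> real measure" where
  "centered_gaussian \<sigma> =
     (if \<sigma> = 0 then return borel 0 else density lborel (\<lambda>x. ennreal (normal_density 0 \<sigma> x)))"

text \<open>Jointly Gaussian means that every finite linear combination is Gaussian, possibly degenerate.
  As the process is centered, the covariance is the expectation of the product.\<close>

definition brownian_sheet :: "'w measure \<Rightarrow> (real \<Rightarrow> real \<Rightarrow> 'w \<Rightarrow> real) \<Rightarrow> bool" where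
  "brownian_sheet M X \<longleftrightarrow>
     (\<forall>x\<in>{0..1}. \<forall>y\<in>{0..1}. X x y \<in> borel_measurable M) \<and>
     (\<forall>I c. finite I \<and> I \<subseteq> {0..1} \<times> {0..1} \<longrightarrow>
        (\<exists>\<sigma>\<ge>0. distr M borel (\<lambda>\<omega>. \<Sum>(x, y)\<in>I. c (x, y) * X x y \<omega>) = centered_gaussian \<sigma>)) \<and>
     (\<forall>x1\<in>{0..1}. \<forall>y1\<in>{0..1}. \<forall>x2\<in>{0..1}. \<forall>y2\<in>{0..1}.
        (LINT \<omega>|M. X x1 y1 \<omega> * X x2 y2 \<omega>) = min x1 x2 * min y1 y2) \<and>
     (AE \<omega> in M. continuous_on ({0..1} \<times> {0..1}) (\<lambda>(x, y). X x y \<omega>))"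

text \<open>Each sheet is regarded as one random element of the product space over the unit square.\<close>

definition independent_sheets :: "'w measure \<Rightarrow> (nat \<Rightarrow> real \<Rightarrow> real \<Rightarrow> 'w \<Rightarrow> real) \<Rightarrow> bool" where
  "independent_sheets M B \<longleftrightarrow>
     prob_space.indep_vars M (\<lambda>_. PiM ({0..1} \<times> {0..1}) (\<lambda>_. borel))
       (\<lambda>m \<omega>. \<lambda>(x, y)\<in>{0..1} \<times> {0..1}. B m x y \<omega>) {1..}"

definition C_sheet :: "(nat \<Rightarrow> real \<Rightarrow> real \<Rightarrow> 'w \<Rightarrow> real) \<Rightarrow> nat \<Rightarrow> real \<Rightarrow> real \<Rightarrow> 'w \<Rightarrow> real" where
  "C_sheet B l x y \<omega> =
     (\<Sum>m | 1 \<le> m \<and> m \<le> l \<and> even (l - m).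
        real (m + 1) / real (l + 1) * real ((l + 1) choose ((l - m) div 2)) * B m x y \<omega>)"

definition \<Gamma>_sheet :: "(nat \<Rightarrow> real \<Rightarrow> real \<Rightarrow> 'w \<Rightarrow> real) \<Rightarrow> nat \<Rightarrow> real \<Rightarrow> real \<Rightarrow> 'w \<Rightarrow> real" where
  "\<Gamma>_sheet B l x y \<omega> = 1 / sqrt 2 * (C_sheet B l x y \<omega> + C_sheet B l y x \<omega>)"

text \<open>The half-open interval from \<open>s\<close> (excluded) to \<open>t\<close> (included), with
  \<open>0 \<le> s < t \<le> 1\<close>, is represented by the pair of arguments \<open>s t\<close>; values at other
  arguments are irrelevant. The last argument is the sample point.\<close>

type_synonym 'w setfun = "real \<Rightarrow> real \<Rightarrow> 'w \<Rightarrow> real"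

definition random_setfun :: "'w measure \<Rightarrow> 'w setfun \<Rightarrow> bool" where
  "random_setfun M F \<longleftrightarrow> (\<forall>s t. 0 \<le> s \<and> s < t \<and> t \<le> 1 \<longrightarrow> F s t \<in> borel_measurable M)"

definition sf_lincomb :: "real \<Rightarrow> 'w setfun \<Rightarrow> real \<Rightarrow> 'w setfun \<Rightarrow> 'w setfun" where
  "sf_lincomb c F d G = (\<lambda>s t \<omega>. c * F s t \<omega> + d * G s t \<omega>)"

definition sf_diff :: "'w setfun \<Rightarrow> 'w setfun \<Rightarrow> 'w setfun" where
  "sf_diff F G = (\<lambda>s t \<omega>. F s t \<omega> - G s t \<omega>)"

definition sf_span :: "'w setfun set \<Rightarrow> 'w setfun set" where
  "sf_span S = {(\<lambda>s t \<omega>. \<Sum>F\<in>T. c F * F s t \<omega>) | T c. finite T \<and> T \<subseteq> S}"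

definition average_sf :: "(real \<Rightarrow> real) \<Rightarrow> 'w setfun" where
  "average_sf f = (\<lambda>s t \<omega>. 1 / (t - s) * (LINT x:{s<..t}|lebesgue. f x))"

definition d_over_sqrt_dx :: "(real \<Rightarrow> 'w \<Rightarrow> real) \<Rightarrow> 'w setfun" where
  "d_over_sqrt_dx F = (\<lambda>s t \<omega>. (F t \<omega> - F s \<omega>) / sqrt (t - s))"

definition is_partition :: "real list \<Rightarrow> bool" where
  "is_partition ts \<longleftrightarrow> ts \<noteq> [] \<and> hd ts = 0 \<and> last ts = 1 \<and> sorted_wrt (<) ts"

definition mesh :: "real list \<Rightarrow> real" where
  "mesh ts = Max ((\<lambda>j. ts ! Suc j - ts ! j) ` {..<length ts - 1})"

definition partition_filter :: "real list filter" where
  "partition_filter = inf (filtercomap mesh (at_right 0)) (principal {ts. is_partition ts})"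

definition partition_sum :: "'w setfun \<Rightarrow> 'w setfun \<Rightarrow> real list \<Rightarrow> 'w \<Rightarrow> real" where
  "partition_sum F G ts \<omega> =
     (\<Sum>j<length ts - 1. F (ts ! j) (ts ! Suc j) \<omega> * G (ts ! j) (ts ! Suc j) \<omega> * (ts ! Suc j - ts ! j))"

definition has_inner :: "'w measure \<Rightarrow> 'w setfun \<Rightarrow> 'w setfun \<Rightarrow> ('w \<Rightarrow> real) \<Rightarrow> bool" where
  "has_inner M F G Z \<longleftrightarrow>
     random_setfun M F \<and> random_setfun M G \<and> Z \<in> borel_measurable M \<and>
     (\<forall>\<epsilon>>0. ((\<lambda>ts. measure M {\<omega> \<in> space M. \<bar>partition_sum F G ts \<omega> - Z \<omega>\<bar> > \<epsilon>}) \<longlongrightarrow> 0)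
        partition_filter)"

definition sf_equiv :: "'w measure \<Rightarrow> 'w setfun \<Rightarrow> 'w setfun \<Rightarrow> bool" where
  "sf_equiv M F G \<longleftrightarrow> has_inner M (sf_diff F G) (sf_diff F G) (\<lambda>_. 0)"

text \<open>The squared distances are random variables; they are required to tend to 0 almost surely.\<close>

definition sf_tendsto :: "'w measure \<Rightarrow> (nat \<Rightarrow> 'w setfun) \<Rightarrow> 'w setfun \<Rightarrow> bool" where
  "sf_tendsto M X F \<longleftrightarrow>
     (\<exists>Z. (\<forall>n. has_inner M (sf_diff (X n) F) (sf_diff (X n) F) (Z n)) \<and>
          (AE \<omega> in M. (\<lambda>n. Z n \<omega>) \<longlonglongrightarrow> 0))"

definition ind_sf :: "(nat \<Rightarrow> real) \<Rightarrow> (nat \<Rightarrow> real) \<Rightarrow> nat \<Rightarrow> 'w setfun" where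
  "ind_sf a b i = average_sf (indicator {a i<..b i})"

definition \<psi>_sf :: "(nat \<Rightarrow> real \<Rightarrow> real \<Rightarrow> 'w \<Rightarrow> real) \<Rightarrow> (nat \<Rightarrow> real) \<Rightarrow> (nat \<Rightarrow> real)
    \<Rightarrow> nat \<Rightarrow> nat \<Rightarrow> 'w setfun" where
  "\<psi>_sf B a b k i = d_over_sqrt_dx (\<lambda>x \<omega>. \<Gamma>_sheet B k x (b i) \<omega> - \<Gamma>_sheet B k x (a i) \<omega>)"

definition sheet_span :: "(nat \<Rightarrow> real \<Rightarrow> real \<Rightarrow> 'w \<Rightarrow> real) \<Rightarrow> (nat \<Rightarrow> real) \<Rightarrow> (nat \<Rightarrow> real)
    \<Rightarrow> 'w setfun set" where
  "sheet_span B a b = sf_span (range (ind_sf a b) \<union> {\<psi>_sf B a b k i | k i. k \<ge> 1})"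

definition sheet_space :: "'w measure \<Rightarrow> (nat \<Rightarrow> real \<Rightarrow> real \<Rightarrow> 'w \<Rightarrow> real) \<Rightarrow> (nat \<Rightarrow> real)
    \<Rightarrow> (nat \<Rightarrow> real) \<Rightarrow> 'w setfun set" where
  "sheet_space M B a b =
     {F. random_setfun M F \<and> (\<exists>X. (\<forall>n. X n \<in> sheet_span B a b) \<and> sf_tendsto M X F)}"

text \<open>The values on the generators determine a linear operator only on the span of the generators.
  The last clause says that its values on the closed span are obtained by approximation, i.e. that
  the graph lies in the closure of the graph of the restriction to the span. Boundedness is
  not assumed. All equations hold modulo the identification of set functions.\<close>

definition is_W :: "'w measure \<Rightarrow> (nat \<Rightarrow> real \<Rightarrow> real \<Rightarrow> 'w \<Rightarrow> real) \<Rightarrow> (nat \<Rightarrow> real)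
    \<Rightarrow> (nat \<Rightarrow> real) \<Rightarrow> ('w setfun \<Rightarrow> 'w setfun) \<Rightarrow> bool" where
  "is_W M B a b W \<longleftrightarrow>
     (\<forall>F\<in>sheet_space M B a b. W F \<in> sheet_space M B a b) \<and>
     (\<forall>F\<in>sheet_space M B a b. \<forall>G\<in>sheet_space M B a b.
        sf_equiv M F G \<longrightarrow> sf_equiv M (W F) (W G)) \<and>
     (\<forall>F\<in>sheet_space M B a b. \<forall>G\<in>sheet_space M B a b. \<forall>c d.
        sf_equiv M (W (sf_lincomb c F d G)) (sf_lincomb c (W F) d (W G))) \<and>
     (\<forall>i. sf_equiv M (W (ind_sf a b i)) (\<psi>_sf B a b 1 i)) \<and>
     (\<forall>k\<ge>1. \<forall>i. sf_equiv M (W (\<psi>_sf B a b k i))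
        (\<lambda>s t \<omega>. \<beta> (k + 1) * ind_sf a b i s t \<omega> + \<psi>_sf B a b (k + 1) i s t \<omega>
                   - \<beta> k * \<psi>_sf B a b 1 i s t \<omega>)) \<and>
     (\<forall>F\<in>sheet_space M B a b. \<exists>X. (\<forall>n. X n \<in> sheet_span B a b) \<and>
        sf_tendsto M X F \<and> sf_tendsto M (\<lambda>n. W (X n)) (W F))"

text \<open>Below, \<open>q\<close> is a real-valued form on set functions, namely the inner product at one
  sample point; it is an inner product modulo the equivalence \<open>E\<close>.\<close>

definition hilbert_space_on ::
  "'w setfun set \<Rightarrow> ('w setfun \<Rightarrow> 'w setfun \<Rightarrow> bool) \<Rightarrow> ('w setfun \<Rightarrow> 'w setfun \<Rightarrow> real) \<Rightarrow> bool" where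
  "hilbert_space_on H E q \<longleftrightarrow>
     H \<noteq> {} \<and>
     (\<forall>F\<in>H. \<forall>G\<in>H. \<forall>c d. sf_lincomb c F d G \<in> H) \<and>
     (\<forall>F\<in>H. \<forall>G\<in>H. q F G = q G F) \<and>
     (\<forall>F\<in>H. \<forall>G\<in>H. \<forall>K\<in>H. \<forall>c d. q (sf_lincomb c F d G) K = c * q F K + d * q G K) \<and>
     (\<forall>F\<in>H. q F F \<ge> 0) \<and>
     (\<forall>F\<in>H. \<forall>G\<in>H. q (sf_diff F G) (sf_diff F G) = 0 \<longleftrightarrow> E F G) \<and>
     (\<forall>X. (\<forall>n. X n \<in> H) \<and>
        (\<forall>\<epsilon>>0. \<exists>N. \<forall>m\<ge>N. \<forall>n\<ge>N. sqrt (q (sf_diff (X m) (X n)) (sf_diff (X m) (X n))) < \<epsilon>) \<longrightarrow>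
        (\<exists>F\<in>H. (\<lambda>n. sqrt (q (sf_diff (X n) F) (sf_diff (X n) F))) \<longlonglongrightarrow> 0))"

definition bounded_operator_on ::
  "'w setfun set \<Rightarrow> ('w setfun \<Rightarrow> 'w setfun \<Rightarrow> real) \<Rightarrow> ('w setfun \<Rightarrow> 'w setfun) \<Rightarrow> bool" where
  "bounded_operator_on H q W \<longleftrightarrow> (\<exists>C. \<forall>F\<in>H. sqrt (q (W F) (W F)) \<le> C * sqrt (q F F))"

definition self_adjoint_on ::
  "'w setfun set \<Rightarrow> ('w setfun \<Rightarrow> 'w setfun \<Rightarrow> real) \<Rightarrow> ('w setfun \<Rightarrow> 'w setfun) \<Rightarrow> bool" where
  "self_adjoint_on H q W \<longleftrightarrow> (\<forall>F\<in>H. \<forall>G\<in>H. q (W F) G = q F (W G))"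

definition is_spectral_measure ::
  "('w setfun \<Rightarrow> 'w setfun \<Rightarrow> real) \<Rightarrow> ('w setfun \<Rightarrow> 'w setfun) \<Rightarrow> 'w setfun \<Rightarrow> real measure \<Rightarrow> bool" where
  "is_spectral_measure q W F \<mu> \<longleftrightarrow>
     prob_space \<mu> \<and> sets \<mu> = sets borel \<and>
     (\<forall>l. integrable \<mu> (\<lambda>t. t ^ l) \<and> (LINT t|\<mu>. t ^ l) = q F ((W ^^ l) F) / q F F)"

end

(* With U_0, U_1, ... the orthonormal polynomials of the semicircular law, x^k is the sum over m of
   ballot k m * U_m(x), so the map taking (indicator of P_i) * U_m to the indicator of P_i (m = 0) or to
   the symmetrized increments of the m-th sheet (m >= 1) takes (indicator of P_i) * (x^k - beta k) to psi k i.
   All inner products of generators are deterministic: quadratic variations of Gaussian increments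
   concentrate, because by Wick's formula their variances are of the order of the mesh, and the map above is
   an isometry of L^2[0,1] tensor L^2(semicircle) onto the Hilbert space. It carries multiplication by x to W.
   Hence W is the free Jacobi matrix in the index m, it has norm at most 2, and the spectral
   measure at any function of the first factor is the semicircular law.
   The limits needed for completeness exist because E of every partition sum of F with itself is at most
   twice the squared norm of F, uniformly in the partition. *)

theory Submission
  imports Defs
begin

text \<open>The obstacle is the closure. Its elements are concrete set functions, and the definition
  does not provide them with inner products among each other, nor does it show that sums stay in the
  closure. The weaker notion \<open>prob_conv\<close>, in which no squared distance is assumed to
  exist, is stable under linear combinations, and the existence of norms is recovered from it.
  Completeness asks for an actual set function as a limit: the uniform second moment bound makes a
  fast subsequence converge almost surely on each single interval, and as a partition has only
  finitely many intervals, one null set per partition is enough although there are uncountably many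
  intervals. Because all inner products are constants, one form serves at every sample point, so
  uncountably many vectors do not accumulate null sets. The subtraction of \<open>\<beta> k\<close>
  occurs because the sum in \<open>C_sheet\<close> starts at m = 1: \<open>\<psi>_sf\<close> lacks
  the part of x^k at U_0, whose coefficient is the k-th moment.\<close>

section \<open>Moments of the semicircular law\<close>

text \<open>\<open>ballot k m\<close> is the coefficient of \<open>x\<^sup>k\<close> at the \<open>m\<close>-th Chebyshev polynomial \<open>U\<^sub>m(x/2)\<close>; these
  polynomials are orthonormal for the semicircular law.\<close>

definition ballot :: "nat \<Rightarrow> nat \<Rightarrow> real" where
  "ballot k m = (if m \<le> k \<and> even (k - m)
     then real (m + 1) / real (k + 1) * real ((k + 1) choose ((k - m) div 2)) else 0)"

text \<open>The reflection principle: j is the number of down-steps, and k choose (j - 1) counts the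
  paths that go below 0, so \<open>ballot k m\<close> counts the nonnegative lattice paths of length
  k from 0 to m. In this form Pascal's rule yields the recursion.\<close>

lemma ballot_diff:
  assumes "m + 2 * j = k"
  shows "ballot k m = real (k choose j) - (if j = 0 then 0 else real (k choose (j - 1)))"
proof (cases j)
  case 0
  then show ?thesis using assms by (simp add: ballot_def)
next
  case (Suc i)
  have k: "k = m + 2 * Suc i" using assms Suc by simp
  have 1: "real (Suc i) * real (k choose Suc i) = real (k - i) * real (k choose i)"
    using binomial_absorb_comp[of k i] binomial_absorption[of i "k"] 
    by (metis (no_types) Suc_times_binomial_eq binomial_absorb_comp binomial_absorption of_nat_mult
      diff_Suc_1 mult.commute times_binomial_minus1_eq zero_less_Suc)
  have 2: "real ((k + 1) choose Suc i) = real (k choose i) + real (k choose Suc i)" by simp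
  have ki: "real (k - i) = real m + real i + 2" using k by simp
  have kk: "real k = real m + 2 * real i + 2" using k by simp
  have "(real m + 1) * (real (k choose i) + real (k choose Suc i)) 
      = (real k + 1) * (real (k choose Suc i) - real (k choose i))"
  proof -
    have "real (k choose Suc i) = (real m + real i + 2) * real (k choose i) / (real i + 1)"
      using 1 ki by (simp add: field_simps)
    moreover have "(real i + 1) \<noteq> 0" by linarith
    ultimately show ?thesis unfolding kk by (simp add: field_simps)
  qed
  then have "(real m + 1) / (real k + 1) * (real (k choose i) + real (k choose Suc i))
     = real (k choose Suc i) - real (k choose i)"
    by (simp add: field_simps add_eq_0_iff)
  moreover have "even (k - m)" "(k - m) div 2 = Suc i" "m \<le> k" using k by auto
  ultimately show ?thesis using 2 Suc by (simp add: ballot_def add.commute)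
qed

lemma ballot_odd: "odd (k + m) \<Longrightarrow> ballot k m = 0"
  by (auto simp: ballot_def)

lemma ballot_eq_0: "k < m \<Longrightarrow> ballot k m = 0"
  by (simp add: ballot_def)

lemma ballot_self: "ballot k k = 1"
  by (simp add: ballot_def)

text \<open>A nonnegative path that ends at height m came from m + 1 or from m - 1. This is the
  transposed form of x U_m = U_(m+1) + U_(m-1), which turns multiplication by x into a Jacobi
  matrix.\<close>

lemma ballot_Suc:
  "ballot (Suc k) m = ballot k (Suc m) + (if m = 0 then 0 else ballot k (m - 1))"
proof (cases "odd (Suc k + m) \<or> Suc k < m")
  case True
  then show ?thesis by (auto simp: ballot_odd ballot_eq_0)
next
  case False
  then obtain j where j: "m + 2 * j = Suc k"
    by (metis even_diff_nat dvd_def le_add_diff_inverse not_less)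
  have L: "ballot (Suc k) m = real (Suc k choose j) - (if j = 0 then 0 else real (Suc k choose (j - 1)))"
    by (rule ballot_diff[OF j])
  show ?thesis
  proof (cases j)
    case 0
    then have m: "m = Suc k" using j by simp
    show ?thesis by (simp add: m ballot_self ballot_eq_0)
  next
    case (Suc i)
    have 1: "ballot k (Suc m) = real (k choose i) - (if i = 0 then 0 else real (k choose (i - 1)))"
      using ballot_diff[of "Suc m" i k] j Suc by simp
    show ?thesis
    proof (cases m)
      case 0
      \<comment> \<open>At height 0 there is no lower predecessor; the recursion survives because
        the two middle binomial coefficients of an odd row coincide.\<close>
      have "k = 2 * i + 1" using j Suc 0 by simp
      then have "k choose Suc i = k choose i" using binomial_symmetric[of i k] by simp
      then show ?thesis using L 1 0 Suc by (cases i) auto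
    next
      case (Suc n)
      have 2: "ballot k n = real (k choose j) - (if j = 0 then 0 else real (k choose (j - 1)))"
        using ballot_diff[of n j k] j Suc by simp
      show ?thesis using L 1 2 Suc \<open>j = Suc i\<close> by (cases i) auto
    qed
  qed
qed

text \<open>The Catalan recursion (k + 2) C(k+1) = 2 (2k + 1) C(k) with n = 2k, written so that it
  has the shape that integration by parts gives for the moments; for odd n both sides
  vanish.\<close>

lemma ballot_Catalan_rec:
  "(real n + 4) * ballot (Suc (Suc n)) 0 = 4 * (real n + 1) * ballot n 0"
proof (cases "even n")
  case False
  then show ?thesis by (simp add: ballot_odd)
next
  case True
  then obtain k where n: "n = 2 * k" by blast
  \<comment> \<open>The closed form C(k) = (2k)! / (k! (k+1)!) without denominators, which reduces
    the recursion to a comparison of factorials.\<close>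
  have f: "ballot (2 * k) 0 * (fact k * fact (Suc k)) = fact (2 * k)" for k
  proof -
    have "fact (k) * fact (Suc k) * ((2 * k + 1) choose k) = (fact (2 * k + 1) :: nat)"
      using binomial_fact_lemma[of k "2 * k + 1"] by simp
    then have "fact k * fact (Suc k) * real ((2 * k + 1) choose k) = fact (2 * k + 1)"
      by (metis of_nat_fact of_nat_mult)
    then have "fact k * fact (Suc k) * real ((2 * k + 1) choose k) = (2 * real k + 1) * fact (2 * k)"
      by simp
    then show ?thesis
      by (simp add: ballot_def field_simps add_eq_0_iff del: fact_Suc)
  qed
  have "ballot (2 * Suc k) 0 * (fact (Suc k) * fact (Suc (Suc k))) 
      = (2 * real k + 2) * ((2 * real k + 1) * fact (2 * k))"
    unfolding f by (simp add: algebra_simps)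
  also have "\<dots> = (2 * real k + 2) * (2 * real k + 1) * (ballot (2 * k) 0 * (fact k * fact (Suc k)))"
    unfolding f by simp
  finally have "(ballot (2 * Suc k) 0 * (real k + 2)) * ((real k + 1) * (fact k * fact (Suc k)))
     = (2 * (2 * real k + 1) * ballot (2 * k) 0) * ((real k + 1) * (fact k * fact (Suc k)))"
    by (simp add: algebra_simps)
  moreover have "(real k + 1) * (fact k * fact (Suc k)) \<noteq> (0::real)" 
    by (simp add: add_eq_0_iff del: fact_Suc)
  ultimately have "ballot (2 * Suc k) 0 * (real k + 2) = 2 * (2 * real k + 1) * ballot (2 * k) 0"
    using mult_right_cancel by blast
  then show ?thesis by (simp add: n algebra_simps)
qed

section \<open>Moments of the semicircle density by integration\<close>

lemma semicircle_density_integrable: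
  "integrable lborel (\<lambda>x::real. indicator {-2..2} x * (sqrt (4 - x\<^sup>2) * x ^ l))"
  using borel_integrable_compact[of "{-2..2}" "\<lambda>x. sqrt (4 - x\<^sup>2) * x ^ l"]
  by (simp add: continuous_intros)

lemma semicircle_integrable: "integrable semicircle_law (\<lambda>x. x ^ l)"
  and \<beta>_lborel: "\<beta> l = 1 / (2 * pi) * (LINT x|lborel. indicator {-2..2} x * (sqrt (4 - x\<^sup>2) * x ^ l))"
proof -
  have nn: "0 \<le> indicator {-2..2} x * (1 / (2 * pi) * sqrt (4 - x\<^sup>2))" for x :: real
  proof (cases "x \<in> {-2..2}")
    case True
    then have "x\<^sup>2 \<le> 2\<^sup>2" by (intro abs_le_square_iff[THEN iffD1]) auto
    then show ?thesis by simp
  qed auto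
  have eq: "(\<lambda>x. (indicator {-2..2} x * (1 / (2 * pi) * sqrt (4 - x\<^sup>2))) * x ^ l)
    = (\<lambda>x::real. 1 / (2 * pi) * (indicator {-2..2} x * (sqrt (4 - x\<^sup>2) * x ^ l)))"
    by auto
  show "integrable semicircle_law (\<lambda>x. x ^ l)"
    unfolding semicircle_law_def
    using nn semicircle_density_integrable[of l]
    by (subst integrable_density) (simp_all only: real_scaleR_def eq AE_I2 integrable_mult_right, measurable)
  show "\<beta> l = 1 / (2 * pi) * (LINT x|lborel. indicator {-2..2} x * (sqrt (4 - x\<^sup>2) * x ^ l))"
    unfolding semicircle_law_def \<beta>_def
    using nn by (subst integral_density) (simp_all only: real_scaleR_def eq AE_I2 integral_mult_right_zero, measurable)
qed

lemma \<beta>_has_integral: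
  assumes "((\<lambda>x. sqrt (4 - x\<^sup>2) * x ^ l) has_integral I) {-2..2}"
  shows "\<beta> l = I / (2 * pi)"
proof -
  have "set_integrable lborel {-2..2} (\<lambda>x::real. sqrt (4 - x\<^sup>2) * x ^ l)"
    using semicircle_density_integrable[of l] by (simp add: set_integrable_def)
  from set_borel_integral_eq_integral[OF this]
  have "(LINT x:{-2..2}|lborel. sqrt (4 - x\<^sup>2) * x ^ l) = I" using assms by (simp add: integral_unique)
  then show ?thesis by (simp add: \<beta>_lborel set_lebesgue_integral_def)
qed

text \<open>Integration by parts: x^n (4 - x^2)^(3/2) vanishes at both ends of the support, and its
  derivative is sqrt(4 - x^2) times 4 n x^(n-1) - (n + 3) x^(n+1). For n = 0 it says that the mean
  is 0.\<close>

lemma \<beta>_rec0: "(real n + 3) * \<beta> (Suc n) = (if n = 0 then 0 else 4 * real n * \<beta> (n - 1))"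
proof -
  let ?s = "\<lambda>x::real. sqrt (4 - x\<^sup>2)"
  let ?F = "\<lambda>x::real. x ^ n * ((4 - x\<^sup>2) * ?s x)"
  let ?I = "\<lambda>l. LINT x|lborel. indicator {-2..2} x * (?s x * x ^ l)"
  have hi: "((\<lambda>x. ?s x * x ^ l) has_integral (2 * pi * \<beta> l)) {-2..2}" for l
  proof -
    have "(\<lambda>x. ?s x * x ^ l) integrable_on {-2..2}"
      by (intro integrable_continuous_interval continuous_intros)
    then obtain I where I: "((\<lambda>x. ?s x * x ^ l) has_integral I) {-2..2}" by blast
    from \<beta>_has_integral[OF this] have "I = 2 * pi * \<beta> l" by simp
    with I show ?thesis by simp
  qed
  let ?f = "\<lambda>x. (if n = 0 then 0 else 4 * real n * (?s x * x ^ (n - 1))) - (real n + 3) * (?s x * x ^ (Suc n))"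
  have "(?f has_integral (?F 2 - ?F (-2))) {-2..2}"
  proof (rule fundamental_theorem_of_calculus_interior)
    show "continuous_on {-2..2} ?F" by (intro continuous_intros)
    fix x :: real assume x: "x \<in> {-2<..<2}"
    then have "x\<^sup>2 < 2\<^sup>2" by (intro abs_square_less_1[THEN iffD2] power2_strict_mono) auto
    then have p: "4 - x\<^sup>2 > 0" by simp
    have sq: "?s x * ?s x = 4 - x\<^sup>2" using p by simp
    have d: "(?F has_real_derivative (real n * x ^ (n - 1) * ((4 - x\<^sup>2) * ?s x)
        + x ^ n * ((- 2 * x) * ?s x + (4 - x\<^sup>2) * (inverse (?s x) / 2 * (- 2 * x))))) (at x)"
      using p by (auto intro!: derivative_eq_intros simp: algebra_simps)
    have "(4 - x\<^sup>2) * inverse (?s x) = ?s x" using p by (metis inverse_eq_divide mult.right_neutral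
        real_div_sqrt times_divide_eq_right less_imp_le)
    then have "(4 - x\<^sup>2) * inverse (?s x) * (- x) = ?s x * (- x)" by simp
    then have "(4 - x\<^sup>2) * (inverse (?s x) / 2 * (- 2 * x)) = - x * ?s x" by (simp add: algebra_simps)
    then have "real n * x ^ (n - 1) * ((4 - x\<^sup>2) * ?s x)
        + x ^ n * ((- 2 * x) * ?s x + (4 - x\<^sup>2) * (inverse (?s x) / 2 * (- 2 * x))) = ?f x"
      by (simp only: \<open>(4 - x\<^sup>2) * (inverse (?s x) / 2 * (- 2 * x)) = - x * ?s x\<close>)
        (cases n; simp add: algebra_simps power2_eq_square)
    with d show "(?F has_vector_derivative ?f x) (at x)"
      by (simp add: has_real_derivative_iff_has_vector_derivative)
  qed auto
  moreover have "(?f has_integral ((if n = 0 then 0 else 4 * real n * (2 * pi * \<beta> (n - 1)))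
      - (real n + 3) * (2 * pi * \<beta> (Suc n)))) {-2..2}"
    using has_integral_mult_right[OF hi, of "4 * real n" "n - 1"]
    by (intro has_integral_diff has_integral_mult_right hi) auto
  ultimately have "(if n = 0 then 0 else 4 * real n * (2 * pi * \<beta> (n - 1)))
      - (real n + 3) * (2 * pi * \<beta> (Suc n)) = ?F 2 - ?F (-2)"
    using has_integral_unique by blast
  then have "(2 * pi) * ((real n + 3) * \<beta> (Suc n)) = (2 * pi) * (if n = 0 then 0 else 4 * real n * \<beta> (n - 1))"
    by (cases "n = 0") (simp_all add: algebra_simps)
  then show ?thesis by simp
qed

text \<open>The antiderivative x sqrt(4 - x^2) / 2 + 2 arcsin(x/2) of sqrt(4 - x^2) grows by 2 pi
  over the support. The argument stays in the open interval, where both square roots are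
  differentiable.\<close>

lemma \<beta>_0: "\<beta> 0 = 1"
proof -
  let ?s = "\<lambda>x::real. sqrt (4 - x\<^sup>2)"
  let ?F = "\<lambda>x::real. x * ?s x / 2 + 2 * arcsin (x / 2)"
  have "((\<lambda>x. ?s x) has_integral (?F 2 - ?F (-2))) {-2..2}"
  proof (rule fundamental_theorem_of_calculus_interior)
    show "continuous_on {-2..2} ?F" by (intro continuous_intros) auto
    fix x :: real assume x: "x \<in> {-2<..<2}"
    then have "x\<^sup>2 < 2\<^sup>2" by (intro abs_square_less_1[THEN iffD2] power2_strict_mono) auto
    then have p: "4 - x\<^sup>2 > 0" by simp
    have r: "sqrt (1 - (x / 2)\<^sup>2) = ?s x / 2"
    proof -
      have "1 - (x / 2)\<^sup>2 = (4 - x\<^sup>2) / 4" by (simp add: field_simps)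
      then have "sqrt (1 - (x / 2)\<^sup>2) = sqrt ((4 - x\<^sup>2) / 4)" by (rule arg_cong)
      then show ?thesis by (simp only: real_sqrt_divide real_sqrt_four)
    qed
    have "(?F has_real_derivative ((?s x + x * (inverse (?s x) / 2 * (- 2 * x))) / 2 
        + 2 * (inverse (sqrt (1 - (x / 2)\<^sup>2)) / 2))) (at x)"
      using p x by (auto intro!: derivative_eq_intros simp: field_simps)
    moreover have "(?s x + x * (inverse (?s x) / 2 * (- 2 * x))) / 2 
        + 2 * (inverse (sqrt (1 - (x / 2)\<^sup>2)) / 2) = ?s x"
    proof -
      have "?s x \<noteq> 0" "?s x * ?s x = 4 - x\<^sup>2" using p by auto
      then show ?thesis unfolding r by (simp add: field_simps power2_eq_square)
    qed
    ultimately show "(?F has_vector_derivative ?s x) (at x)"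
      by (simp add: has_real_derivative_iff_has_vector_derivative)
  qed auto
  then have "((\<lambda>x. ?s x * x ^ 0) has_integral (2 * pi)) {-2..2}" by simp
  from \<beta>_has_integral[OF this] show ?thesis by simp
qed

text \<open>Both sides satisfy the same two-step recursion and agree at 0 and 1. It identifies the
  constants in the rule for W with the coefficients of x^n at U_0.\<close>

lemma \<beta>_ballot: "\<beta> n = ballot n 0"
proof (induction n rule: less_induct)
  case (less n)
  show ?case
  proof (cases "n \<le> 1")
    case True
    then consider "n = 0" | "n = 1" by linarith
    then show ?thesis using \<beta>_rec0[of 0] by cases (auto simp: \<beta>_0 ballot_self ballot_odd)
  next
    case False
    then obtain m where m: "n = Suc (Suc m)" by (metis One_nat_def Suc_leI le_0_eq not0_implies_Suc not_less_eq_eq)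
    have "(real m + 4) * \<beta> n = 4 * (real m + 1) * \<beta> m" using \<beta>_rec0[of "Suc m"] m by (simp add: algebra_simps)
    moreover have "(real m + 4) * ballot n 0 = 4 * (real m + 1) * ballot m 0" 
      using ballot_Catalan_rec[of m] m by simp
    ultimately have "(real m + 4) * \<beta> n = (real m + 4) * ballot n 0" using less[of m] m by simp
    moreover have "real m + 4 \<noteq> 0" by linarith
    ultimately show ?thesis using mult_left_cancel by blast
  qed
qed

lemma prob_space_semicircle: "prob_space semicircle_law"
proof
  have i: "integrable semicircle_law (\<lambda>x. 1::real)" "(LINT x|semicircle_law. (1::real)) = 1"
    using semicircle_integrable[of 0] \<beta>_0 by (simp_all add: \<beta>_def)
  then show "emeasure semicircle_law (space semicircle_law) = 1"
    using nn_integral_eq_integral[OF i(1)] by simp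
qed

lemma sets_semicircle [simp]: "sets semicircle_law = sets borel"
  by (simp add: semicircle_law_def)

text \<open>By the recursion consecutive even moments have ratio 4 (2n + 1) / (2n + 4), which is at
  most 4 and reflects the support [-2, 2]. This geometric growth makes the Taylor remainders of the
  characteristic function vanish.\<close>

lemma \<beta>_even_le: "\<beta> (2 * n) \<le> 4 ^ n" and \<beta>_even_ge: "0 \<le> \<beta> (2 * n)"
proof -
  have "0 \<le> \<beta> (2 * n) \<and> \<beta> (2 * n) \<le> 4 ^ n"
  proof (induction n)
    case 0
    then show ?case by (simp add: \<beta>_0)
  next
    case (Suc n)
    have *: "(real (2 * n) + 4) * \<beta> (2 * Suc n) = 4 * (real (2 * n) + 1) * \<beta> (2 * n)"
      using ballot_Catalan_rec[of "2 * n"] by (simp add: \<beta>_ballot)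
    have "\<beta> (2 * Suc n) = 4 * ((real (2 * n) + 1) / (real (2 * n) + 4) * \<beta> (2 * n))"
      using * by (simp add: field_simps)
    moreover have "(real (2 * n) + 1) / (real (2 * n) + 4) \<le> 1" "0 \<le> (real (2 * n) + 1) / (real (2 * n) + 4)"
      by simp_all
    then have "(real (2 * n) + 1) / (real (2 * n) + 4) * \<beta> (2 * n) \<le> 1 * 4 ^ n"
      "0 \<le> (real (2 * n) + 1) / (real (2 * n) + 4) * \<beta> (2 * n)"
      using Suc by (intro mult_mono mult_nonneg_nonneg; simp)+
    ultimately show ?case by (simp only:) simp
  qed
  then show "\<beta> (2 * n) \<le> 4 ^ n" "0 \<le> \<beta> (2 * n)" by auto
qed

text \<open>Moments growing at most geometrically make the Taylor series of the characteristic
  function converge to it, so they determine the distribution.\<close>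

lemma semicircle_moments_unique:
  assumes \<mu>: "prob_space \<mu>" "sets \<mu> = sets borel"
    and int: "\<And>l. integrable \<mu> (\<lambda>t. t ^ l)" and mom: "\<And>l. (LINT t|\<mu>. t ^ l) = \<beta> l"
  shows "\<mu> = semicircle_law"
proof (rule Levy_uniqueness)
  have rd: "real_distribution N" if "prob_space N" "sets N = sets borel" for N :: "real measure"
    using that by (simp add: real_distribution_def real_distribution_axioms_def)
  show "real_distribution \<mu>" "real_distribution semicircle_law"
    using \<mu> prob_space_semicircle by (simp_all add: rd)
  \<comment> \<open>Only Taylor polynomials of even degree are taken: the remainder contains the
    absolute moment of that order, which for even order is the moment itself.\<close>
  have lim: "(\<lambda>n::nat. \<Sum>k\<le>2 * n. ((\<i> * complex_of_real t) ^ k / fact k) * \<beta> k) \<longlonglongrightarrow> char N t"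
    if N: "prob_space N" "sets N = sets borel" "\<And>l. integrable N (\<lambda>t. t ^ l)" "\<And>l. (LINT t|N. t ^ l) = \<beta> l"
    for N :: "real measure" and t :: real
  proof -
    interpret real_distribution N using N rd by blast
    have "(\<lambda>n::nat. char N t - (\<Sum>k\<le>2 * n. ((\<i> * complex_of_real t) ^ k / fact k) * \<beta> k)) \<longlonglongrightarrow> 0"
    proof (rule tendsto_norm_zero_cancel, rule tendsto_sandwich[OF _ _ tendsto_const])
      show "\<forall>\<^sub>F n::nat in sequentially. cmod (char N t - (\<Sum>k\<le>2 * n. ((\<i> * complex_of_real t) ^ k / fact k) * \<beta> k))
          \<le> 2 * ((2 * \<bar>t\<bar>) ^ (2 * n) / fact (2 * n))"
      proof (rule always_eventually, rule allI)
        fix n :: nat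
        have "cmod (char N t - (\<Sum>k\<le>2 * n. ((\<i> * complex_of_real t) ^ k / fact k) * \<beta> k)) \<le> 2 * \<bar>t\<bar> ^ (2 * n) / fact (2 * n) * \<beta> (2 * n)"
          using char_approx1[where n = "2 * n" and t = t, OF N(3)] N(4)
          by (simp add: power_even_abs)
        also have "\<dots> \<le> 2 * \<bar>t\<bar> ^ (2 * n) / fact (2 * n) * 4 ^ n"
          by (intro mult_left_mono \<beta>_even_le) simp
        also have "\<dots> = 2 * ((2 * \<bar>t\<bar>) ^ (2 * n) / fact (2 * n))"
          using power_mult[of "2::real" 2 n] by (simp add: power_mult_distrib)
        finally show "cmod (char N t - (\<Sum>k\<le>2 * n. ((\<i> * complex_of_real t) ^ k / fact k) * \<beta> k))
          \<le> 2 * ((2 * \<bar>t\<bar>) ^ (2 * n) / fact (2 * n))" .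
      qed
      have "(\<lambda>n::nat. (2 * \<bar>t\<bar>) ^ n / fact n) \<longlonglongrightarrow> 0"
        using summable_LIMSEQ_zero[OF summable_exp_generic[of "2 * \<bar>t\<bar>"]] by (simp add: divide_inverse mult.commute)
      then have "(\<lambda>n::nat. (2 * \<bar>t\<bar>) ^ (2 * n) / fact (2 * n)) \<longlonglongrightarrow> 0"
        using LIMSEQ_subseq_LIMSEQ[of _ 0 "\<lambda>n. 2 * n"] by (fastforce simp: strict_mono_def o_def)
      from tendsto_mult_right_zero[OF this, of 2]
      show "(\<lambda>n::nat. 2 * ((2 * \<bar>t\<bar>) ^ (2 * n) / fact (2 * n))) \<longlonglongrightarrow> 0" .
    qed auto
    from tendsto_diff[OF tendsto_const this, of "char N t"] show ?thesis by simp
  qed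
  show "char \<mu> = char semicircle_law"
  proof
    fix t
    show "char \<mu> t = char semicircle_law t"
      using lim[OF \<mu> int mom, of t] 
        lim[OF prob_space_semicircle sets_semicircle semicircle_integrable \<beta>_def[symmetric], of t]
      by (rule LIMSEQ_unique)
  qed
qed

section \<open>Partition sums and limits in probability\<close>

lemma is_partitionD:
  assumes "is_partition ts"
  shows "length ts \<ge> 2" "ts ! 0 = 0" "ts ! (length ts - 1) = 1"
proof -
  have ne: "ts \<noteq> []" "hd ts = 0" "last ts = 1" using assms by (auto simp: is_partition_def)
  show "length ts \<ge> 2"
  proof (rule ccontr)
    assume "\<not> length ts \<ge> 2"
    then have "length ts = 1" using ne(1) by (cases ts) (auto simp: not_le Suc_le_eq)
    then have "hd ts = last ts" using ne by (cases ts) auto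
    then show False using ne by simp
  qed
  show "ts ! 0 = 0" "ts ! (length ts - 1) = 1" using ne by (simp_all add: hd_conv_nth last_conv_nth)
qed

lemma partition_mono:
  assumes "is_partition ts" "i \<le> j" "j < length ts"
  shows "ts ! i \<le> ts ! j"
  using assms sorted_wrt_nth_less[of "(<)" ts i j] by (cases "i = j") (auto simp: is_partition_def)

lemma partition_interval:
  assumes "is_partition ts" "j < length ts - 1"
  shows "0 \<le> ts ! j" "ts ! j < ts ! Suc j" "ts ! Suc j \<le> 1"
  using partition_mono[OF assms(1), of 0 j] partition_mono[OF assms(1), of "Suc j" "length ts - 1"]
    is_partitionD[OF assms(1)] sorted_wrt_nth_less[of "(<)" ts j "Suc j"] assms
  by (auto simp: is_partition_def)

lemma partition_sum_lengths:
  assumes "is_partition ts"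
  shows "(\<Sum>j<length ts - 1. ts ! Suc j - ts ! j) = 1"
  using sum_lessThan_telescope[of "\<lambda>j. ts ! j" "length ts - 1"] is_partitionD[OF assms] by simp

lemma partition_le_mesh:
  assumes "is_partition ts" "j < length ts - 1"
  shows "ts ! Suc j - ts ! j \<le> mesh ts"
  unfolding mesh_def using assms by (intro Max_ge) auto

lemma mesh_bounds:
  assumes "is_partition ts"
  shows "0 < mesh ts" "mesh ts \<le> 1"
proof -
  have l: "0 < length ts - 1" using is_partitionD(1)[OF assms] by simp
  then show "0 < mesh ts" using partition_le_mesh[OF assms l] partition_interval[OF assms l] by simp
  have "ts ! Suc j - ts ! j \<le> 1" if "j < length ts - 1" for j
    using partition_interval[OF assms that] by simp
  moreover have "{..<length ts - 1} \<noteq> {}" using l by (metis lessThan_iff empty_iff)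
  ultimately show "mesh ts \<le> 1" unfolding mesh_def by (intro Max.boundedI) auto
qed

lemma eventually_partition_filter:
  "eventually P partition_filter \<longleftrightarrow> (\<exists>\<delta>>0. \<forall>ts. is_partition ts \<and> mesh ts < \<delta> \<longrightarrow> P ts)"
proof
  assume "eventually P partition_filter"
  then obtain Q where Q: "eventually Q (at_right 0)" "\<And>ts. Q (mesh ts) \<Longrightarrow> is_partition ts \<Longrightarrow> P ts"
    by (auto simp: partition_filter_def eventually_inf_principal eventually_filtercomap)
  then obtain \<delta> where "\<delta> > 0" "\<And>y. 0 < y \<Longrightarrow> y < \<delta> \<Longrightarrow> Q y" 
    by (auto simp: eventually_at_right_field)
  then show "\<exists>\<delta>>0. \<forall>ts. is_partition ts \<and> mesh ts < \<delta> \<longrightarrow> P ts"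
    using Q(2) mesh_bounds(1) by blast
next
  assume "\<exists>\<delta>>0. \<forall>ts. is_partition ts \<and> mesh ts < \<delta> \<longrightarrow> P ts"
  then obtain \<delta> where "\<delta> > 0" and d: "\<And>ts. is_partition ts \<Longrightarrow> mesh ts < \<delta> \<Longrightarrow> P ts" by blast
  then have "eventually (\<lambda>y. y < \<delta>) (at_right 0)" by (auto simp: eventually_at_right_field)
  then show "eventually P partition_filter"
    unfolding partition_filter_def eventually_inf_principal eventually_filtercomap using d by blast
qed

lemma eventually_is_partition: "eventually is_partition partition_filter"
  unfolding eventually_partition_filter by (rule exI[of _ 1]) simp

text \<open>Equidistant partitions have arbitrarily small mesh. This makes limits along the filter
  unique and allows one to pick a single partition for which finitely many eventual statements
  hold.\<close>

lemma partition_filter_not_bot [simp]: "partition_filter \<noteq> bot"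
proof
  assume "partition_filter = bot"
  then have "eventually (\<lambda>_. False) partition_filter" by simp
  then obtain \<delta> :: real where \<delta>: "\<delta> > 0" and no: "\<And>ts. is_partition ts \<Longrightarrow> \<not> mesh ts < \<delta>"
    by (auto simp: eventually_partition_filter)
  obtain n :: nat where n: "1 / real (Suc n) < \<delta>" using \<delta> nat_approx_posE by metis
  define ts where "ts = map (\<lambda>i. real i / real (Suc n)) [0..<Suc (Suc n)]"
  have nth: "ts ! j = real j / real (Suc n)" if "j < Suc (Suc n)" for j
    using that by (auto simp: ts_def simp del: upt_Suc)
  have len: "length ts = Suc (Suc n)" by (simp add: ts_def)
  have "is_partition ts" 
    unfolding is_partition_def
  proof (intro conjI)
    show "ts \<noteq> []" using len by auto
    then show "hd ts = 0" "last ts = 1" by (simp_all add: hd_conv_nth last_conv_nth len nth)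
    show "sorted_wrt (<) ts" by (auto simp: sorted_wrt_iff_nth_less len nth divide_strict_right_mono)
  qed
  moreover have "mesh ts = 1 / real (Suc n)"
  proof -
    have "(\<lambda>j. ts ! Suc j - ts ! j) ` {..<length ts - 1} = {1 / real (Suc n)}"
    proof -
      have "ts ! Suc j - ts ! j = 1 / real (Suc n)" if "j < length ts - 1" for j
        using that by (simp add: nth len diff_divide_distrib[symmetric])
      moreover have "{..<length ts - 1} \<noteq> {}" by (auto simp: len)
      ultimately show ?thesis by force
    qed
    then show ?thesis by (simp add: mesh_def)
  qed
  ultimately show False using no[of ts] n by simp
qed

lemma partition_sum_commute: "partition_sum F G ts \<omega> = partition_sum G F ts \<omega>"
  by (simp add: partition_sum_def mult.commute)

lemma partition_sum_lincomb_left: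
  "partition_sum (sf_lincomb c F d G) K ts \<omega> = c * partition_sum F K ts \<omega> + d * partition_sum G K ts \<omega>"
  by (simp add: partition_sum_def sf_lincomb_def sum_distrib_left sum.distrib[symmetric] algebra_simps)

lemma partition_sum_nonneg: "is_partition ts \<Longrightarrow> 0 \<le> partition_sum F F ts \<omega>"
  unfolding partition_sum_def using partition_interval(2)
  by (intro sum_nonneg mult_nonneg_nonneg[OF zero_le_square]) (auto simp: less_imp_le)

text \<open>The pointwise inequality (x + y)^2 <= 2 x^2 + 2 y^2. It replaces the triangle inequality
  as long as the norms are not known to exist.\<close>

lemma partition_sum_lincomb_le:
  assumes "is_partition ts"
  shows "partition_sum (sf_lincomb c F d G) (sf_lincomb c F d G) ts \<omega>
    \<le> 2 * c\<^sup>2 * partition_sum F F ts \<omega> + 2 * d\<^sup>2 * partition_sum G G ts \<omega>"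
proof -
  have e: "(c * x + d * y) * (c * x + d * y) * D \<le> 2 * c\<^sup>2 * (x * x * D) + 2 * d\<^sup>2 * (y * y * D)" if "D \<ge> 0" for x y D :: real
  proof -
    have "0 \<le> (c * x - d * y)\<^sup>2 * D" using that by simp
    then show ?thesis by (simp add: power2_eq_square algebra_simps)
  qed
  show ?thesis unfolding partition_sum_def sum_distrib_left sum.distrib[symmetric] sf_lincomb_def
    using partition_interval(2)[OF assms] by (intro sum_mono e) (auto simp: less_imp_le)
qed

text \<open>Write x^2 - y^2 = 2 y (x - y) + (x - y)^2 and split the cross term by the weighted
  arithmetic-geometric mean inequality. The relative error \<open>\<eta>\<close> is free, so sums
  for F are compared with those of an approximant G whose sums are under control.\<close>

lemma partition_sum_perturb:
  assumes "is_partition ts" "0 < \<eta>"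
  shows "\<bar>partition_sum F F ts \<omega> - partition_sum G G ts \<omega>\<bar> \<le>
    \<eta> * partition_sum G G ts \<omega> + (1 + 1 / \<eta>) * partition_sum (sf_diff G F) (sf_diff G F) ts \<omega>"
proof -
  have e: "\<bar>x * x * D - y * y * D\<bar> \<le> \<eta> * (y * y * D) + (1 + 1 / \<eta>) * ((y - x) * (y - x) * D)" if "D \<ge> 0" for x y D :: real
  proof -
    have "(sqrt \<eta> * s - t / sqrt \<eta>)\<^sup>2 = \<eta> * s\<^sup>2 + t\<^sup>2 / \<eta> - 2 * s * t" for s t
      using assms(2) by (simp add: power2_diff power_mult_distrib power_divide less_imp_le)
    then have "0 \<le> \<eta> * s\<^sup>2 + t\<^sup>2 / \<eta> - 2 * s * t" for s t by (metis zero_le_power2)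
    from this[of y "x - y"] this[of y "y - x"]
    have "\<bar>x * x - y * y\<bar> \<le> \<eta> * (y * y) + (1 + 1 / \<eta>) * ((y - x) * (y - x))"
    proof -
      assume a: "0 \<le> \<eta> * y\<^sup>2 + (x - y)\<^sup>2 / \<eta> - 2 * y * (x - y)" "0 \<le> \<eta> * y\<^sup>2 + (y - x)\<^sup>2 / \<eta> - 2 * y * (y - x)"
      have b: "(x - y)\<^sup>2 / \<eta> = 1 / \<eta> * ((y - x) * (y - x))" "(y - x)\<^sup>2 / \<eta> = 1 / \<eta> * ((y - x) * (y - x))"
        by (simp_all add: power2_eq_square diff_divide_distrib add_divide_distrib algebra_simps)
      have c: "0 \<le> (y - x) * (y - x)" by simp
      show ?thesis using a c unfolding b abs_le_iff by (simp add: power2_eq_square algebra_simps)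
    qed
    then have "\<bar>x * x - y * y\<bar> * D \<le> (\<eta> * (y * y) + (1 + 1 / \<eta>) * ((y - x) * (y - x))) * D" 
      using that by (rule mult_right_mono)
    moreover have "\<bar>x * x - y * y\<bar> * D = \<bar>x * x * D - y * y * D\<bar>"
      using that by (simp add: abs_mult left_diff_distrib[symmetric] del: mult.assoc)
    ultimately show ?thesis by (simp add: algebra_simps)
  qed
  have "\<bar>partition_sum F F ts \<omega> - partition_sum G G ts \<omega>\<bar> \<le> (\<Sum>j<length ts - 1.
    \<bar>F (ts ! j) (ts ! Suc j) \<omega> * F (ts ! j) (ts ! Suc j) \<omega> * (ts ! Suc j - ts ! j) - 
     G (ts ! j) (ts ! Suc j) \<omega> * G (ts ! j) (ts ! Suc j) \<omega> * (ts ! Suc j - ts ! j)\<bar>)"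
    unfolding partition_sum_def sum_subtractf[symmetric] by (rule sum_abs)
  also have "\<dots> \<le> \<eta> * partition_sum G G ts \<omega> + (1 + 1 / \<eta>) * partition_sum (sf_diff G F) (sf_diff G F) ts \<omega>"
    unfolding partition_sum_def sum_distrib_left sum.distrib[symmetric] sf_diff_def
    using partition_interval(2)[OF assms(1)] by (intro sum_mono e) (auto simp: less_imp_le)
  finally show ?thesis .
qed

lemma sf_diff_lincomb: "sf_diff F G = sf_lincomb 1 F (- 1) G"
  by (simp add: sf_diff_def sf_lincomb_def)

lemma random_setfun_lincomb:
  "random_setfun M F \<Longrightarrow> random_setfun M G \<Longrightarrow> random_setfun M (sf_lincomb c F d G)"
  by (auto simp: random_setfun_def sf_lincomb_def intro!: borel_measurable_add borel_measurable_times)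

lemma random_setfun_diff:
  "random_setfun M F \<Longrightarrow> random_setfun M G \<Longrightarrow> random_setfun M (sf_diff F G)"
  by (simp add: sf_diff_lincomb random_setfun_lincomb)

lemma partition_sum_measurable [measurable (raw)]:
  assumes "random_setfun M F" "random_setfun M G" "is_partition ts"
  shows "partition_sum F G ts \<in> borel_measurable M"
  unfolding partition_sum_def[abs_def]
  using assms(1,2) partition_interval[OF assms(3)]
  by (intro borel_measurable_sum borel_measurable_times) (auto simp: random_setfun_def)

section \<open>Limits in probability\<close>

definition prob_lim :: "'w measure \<Rightarrow> ('i \<Rightarrow> 'w \<Rightarrow> real) \<Rightarrow> ('w \<Rightarrow> real) \<Rightarrow> 'i filter \<Rightarrow> bool" where
  "prob_lim M f Z Fl \<longleftrightarrow> (\<forall>\<epsilon>>0. ((\<lambda>i. measure M {\<omega> \<in> space M. \<bar>f i \<omega> - Z \<omega>\<bar> > \<epsilon>}) \<longlongrightarrow> 0) Fl)"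

lemma has_inner_prob_lim:
  "has_inner M F G Z \<longleftrightarrow> random_setfun M F \<and> random_setfun M G \<and> Z \<in> borel_measurable M \<and>
     prob_lim M (partition_sum F G) Z partition_filter"
  by (simp add: has_inner_def prob_lim_def)

context prob_space
begin

lemma measure_subadd2:
  assumes "A \<in> events" "B \<in> events" "C \<subseteq> A \<union> B"
  shows "measure M C \<le> measure M A + measure M B"
  using finite_measure_mono[OF assms(3)] measure_Un_le[OF assms(1,2)] assms by force

lemma prob_lim_lincomb:
  assumes f: "eventually (\<lambda>i. f i \<in> borel_measurable M) Fl" "Z \<in> borel_measurable M" "prob_lim M f Z Fl"
    and g: "eventually (\<lambda>i. g i \<in> borel_measurable M) Fl" "Y \<in> borel_measurable M" "prob_lim M g Y Fl"
  shows "prob_lim M (\<lambda>i \<omega>. c * f i \<omega> + d * g i \<omega>) (\<lambda>\<omega>. c * Z \<omega> + d * Y \<omega>) Fl"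
  unfolding prob_lim_def
proof (intro allI impI)
  fix \<epsilon> :: real assume e: "\<epsilon> > 0"
  \<comment> \<open>The summand 1 keeps the divisor positive when c = d = 0 and makes the estimate
    that follows strict.\<close>
  define k where "k = \<epsilon> / (\<bar>c\<bar> + \<bar>d\<bar> + 1)"
  have k: "k > 0" using e by (simp add: k_def add_nonneg_pos)
  have ke: "\<bar>c\<bar> * k + \<bar>d\<bar> * k < \<epsilon>"
  proof -
    have "\<bar>c\<bar> + \<bar>d\<bar> + 1 \<noteq> 0" by linarith
    then have "(\<bar>c\<bar> + \<bar>d\<bar> + 1) * k = \<epsilon>" by (simp add: k_def)
    then have "\<epsilon> = \<bar>c\<bar> * k + \<bar>d\<bar> * k + k" by (simp add: algebra_simps)
    then show ?thesis using k by linarith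
  qed
  let ?F = "\<lambda>i. measure M {\<omega> \<in> space M. \<bar>f i \<omega> - Z \<omega>\<bar> > k}"
  let ?G = "\<lambda>i. measure M {\<omega> \<in> space M. \<bar>g i \<omega> - Y \<omega>\<bar> > k}"
  show "((\<lambda>i. measure M {\<omega> \<in> space M. \<epsilon> < \<bar>c * f i \<omega> + d * g i \<omega> - (c * Z \<omega> + d * Y \<omega>)\<bar>}) \<longlongrightarrow> 0) Fl"
  proof (rule tendsto_sandwich[OF _ _ tendsto_const])
    show "((\<lambda>i. ?F i + ?G i) \<longlongrightarrow> 0) Fl"
      using tendsto_add[of ?F 0 Fl ?G 0] f(3) g(3) k by (simp add: prob_lim_def)
    show "\<forall>\<^sub>F i in Fl. measure M {\<omega> \<in> space M. \<epsilon> < \<bar>c * f i \<omega> + d * g i \<omega> - (c * Z \<omega> + d * Y \<omega>)\<bar>} \<le> ?F i + ?G i"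
      using f(1) g(1)
    proof eventually_elim
      case (elim i)
      note [measurable] = elim f(2) g(2)
      show ?case
      proof (rule measure_subadd2)
        show "{\<omega> \<in> space M. \<epsilon> < \<bar>c * f i \<omega> + d * g i \<omega> - (c * Z \<omega> + d * Y \<omega>)\<bar>}
          \<subseteq> {\<omega> \<in> space M. \<bar>f i \<omega> - Z \<omega>\<bar> > k} \<union> {\<omega> \<in> space M. \<bar>g i \<omega> - Y \<omega>\<bar> > k}"
        proof (safe, rule ccontr)
          fix \<omega> assume w: "\<epsilon> < \<bar>c * f i \<omega> + d * g i \<omega> - (c * Z \<omega> + d * Y \<omega>)\<bar>" "\<not> k < \<bar>f i \<omega> - Z \<omega>\<bar>" "\<not> k < \<bar>g i \<omega> - Y \<omega>\<bar>"
          have "\<bar>c * f i \<omega> + d * g i \<omega> - (c * Z \<omega> + d * Y \<omega>)\<bar> = \<bar>c * (f i \<omega> - Z \<omega>) + d * (g i \<omega> - Y \<omega>)\<bar>"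
            by (simp add: algebra_simps)
          also have "\<dots> \<le> \<bar>c\<bar> * \<bar>f i \<omega> - Z \<omega>\<bar> + \<bar>d\<bar> * \<bar>g i \<omega> - Y \<omega>\<bar>" 
            by (simp add: abs_mult[symmetric] abs_triangle_ineq)
          also have "\<dots> \<le> \<bar>c\<bar> * k + \<bar>d\<bar> * k" using w by (intro add_mono mult_left_mono) auto
          finally show False using w(1) ke by simp
        qed
      qed measurable
    qed
  qed auto
qed

lemma prob_lim_unique:
  assumes "Fl \<noteq> bot" "eventually (\<lambda>i. f i \<in> borel_measurable M) Fl"
    and Z [measurable]: "Z \<in> borel_measurable M" "Y \<in> borel_measurable M"
    and lim: "prob_lim M f Z Fl" "prob_lim M f Y Fl"
  shows "AE \<omega> in M. Z \<omega> = Y \<omega>"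
proof -
  have "AE \<omega> in M. \<not> \<bar>Z \<omega> - Y \<omega>\<bar> > \<epsilon>" if "\<epsilon> > 0" for \<epsilon>
  proof -
    let ?F = "\<lambda>i. measure M {\<omega> \<in> space M. \<bar>f i \<omega> - Z \<omega>\<bar> > \<epsilon> / 2}"
    let ?G = "\<lambda>i. measure M {\<omega> \<in> space M. \<bar>f i \<omega> - Y \<omega>\<bar> > \<epsilon> / 2}"
    have "measure M {\<omega> \<in> space M. \<bar>Z \<omega> - Y \<omega>\<bar> > \<epsilon>} \<le> 0"
    proof (rule tendsto_le[OF assms(1) _ tendsto_const])
      show "((\<lambda>i. ?F i + ?G i) \<longlongrightarrow> 0) Fl"
        using tendsto_add[OF lim(1)[unfolded prob_lim_def, rule_format, of "\<epsilon> / 2"]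
          lim(2)[unfolded prob_lim_def, rule_format, of "\<epsilon> / 2"]] that by simp
      show "\<forall>\<^sub>F i in Fl. measure M {\<omega> \<in> space M. \<bar>Z \<omega> - Y \<omega>\<bar> > \<epsilon>} \<le> ?F i + ?G i"
        using assms(2)
      proof eventually_elim
        case (elim i)
        note [measurable] = elim
        show ?case
          by (rule measure_subadd2) (measurable, auto simp: abs_real_def split: if_splits)
      qed
    qed
    then have "measure M {\<omega> \<in> space M. \<bar>Z \<omega> - Y \<omega>\<bar> > \<epsilon>} = 0" by (simp add: measure_le_0_iff)
    then show ?thesis by (subst AE_iff_measurable[OF _ refl]) (auto simp: emeasure_eq_measure)
  qed
  then have "AE \<omega> in M. \<forall>n::nat. \<not> \<bar>Z \<omega> - Y \<omega>\<bar> > 1 / real (Suc n)"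
    unfolding AE_all_countable by simp
  then show ?thesis
  proof eventually_elim
    case (elim \<omega>)
    show ?case
    proof (rule ccontr)
      assume "Z \<omega> \<noteq> Y \<omega>"
      then have "\<bar>Z \<omega> - Y \<omega>\<bar> > 0" by simp
      then obtain n :: nat where "1 / real (Suc n) < \<bar>Z \<omega> - Y \<omega>\<bar>" using nat_approx_posE by metis
      then show False using elim by auto
    qed
  qed
qed

lemma ev_partition_sum_measurable:
  "random_setfun M F \<Longrightarrow> random_setfun M G \<Longrightarrow>
    \<forall>\<^sub>F ts in partition_filter. partition_sum F G ts \<in> borel_measurable M"
  using eventually_is_partition by eventually_elim (rule partition_sum_measurable)

lemma has_inner_commute: "has_inner M F G Z \<Longrightarrow> has_inner M G F Z"
  unfolding has_inner_def using partition_sum_commute[of F G] by simp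

lemma has_inner_lincomb_left:
  assumes "has_inner M F K Z" "has_inner M G K Y"
  shows "has_inner M (sf_lincomb c F d G) K (\<lambda>\<omega>. c * Z \<omega> + d * Y \<omega>)"
  using assms prob_lim_lincomb[of "partition_sum F K" partition_filter Z "partition_sum G K" Y c d]
  unfolding has_inner_prob_lim
  by (auto simp: partition_sum_lincomb_left[abs_def] random_setfun_lincomb ev_partition_sum_measurable)

lemma has_inner_unique:
  assumes "has_inner M F G Z" "has_inner M F G Y"
  shows "AE \<omega> in M. Z \<omega> = Y \<omega>"
  using assms unfolding has_inner_prob_lim
  by (intro prob_lim_unique[of partition_filter "partition_sum F G"]) (auto simp: ev_partition_sum_measurable)

lemma has_inner_const_unique:
  assumes "has_inner M F G (\<lambda>_. r)" "has_inner M F G (\<lambda>_. r')"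
  shows "r = r'"
  using has_inner_unique[OF assms] by simp

text \<open>Polarization at the level of partition sums: existence of all inner products is reduced
  to that of squared norms, so limits of set functions have to be studied on the diagonal
  only.\<close>

lemma has_inner_polarization:
  assumes "random_setfun M F" "random_setfun M G"
    and "has_inner M (sf_lincomb 1 F 1 G) (sf_lincomb 1 F 1 G) (\<lambda>_. r)"
    and "has_inner M (sf_lincomb 1 F (- 1) G) (sf_lincomb 1 F (- 1) G) (\<lambda>_. r')"
  shows "has_inner M F G (\<lambda>_. (r - r') / 4)"
proof -
  let ?A = "sf_lincomb 1 F 1 G" and ?B = "sf_lincomb 1 F (- 1) G"
  have "prob_lim M (\<lambda>ts \<omega>. 1 / 4 * partition_sum ?A ?A ts \<omega> + (- 1 / 4) * partition_sum ?B ?B ts \<omega>)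
     (\<lambda>\<omega>. 1 / 4 * r + (- 1 / 4) * r') partition_filter"
    using assms by (intro prob_lim_lincomb) (auto simp: has_inner_prob_lim ev_partition_sum_measurable)
  moreover have "1 / 4 * partition_sum ?A ?A ts \<omega> + (- 1 / 4) * partition_sum ?B ?B ts \<omega> = partition_sum F G ts \<omega>" for ts \<omega>
    unfolding partition_sum_def sf_lincomb_def sum_distrib_left sum.distrib[symmetric]
    by (rule sum.cong) (simp_all add: field_simps)
  ultimately show ?thesis using assms by (simp add: has_inner_prob_lim diff_divide_distrib)
qed

text \<open>Used to pass from estimates in probability to inequalities between constants: if for one
  partition the bad events are small, some sample point avoids all of them, and there the pointwise
  inequalities for partition sums apply.\<close>

lemma ex_outside3:
  assumes "A \<in> events" "B \<in> events" "C \<in> events" "prob A + prob B + prob C < 1"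
  obtains \<omega> where "\<omega> \<in> space M" "\<omega> \<notin> A" "\<omega> \<notin> B" "\<omega> \<notin> C"
proof -
  have "prob (A \<union> B \<union> C) \<le> prob A + prob B + prob C"
    using measure_Un_le[of "A \<union> B" M C] measure_Un_le[of A M B] assms by auto
  then have "A \<union> B \<union> C \<noteq> space M" using assms prob_space by auto
  moreover have "A \<union> B \<union> C \<subseteq> space M" using assms sets.sets_into_space by blast
  ultimately show ?thesis using that by blast
qed

lemma has_inner_eventually_near:
  assumes "has_inner M F G (\<lambda>_. r)" "\<epsilon> > 0" "\<eta> > 0"
  shows "\<forall>\<^sub>F ts in partition_filter. prob {\<omega> \<in> space M. \<bar>partition_sum F G ts \<omega> - r\<bar> > \<epsilon>} < \<eta>"
  using assms order_tendstoD(2)[of _ 0 partition_filter \<eta>] by (auto simp: has_inner_def)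

lemma has_inner_nonneg:
  assumes "has_inner M F F (\<lambda>_. r)"
  shows "0 \<le> r"
proof (rule ccontr)
  assume "\<not> 0 \<le> r"
  then have r: "- r / 2 > 0" by simp
  have rs: "random_setfun M F" using assms by (simp add: has_inner_def)
  have "\<forall>\<^sub>F ts in partition_filter. is_partition ts \<and> prob {\<omega> \<in> space M. \<bar>partition_sum F F ts \<omega> - r\<bar> > - r / 2} < 1"
    using eventually_is_partition has_inner_eventually_near[OF assms r, of 1] by (simp add: eventually_conj)
  then obtain ts where ts: "is_partition ts" "prob {\<omega> \<in> space M. \<bar>partition_sum F F ts \<omega> - r\<bar> > - r / 2} < 1"
    using eventually_happens'[OF partition_filter_not_bot] by blast
  have [measurable]: "partition_sum F F ts \<in> borel_measurable M" by (rule partition_sum_measurable) fact+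
  obtain \<omega> where "\<not> \<bar>partition_sum F F ts \<omega> - r\<bar> > - r / 2"
    by (rule ex_outside3[of "{\<omega> \<in> space M. \<bar>partition_sum F F ts \<omega> - r\<bar> > - r / 2}" "{}" "{}"]) (use ts in auto)
  then show False using partition_sum_nonneg[OF ts(1), of F \<omega>] r by (simp add: abs_le_iff not_less)
qed

text \<open>Chebyshev's inequality. All inner products of generators are computed through such a
  bound on the mean square deviation that is linear in the mesh.\<close>

lemma has_inner_of_mesh_bound:
  assumes "random_setfun M F" "random_setfun M G"
    and "\<And>ts. is_partition ts \<Longrightarrow> integrable M (\<lambda>\<omega>. (partition_sum F G ts \<omega> - r)\<^sup>2)"
    and "\<And>ts. is_partition ts \<Longrightarrow> expectation (\<lambda>\<omega>. (partition_sum F G ts \<omega> - r)\<^sup>2) \<le> K * mesh ts"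
  shows "has_inner M F G (\<lambda>_. r)"
  unfolding has_inner_def
proof (intro conjI allI impI assms(1,2))
  fix \<epsilon> :: real assume e: "\<epsilon> > 0"
  show "((\<lambda>ts. prob {\<omega> \<in> space M. \<bar>partition_sum F G ts \<omega> - r\<bar> > \<epsilon>}) \<longlongrightarrow> 0) partition_filter"
  proof (rule tendsto_sandwich[OF _ _ tendsto_const])
    show "\<forall>\<^sub>F ts in partition_filter. prob {\<omega> \<in> space M. \<bar>partition_sum F G ts \<omega> - r\<bar> > \<epsilon>} \<le> (\<bar>K\<bar> / \<epsilon>\<^sup>2) * mesh ts"
      using eventually_is_partition
    proof eventually_elim
      case (elim ts)
      have [measurable]: "partition_sum F G ts \<in> borel_measurable M"
        by (rule partition_sum_measurable) fact+
      have "prob {\<omega> \<in> space M. \<bar>partition_sum F G ts \<omega> - r\<bar> > \<epsilon>} \<le> prob {\<omega> \<in> space M. (partition_sum F G ts \<omega> - r)\<^sup>2 \<ge> \<epsilon>\<^sup>2}"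
        using e by (intro finite_measure_mono) (auto simp: abs_le_square_iff[symmetric])
      also have "\<dots> \<le> expectation (\<lambda>\<omega>. (partition_sum F G ts \<omega> - r)\<^sup>2) / \<epsilon>\<^sup>2"
        using e assms(3)[OF elim] by (intro integral_Markov_inequality_measure[where A = "{}"]) auto
      also have "\<dots> \<le> K * mesh ts / \<epsilon>\<^sup>2" by (intro divide_right_mono assms elim) auto
      also have "\<dots> \<le> \<bar>K\<bar> * mesh ts / \<epsilon>\<^sup>2" using mesh_bounds[OF elim] 
        by (intro divide_right_mono mult_right_mono) auto
      finally show ?case by simp
    qed
    show "((\<lambda>ts. (\<bar>K\<bar> / \<epsilon>\<^sup>2) * mesh ts) \<longlongrightarrow> 0) partition_filter"
    proof (rule tendsto_mult_right_zero, rule order_tendstoI)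
      fix a :: real assume "a < 0"
      then show "\<forall>\<^sub>F ts in partition_filter. a < mesh ts"
        using mesh_bounds(1) by (auto intro!: eventually_mono[OF eventually_is_partition] elim: less_trans)
    next
      fix a :: real assume "0 < a"
      then show "\<forall>\<^sub>F ts in partition_filter. mesh ts < a" by (auto simp: eventually_partition_filter)
    qed
  qed auto
qed simp

end

section \<open>Closure of a space with deterministic inner products\<close>

text \<open>A number and not a random variable. A constant limit in probability is unique, so the
  value does not involve a null set that varies with the pair of set functions.\<close>

definition const_ip :: "'w measure \<Rightarrow> 'w setfun \<Rightarrow> 'w setfun \<Rightarrow> real" where
  "const_ip M F G = (THE r. has_inner M F G (\<lambda>_. r))"

definition const_nrm :: "'w measure \<Rightarrow> 'w setfun \<Rightarrow> real" where
  "const_nrm M F = sqrt (const_ip M F F)"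

lemma (in prob_space) const_ip_eqI: "has_inner M F G (\<lambda>_. r) \<Longrightarrow> const_ip M F G = r"
  unfolding const_ip_def by (rule the_equality) (auto intro: has_inner_const_unique)

text \<open>A pre-Hilbert space modulo null vectors. It is instantiated with the span of the
  generators and then with the closure, so that geometric facts are proved once.\<close>

locale const_inner = prob_space M for M :: "'w measure" +
  fixes V :: "'w setfun set"
  assumes nonempty: "V \<noteq> {}"
    and random: "F \<in> V \<Longrightarrow> random_setfun M F"
    and lincomb: "F \<in> V \<Longrightarrow> G \<in> V \<Longrightarrow> sf_lincomb c F d G \<in> V"
    and const: "F \<in> V \<Longrightarrow> G \<in> V \<Longrightarrow> \<exists>r. has_inner M F G (\<lambda>_. r)"
begin

abbreviation "ip \<equiv> const_ip M"
abbreviation "nrm \<equiv> const_nrm M"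

lemma has_inner_ip: "F \<in> V \<Longrightarrow> G \<in> V \<Longrightarrow> has_inner M F G (\<lambda>_. ip F G)"
  using const const_ip_eqI by metis

lemma diff: "F \<in> V \<Longrightarrow> G \<in> V \<Longrightarrow> sf_diff F G \<in> V"
  by (simp add: sf_diff_lincomb lincomb)

lemma ip_commute: "F \<in> V \<Longrightarrow> G \<in> V \<Longrightarrow> ip F G = ip G F"
  by (metis has_inner_ip has_inner_commute const_ip_eqI)

lemma ip_lincomb_left:
  "F \<in> V \<Longrightarrow> G \<in> V \<Longrightarrow> K \<in> V \<Longrightarrow> ip (sf_lincomb c F d G) K = c * ip F K + d * ip G K"
  by (intro const_ip_eqI has_inner_lincomb_left has_inner_ip)

lemma ip_lincomb_right:
  "F \<in> V \<Longrightarrow> G \<in> V \<Longrightarrow> K \<in> V \<Longrightarrow> ip K (sf_lincomb c F d G) = c * ip K F + d * ip K G"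
  using ip_lincomb_left[of F G K c d] ip_commute[of K] lincomb[of F G c d] by simp

lemma ip_diff_left: "F \<in> V \<Longrightarrow> G \<in> V \<Longrightarrow> K \<in> V \<Longrightarrow> ip (sf_diff F G) K = ip F K - ip G K"
  by (simp add: sf_diff_lincomb ip_lincomb_left)

lemma ip_diff_right: "F \<in> V \<Longrightarrow> G \<in> V \<Longrightarrow> K \<in> V \<Longrightarrow> ip K (sf_diff F G) = ip K F - ip K G"
  by (simp add: sf_diff_lincomb ip_lincomb_right)

lemma ip_nonneg: "F \<in> V \<Longrightarrow> 0 \<le> ip F F"
  using has_inner_ip has_inner_nonneg by blast

lemma ip_CS: 
  assumes "F \<in> V" "G \<in> V"
  shows "\<bar>ip F G\<bar> \<le> nrm F * nrm G"
proof -
  have nn: "0 \<le> ip F F + 2 * t * ip F G + t\<^sup>2 * ip G G" for t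
  proof -
    have "0 \<le> ip (sf_lincomb 1 F t G) (sf_lincomb 1 F t G)" by (rule ip_nonneg[OF lincomb[OF assms]])
    also have "\<dots> = ip F F + 2 * t * ip F G + t\<^sup>2 * ip G G"
      using assms lincomb[OF assms, of 1 t]
      by (simp add: ip_lincomb_left ip_lincomb_right ip_commute[of G F] power2_eq_square algebra_simps)
    finally show ?thesis .
  qed
  have "(ip F G)\<^sup>2 \<le> ip F F * ip G G"
  proof (cases "ip G G = 0")
    case True
    have "ip F G = 0"
    proof (rule ccontr)
      assume ne: "ip F G \<noteq> 0"
      \<comment> \<open>For a null vector G the quadratic is affine in t; this t gives it the value
        -1.\<close>
      show False using nn[of "- (ip F F + 1) / (2 * ip F G)"] True ne by (simp add: field_simps)
    qed
    then show ?thesis by (simp add: True)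
  next
    case False
    then have p: "ip G G > 0" using ip_nonneg[OF assms(2)] by simp
    have "0 \<le> (ip F F + 2 * (- ip F G / ip G G) * ip F G + (- ip F G / ip G G)\<^sup>2 * ip G G) * ip G G"
      by (rule mult_nonneg_nonneg[OF nn less_imp_le[OF p]])
    also have "\<dots> = ip F F * ip G G - (ip F G)\<^sup>2"
      using False by (simp add: power2_eq_square field_simps)
    finally show ?thesis by simp
  qed
  then have "sqrt ((ip F G)\<^sup>2) \<le> sqrt (ip F F * ip G G)" by (rule real_sqrt_le_mono)
  then show ?thesis by (simp add: const_nrm_def real_sqrt_mult)
qed

lemma nrm_nonneg: "F \<in> V \<Longrightarrow> 0 \<le> nrm F"
  by (simp add: const_nrm_def ip_nonneg)

lemma nrm_square: "F \<in> V \<Longrightarrow> (nrm F)\<^sup>2 = ip F F"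
  by (simp add: const_nrm_def ip_nonneg)

lemma nrm_triangle:
  assumes "F \<in> V" "G \<in> V"
  shows "nrm (sf_lincomb 1 F 1 G) \<le> nrm F + nrm G"
proof (rule power2_le_imp_le)
  have "(nrm (sf_lincomb 1 F 1 G))\<^sup>2 = (nrm F)\<^sup>2 + 2 * ip F G + (nrm G)\<^sup>2"
    using assms lincomb[OF assms, of 1 1]
    by (simp add: nrm_square ip_lincomb_left ip_lincomb_right ip_commute[of G F])
  then show "(nrm (sf_lincomb 1 F 1 G))\<^sup>2 \<le> (nrm F + nrm G)\<^sup>2"
    using ip_CS[OF assms] by (simp add: power2_sum)
  show "0 \<le> nrm F + nrm G" using assms by (simp add: nrm_nonneg)
qed

lemma nrm_diff_triangle:
  assumes "F \<in> V" "G \<in> V" "K \<in> V"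
  shows "nrm (sf_diff F K) \<le> nrm (sf_diff F G) + nrm (sf_diff G K)"
proof -
  have "sf_diff F K = sf_lincomb 1 (sf_diff F G) 1 (sf_diff G K)"
    by (simp add: sf_diff_def sf_lincomb_def)
  then show ?thesis using nrm_triangle[of "sf_diff F G" "sf_diff G K"] assms by (simp add: diff)
qed

lemma nrm_diff_commute: "F \<in> V \<Longrightarrow> G \<in> V \<Longrightarrow> nrm (sf_diff F G) = nrm (sf_diff G F)"
  by (simp add: const_nrm_def ip_diff_left ip_diff_right diff ip_commute)

lemma nrm_diff_self: "F \<in> V \<Longrightarrow> nrm (sf_diff F F) = 0"
  by (simp add: const_nrm_def ip_diff_left ip_diff_right diff)

lemma nrm_reverse_triangle:
  assumes "F \<in> V" "G \<in> V"
  shows "\<bar>nrm F - nrm G\<bar> \<le> nrm (sf_diff F G)"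
proof -
  have e: "sf_lincomb 1 G 1 (sf_diff F G) = F" "sf_lincomb 1 F 1 (sf_diff G F) = G"
    by (simp_all add: sf_diff_def sf_lincomb_def)
  show ?thesis
    using nrm_triangle[of G "sf_diff F G"] nrm_triangle[of F "sf_diff G F"] assms nrm_diff_commute[OF assms]
    by (simp add: e diff abs_le_iff)
qed

lemma nrm_lincomb_le:
  assumes "F \<in> V" "G \<in> V"
  shows "nrm (sf_lincomb c F d G) \<le> \<bar>c\<bar> * nrm F + \<bar>d\<bar> * nrm G"
proof -
  have z: "nrm (sf_lincomb c F 0 G) = \<bar>c\<bar> * nrm F" if "F \<in> V" "G \<in> V" for F G c
  proof -
    have "ip (sf_lincomb c F 0 G) (sf_lincomb c F 0 G) = c\<^sup>2 * ip F F"
      using that lincomb[OF that, of c 0] by (simp add: ip_lincomb_left ip_lincomb_right power2_eq_square)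
    then show ?thesis by (simp add: const_nrm_def real_sqrt_mult)
  qed
  have "sf_lincomb c F d G = sf_lincomb 1 (sf_lincomb c F 0 G) 1 (sf_lincomb d G 0 F)"
    by (simp add: sf_lincomb_def)
  then show ?thesis
    using nrm_triangle[of "sf_lincomb c F 0 G" "sf_lincomb d G 0 F"] assms z lincomb by simp
qed

lemma ip_continuous:
  assumes V: "\<And>n. X n \<in> V" "F \<in> V" "\<And>n. Y n \<in> V" "G \<in> V"
    and lim: "(\<lambda>n. nrm (sf_diff (X n) F)) \<longlonglongrightarrow> 0" "(\<lambda>n. nrm (sf_diff (Y n) G)) \<longlonglongrightarrow> 0"
  shows "(\<lambda>n. ip (X n) (Y n)) \<longlonglongrightarrow> ip F G"
proof -
  have "(\<lambda>n. ip (X n) (Y n) - ip F G) \<longlonglongrightarrow> 0"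
  proof (rule Lim_null_comparison, rule always_eventually, rule allI)
    fix n
    have "ip (X n) (Y n) - ip F G = ip (sf_diff (X n) F) (Y n) + ip F (sf_diff (Y n) G)"
      using V by (simp add: ip_diff_left ip_diff_right)
    then have "norm (ip (X n) (Y n) - ip F G) \<le> nrm (sf_diff (X n) F) * nrm (Y n) + nrm F * nrm (sf_diff (Y n) G)"
      using ip_CS[OF diff[OF V(1)[of n] V(2)] V(3)[of n]] ip_CS[OF V(2) diff[OF V(3)[of n] V(4)]]
        abs_triangle_ineq[of "ip (sf_diff (X n) F) (Y n)" "ip F (sf_diff (Y n) G)"] by simp
    moreover have "nrm (sf_diff (X n) F) * nrm (Y n) \<le> nrm (sf_diff (X n) F) * (nrm G + nrm (sf_diff (Y n) G))"
      using nrm_reverse_triangle[OF V(3)[of n] V(4)] by (intro mult_left_mono nrm_nonneg diff V) linarith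
    ultimately show "norm (ip (X n) (Y n) - ip F G) \<le> nrm (sf_diff (X n) F) * (nrm G + nrm (sf_diff (Y n) G)) + nrm F * nrm (sf_diff (Y n) G)"
      by linarith
  next
    have "(\<lambda>n. nrm (sf_diff (X n) F) * (nrm G + nrm (sf_diff (Y n) G)) + nrm F * nrm (sf_diff (Y n) G))
      \<longlonglongrightarrow> 0 * (nrm G + 0) + nrm F * 0"
      by (intro tendsto_intros lim)
    then show "(\<lambda>n. nrm (sf_diff (X n) F) * (nrm G + nrm (sf_diff (Y n) G)) + nrm F * nrm (sf_diff (Y n) G))
      \<longlonglongrightarrow> 0" by simp
  qed
  then show ?thesis by (rule LIM_zero_cancel)
qed

lemma sf_equiv_iff:
  assumes "F \<in> V" "G \<in> V"
  shows "sf_equiv M F G \<longleftrightarrow> nrm (sf_diff F G) = 0"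
proof
  assume "sf_equiv M F G"
  then have "ip (sf_diff F G) (sf_diff F G) = 0" unfolding sf_equiv_def by (rule const_ip_eqI)
  then show "nrm (sf_diff F G) = 0" by (simp add: const_nrm_def)
next
  assume "nrm (sf_diff F G) = 0"
  then have "ip (sf_diff F G) (sf_diff F G) = 0" by (simp add: const_nrm_def)
  then show "sf_equiv M F G" 
    unfolding sf_equiv_def using has_inner_ip[of "sf_diff F G" "sf_diff F G"] diff[OF assms] by simp
qed

text \<open>Each random squared distance equals a constant almost surely, and countably many null
  sets can be united. Almost sure convergence thus becomes convergence of numbers.\<close>

lemma sf_tendsto_iff:
  assumes V: "\<And>n. X n \<in> V" "F \<in> V"
  shows "sf_tendsto M X F \<longleftrightarrow> (\<lambda>n. nrm (sf_diff (X n) F)) \<longlonglongrightarrow> 0"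
proof
  assume "sf_tendsto M X F"
  then obtain Z where Z: "\<And>n. has_inner M (sf_diff (X n) F) (sf_diff (X n) F) (Z n)"
    "AE \<omega> in M. (\<lambda>n. Z n \<omega>) \<longlonglongrightarrow> 0" by (auto simp: sf_tendsto_def)
  have "AE \<omega> in M. Z n \<omega> = ip (sf_diff (X n) F) (sf_diff (X n) F)" for n
    using Z(1)[of n] has_inner_ip[OF diff[OF V(1)[of n] V(2)] diff[OF V(1)[of n] V(2)]] by (rule has_inner_unique)
  then have "AE \<omega> in M. \<forall>n. Z n \<omega> = ip (sf_diff (X n) F) (sf_diff (X n) F)" by (simp add: AE_all_countable)
  with Z(2) have "AE \<omega> in M. (\<lambda>n. ip (sf_diff (X n) F) (sf_diff (X n) F)) \<longlonglongrightarrow> 0"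
    by eventually_elim simp
  then have "(\<lambda>n. ip (sf_diff (X n) F) (sf_diff (X n) F)) \<longlonglongrightarrow> 0" by simp
  from tendsto_real_sqrt[OF this] show "(\<lambda>n. nrm (sf_diff (X n) F)) \<longlonglongrightarrow> 0" by (simp add: const_nrm_def)
next
  assume "(\<lambda>n. nrm (sf_diff (X n) F)) \<longlonglongrightarrow> 0"
  from tendsto_power[OF this, of 2] have "(\<lambda>n. ip (sf_diff (X n) F) (sf_diff (X n) F)) \<longlonglongrightarrow> 0"
    using V by (simp add: nrm_square diff)
  then show "sf_tendsto M X F" unfolding sf_tendsto_def
    using has_inner_ip[OF diff[OF V(1) V(2)] diff[OF V(1) V(2)]]
    by (intro exI[of _ "\<lambda>n \<omega>. ip (sf_diff (X n) F) (sf_diff (X n) F)"]) auto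
qed

end

text \<open>The squared distance of X n and F need not exist here; only the partition sums have to
  be small with high probability, for all partitions finer than a bound that may depend on n. This
  makes the notion stable under linear combinations.\<close>

definition prob_conv :: "'w measure \<Rightarrow> (nat \<Rightarrow> 'w setfun) \<Rightarrow> 'w setfun \<Rightarrow> bool" where
  "prob_conv M X F \<longleftrightarrow> (\<forall>\<delta>>0. \<forall>\<eta>>0. \<exists>N. \<forall>n\<ge>N. \<forall>\<^sub>F ts in partition_filter.
     measure M {\<omega> \<in> space M. partition_sum (sf_diff (X n) F) (sf_diff (X n) F) ts \<omega> > \<delta>} < \<eta>)"

text \<open>Almost sure convergence of the squared distances implies convergence in probability,
  here by dominated convergence of indicators. The error is then split into the distance of the
  partition sum from its limit and the size of that limit.\<close>

lemma (in prob_space) sf_tendsto_imp_prob_conv: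
  assumes "sf_tendsto M X F" "random_setfun M F" "\<And>n. random_setfun M (X n)"
  shows "prob_conv M X F"
  unfolding prob_conv_def
proof (intro allI impI)
  fix \<delta> \<eta> :: real assume \<delta>: "\<delta> > 0" and \<eta>: "\<eta> > 0"
  obtain Z where Z: "\<And>n. has_inner M (sf_diff (X n) F) (sf_diff (X n) F) (Z n)"
    "AE \<omega> in M. (\<lambda>n. Z n \<omega>) \<longlonglongrightarrow> 0" using assms(1) by (auto simp: sf_tendsto_def)
  have [measurable]: "Z n \<in> borel_measurable M" for n using Z(1)[of n] by (simp add: has_inner_def)
  have "(\<lambda>n. \<integral>\<omega>. indicator {\<omega> \<in> space M. \<bar>Z n \<omega>\<bar> > \<delta> / 2} \<omega> \<partial>M) \<longlonglongrightarrow> (\<integral>\<omega>. 0 \<partial>M :: real)"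
  proof (rule integral_dominated_convergence[where w = "\<lambda>_. 1"])
    show "AE \<omega> in M. (\<lambda>n. indicator {\<omega> \<in> space M. \<bar>Z n \<omega>\<bar> > \<delta> / 2} \<omega>) \<longlonglongrightarrow> (0::real)"
      using Z(2)
    proof eventually_elim
      case (elim \<omega>)
      have "\<forall>\<^sub>F n in sequentially. \<bar>Z n \<omega>\<bar> < \<delta> / 2"
        using tendstoD[OF elim, of "\<delta> / 2"] \<delta> by (simp add: dist_real_def)
      then have "\<forall>\<^sub>F n in sequentially. indicator {\<omega> \<in> space M. \<bar>Z n \<omega>\<bar> > \<delta> / 2} \<omega> = (0::real)"
        by eventually_elim (simp add: indicator_def)
      then show ?case by (rule tendsto_eventually)
    qed
  qed (auto simp: indicator_def)
  then have "(\<lambda>n. prob {\<omega> \<in> space M. \<bar>Z n \<omega>\<bar> > \<delta> / 2}) \<longlonglongrightarrow> 0" by simp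
  from order_tendstoD(2)[OF this, of "\<eta> / 2"] \<eta> obtain N where 
    N: "\<And>n. n \<ge> N \<Longrightarrow> prob {\<omega> \<in> space M. \<bar>Z n \<omega>\<bar> > \<delta> / 2} < \<eta> / 2"
    by (auto simp: eventually_sequentially)
  show "\<exists>N. \<forall>n\<ge>N. \<forall>\<^sub>F ts in partition_filter.
     prob {\<omega> \<in> space M. partition_sum (sf_diff (X n) F) (sf_diff (X n) F) ts \<omega> > \<delta>} < \<eta>"
  proof (intro exI allI impI)
    fix n assume "n \<ge> N"
    let ?D = "sf_diff (X n) F"
    have r: "random_setfun M ?D" using assms by (simp add: random_setfun_diff)
    have "((\<lambda>ts. prob {\<omega> \<in> space M. \<bar>partition_sum ?D ?D ts \<omega> - Z n \<omega>\<bar> > \<delta> / 2}) \<longlongrightarrow> 0) partition_filter"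
      using Z(1)[of n, unfolded has_inner_def, THEN conjunct2, THEN conjunct2, THEN conjunct2, rule_format, of "\<delta> / 2"] \<delta> by simp
    from order_tendstoD(2)[OF this, of "\<eta> / 2"] \<eta>
    have "\<forall>\<^sub>F ts in partition_filter. prob {\<omega> \<in> space M. \<bar>partition_sum ?D ?D ts \<omega> - Z n \<omega>\<bar> > \<delta> / 2} < \<eta> / 2" by simp
    with eventually_is_partition
    show "\<forall>\<^sub>F ts in partition_filter. prob {\<omega> \<in> space M. partition_sum ?D ?D ts \<omega> > \<delta>} < \<eta>"
    proof eventually_elim
      case (elim ts)
      have [measurable]: "partition_sum ?D ?D ts \<in> borel_measurable M" by (rule partition_sum_measurable[OF r r elim(1)])
      have "prob {\<omega> \<in> space M. partition_sum ?D ?D ts \<omega> > \<delta>} \<le>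
        prob {\<omega> \<in> space M. \<bar>partition_sum ?D ?D ts \<omega> - Z n \<omega>\<bar> > \<delta> / 2} + prob {\<omega> \<in> space M. \<bar>Z n \<omega>\<bar> > \<delta> / 2}"
        by (rule measure_subadd2) (measurable, auto simp: abs_real_def split: if_splits)
      then show ?case using elim(2) N[OF \<open>n \<ge> N\<close>] by simp
    qed
  qed
qed

lemma prob_convE:
  assumes "prob_conv M X F" "\<delta> > 0" "\<eta> > 0"
  obtains N where "\<And>n. n \<ge> N \<Longrightarrow> \<forall>\<^sub>F ts in partition_filter.
     measure M {\<omega> \<in> space M. partition_sum (sf_diff (X n) F) (sf_diff (X n) F) ts \<omega> > \<delta>} < \<eta>"
  using assms unfolding prob_conv_def by blast

lemma (in prob_space) prob_conv_lincomb:
  assumes "prob_conv M X F" "prob_conv M Y G"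
    and r: "\<And>n. random_setfun M (X n)" "\<And>n. random_setfun M (Y n)" "random_setfun M F" "random_setfun M G"
  shows "prob_conv M (\<lambda>n. sf_lincomb c (X n) d (Y n)) (sf_lincomb c F d G)"
  unfolding prob_conv_def
proof (intro allI impI)
  fix \<delta> \<eta> :: real assume \<delta>: "\<delta> > 0" and \<eta>: "\<eta> > 0"
  \<comment> \<open>The divisor comes from the factors 2 c^2 and 2 d^2 in
    \<open>partition_sum_lincomb_le\<close>; the 1 makes it positive.\<close>
  define k where "k = \<delta> / (2 * c\<^sup>2 + 2 * d\<^sup>2 + 1)"
  have p: "2 * c\<^sup>2 + 2 * d\<^sup>2 + 1 > 0" by (intro add_nonneg_pos) auto
  have k: "k > 0" using \<delta> p by (simp add: k_def)
  have "(2 * c\<^sup>2 + 2 * d\<^sup>2 + 1) * k = \<delta>" using p by (simp add: k_def)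
  then have kd: "2 * c\<^sup>2 * k + 2 * d\<^sup>2 * k \<le> \<delta>" using k by (simp add: algebra_simps)
  from assms(1) k \<eta> obtain N1 where N1: "\<And>n. n \<ge> N1 \<Longrightarrow> \<forall>\<^sub>F ts in partition_filter.
     prob {\<omega> \<in> space M. partition_sum (sf_diff (X n) F) (sf_diff (X n) F) ts \<omega> > k} < \<eta> / 2"
    by (rule_tac prob_convE[of M X F k "\<eta> / 2"]) auto
  from assms(2) k \<eta> obtain N2 where N2: "\<And>n. n \<ge> N2 \<Longrightarrow> \<forall>\<^sub>F ts in partition_filter.
     prob {\<omega> \<in> space M. partition_sum (sf_diff (Y n) G) (sf_diff (Y n) G) ts \<omega> > k} < \<eta> / 2"
    by (rule_tac prob_convE[of M Y G k "\<eta> / 2"]) auto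
  show "\<exists>N. \<forall>n\<ge>N. \<forall>\<^sub>F ts in partition_filter. prob {\<omega> \<in> space M. 
     partition_sum (sf_diff (sf_lincomb c (X n) d (Y n)) (sf_lincomb c F d G))
      (sf_diff (sf_lincomb c (X n) d (Y n)) (sf_lincomb c F d G)) ts \<omega> > \<delta>} < \<eta>"
  proof (intro exI[of _ "max N1 N2"] allI impI)
    fix n assume n: "n \<ge> max N1 N2"
    let ?A = "sf_diff (X n) F" and ?B = "sf_diff (Y n) G"
    have e: "sf_diff (sf_lincomb c (X n) d (Y n)) (sf_lincomb c F d G) = sf_lincomb c ?A d ?B"
      by (simp add: sf_diff_def sf_lincomb_def algebra_simps)
    have "\<forall>\<^sub>F ts in partition_filter. prob {\<omega> \<in> space M. partition_sum ?A ?A ts \<omega> > k} < \<eta> / 2"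
      "\<forall>\<^sub>F ts in partition_filter. prob {\<omega> \<in> space M. partition_sum ?B ?B ts \<omega> > k} < \<eta> / 2"
      using N1 N2 n by auto
    with eventually_is_partition
    show "\<forall>\<^sub>F ts in partition_filter. prob {\<omega> \<in> space M. 
     partition_sum (sf_diff (sf_lincomb c (X n) d (Y n)) (sf_lincomb c F d G))
      (sf_diff (sf_lincomb c (X n) d (Y n)) (sf_lincomb c F d G)) ts \<omega> > \<delta>} < \<eta>"
      unfolding e
    proof eventually_elim
      case (elim ts)
      have [measurable]: "partition_sum ?A ?A ts \<in> borel_measurable M" "partition_sum ?B ?B ts \<in> borel_measurable M"
        using r elim(1) by (auto intro!: partition_sum_measurable random_setfun_diff)
      have "prob {\<omega> \<in> space M. partition_sum (sf_lincomb c ?A d ?B) (sf_lincomb c ?A d ?B) ts \<omega> > \<delta>} \<le>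
        prob {\<omega> \<in> space M. partition_sum ?A ?A ts \<omega> > k} + prob {\<omega> \<in> space M. partition_sum ?B ?B ts \<omega> > k}"
      proof (rule measure_subadd2)
        show "{\<omega> \<in> space M. partition_sum (sf_lincomb c ?A d ?B) (sf_lincomb c ?A d ?B) ts \<omega> > \<delta>}
         \<subseteq> {\<omega> \<in> space M. partition_sum ?A ?A ts \<omega> > k} \<union> {\<omega> \<in> space M. partition_sum ?B ?B ts \<omega> > k}"
        proof (safe, rule ccontr)
          fix \<omega> assume "\<delta> < partition_sum (sf_lincomb c ?A d ?B) (sf_lincomb c ?A d ?B) ts \<omega>"
            "\<not> k < partition_sum ?A ?A ts \<omega>" "\<not> k < partition_sum ?B ?B ts \<omega>"
          moreover have "2 * c\<^sup>2 * partition_sum ?A ?A ts \<omega> + 2 * d\<^sup>2 * partition_sum ?B ?B ts \<omega>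
            \<le> 2 * c\<^sup>2 * k + 2 * d\<^sup>2 * k" if "\<not> k < partition_sum ?A ?A ts \<omega>" "\<not> k < partition_sum ?B ?B ts \<omega>"
            using that by (intro add_mono mult_left_mono) auto
          ultimately show False using partition_sum_lincomb_le[OF elim(1), of c ?A d ?B \<omega>] kd by force
        qed
      qed measurable
      then show ?case using elim by simp
    qed
  qed
qed

text \<open>The limit that defines an inner product says nothing about a set function on one fixed
  interval. The second moment bound holds for every partition, coarse ones included, and this gives
  control on single intervals when a limit has to be constructed.\<close>

locale span_closure = const_inner M S for M :: "'w measure" and S :: "'w setfun set" +
  assumes second_moment: "F \<in> S \<Longrightarrow> is_partition ts \<Longrightarrow>
    (\<integral>\<^sup>+\<omega>. ennreal (partition_sum F F ts \<omega>) \<partial>M) \<le> ennreal (2 * const_ip M F F)"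
begin

definition H :: "'w setfun set" where
  "H = {F. random_setfun M F \<and> (\<exists>X. (\<forall>n. X n \<in> S) \<and> sf_tendsto M X F)}"

text \<open>For a fixed pair m, n take one fine partition and one sample point at which both
  approximants are close to F and the sum of X m - X n is close to its norm squared. F itself needs
  no norm for this comparison.\<close>

lemma prob_conv_Cauchy:
  assumes X: "\<And>n. X n \<in> S" and F: "random_setfun M F" and lim: "prob_conv M X F" and e: "\<epsilon> > 0"
  shows "\<exists>N. \<forall>m\<ge>N. \<forall>n\<ge>N. nrm (sf_diff (X m) (X n)) < \<epsilon>"
proof -
  \<comment> \<open>The bound reached below is 5 \<open>\<delta>\<close>: twice
    \<open>\<delta>\<close> for each of the two approximants, and \<open>\<delta>\<close> for the
    deviation of the partition sum from its limit.\<close>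
  define \<delta> where "\<delta> = \<epsilon>\<^sup>2 / 6"
  have d: "\<delta> > 0" using e by (simp add: \<delta>_def)
  obtain N where N: "\<And>n. n \<ge> N \<Longrightarrow> \<forall>\<^sub>F ts in partition_filter.
     prob {\<omega> \<in> space M. partition_sum (sf_diff (X n) F) (sf_diff (X n) F) ts \<omega> > \<delta>} < 1 / 4"
    using prob_convE[OF lim d, of "1 / 4"] by auto
  have "nrm (sf_diff (X m) (X n)) < \<epsilon>" if mn: "m \<ge> N" "n \<ge> N" for m n
  proof -
    let ?A = "sf_diff (X m) F" and ?B = "sf_diff (X n) F" and ?C = "sf_diff (X m) (X n)"
    have C: "?C \<in> S" using X by (simp add: diff)
    have "\<forall>\<^sub>F ts in partition_filter. is_partition ts \<and>
       prob {\<omega> \<in> space M. partition_sum ?A ?A ts \<omega> > \<delta>} < 1 / 4 \<and>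
       prob {\<omega> \<in> space M. partition_sum ?B ?B ts \<omega> > \<delta>} < 1 / 4 \<and>
       prob {\<omega> \<in> space M. \<bar>partition_sum ?C ?C ts \<omega> - ip ?C ?C\<bar> > \<delta>} < 1 / 4"
      using eventually_is_partition N[OF mn(1)] N[OF mn(2)] has_inner_eventually_near[OF has_inner_ip[OF C C] d, of "1 / 4"]
      by (auto intro!: eventually_conj)
    then obtain ts where ts: "is_partition ts" 
       "prob {\<omega> \<in> space M. partition_sum ?A ?A ts \<omega> > \<delta>} < 1 / 4"
       "prob {\<omega> \<in> space M. partition_sum ?B ?B ts \<omega> > \<delta>} < 1 / 4"
       "prob {\<omega> \<in> space M. \<bar>partition_sum ?C ?C ts \<omega> - ip ?C ?C\<bar> > \<delta>} < 1 / 4"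
      using eventually_happens'[OF partition_filter_not_bot] by blast
    have [measurable]: "partition_sum ?A ?A ts \<in> borel_measurable M" "partition_sum ?B ?B ts \<in> borel_measurable M"
      "partition_sum ?C ?C ts \<in> borel_measurable M"
      using X F ts(1) by (auto intro!: partition_sum_measurable random_setfun_diff random[OF X])
    obtain \<omega> where w: "\<omega> \<in> space M" "\<omega> \<notin> {\<omega> \<in> space M. partition_sum ?A ?A ts \<omega> > \<delta>}"
      "\<omega> \<notin> {\<omega> \<in> space M. partition_sum ?B ?B ts \<omega> > \<delta>}" 
      "\<omega> \<notin> {\<omega> \<in> space M. \<bar>partition_sum ?C ?C ts \<omega> - ip ?C ?C\<bar> > \<delta>}"
    proof (rule ex_outside3)
      show "prob {\<omega> \<in> space M. partition_sum ?A ?A ts \<omega> > \<delta>} + prob {\<omega> \<in> space M. partition_sum ?B ?B ts \<omega> > \<delta>}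
        + prob {\<omega> \<in> space M. \<bar>partition_sum ?C ?C ts \<omega> - ip ?C ?C\<bar> > \<delta>} < 1" using ts by linarith
    qed auto
    have "?C = sf_lincomb 1 ?A (- 1) ?B" by (simp add: sf_diff_def sf_lincomb_def)
    then have "partition_sum ?C ?C ts \<omega> \<le> 2 * partition_sum ?A ?A ts \<omega> + 2 * partition_sum ?B ?B ts \<omega>"
      using partition_sum_lincomb_le[OF ts(1), of 1 ?A "- 1" ?B \<omega>] by simp
    moreover have "\<not> partition_sum ?A ?A ts \<omega> > \<delta>" "\<not> partition_sum ?B ?B ts \<omega> > \<delta>"
      "\<not> \<bar>partition_sum ?C ?C ts \<omega> - ip ?C ?C\<bar> > \<delta>" using w by auto
    ultimately have "ip ?C ?C \<le> 5 * \<delta>" by linarith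
    also have "\<dots> < \<epsilon>\<^sup>2" using d by (simp add: \<delta>_def)
    finally have "sqrt (ip ?C ?C) < sqrt (\<epsilon>\<^sup>2)" by (rule real_sqrt_less_mono)
    then show ?thesis using e by (simp add: const_nrm_def)
  qed
  then show ?thesis by blast
qed

text \<open>The norms of the approximants form a Cauchy sequence. The square of its limit is the
  limit of the partition sums of F, because \<open>partition_sum_perturb\<close> compares the sums
  of F with those of one good approximant.\<close>

lemma prob_conv_has_inner_self:
  assumes X: "\<And>n. X n \<in> S" and F: "random_setfun M F" and lim: "prob_conv M X F"
  shows "\<exists>r. has_inner M F F (\<lambda>_. r)"
proof -
  have "Cauchy (\<lambda>n. nrm (X n))"
  proof (rule metric_CauchyI)
    fix e :: real assume "e > 0"
    from prob_conv_Cauchy[OF X F lim this] obtain N where "\<forall>m\<ge>N. \<forall>n\<ge>N. nrm (sf_diff (X m) (X n)) < e" ..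
    then show "\<exists>N. \<forall>m\<ge>N. \<forall>n\<ge>N. dist (nrm (X m)) (nrm (X n)) < e"
      using nrm_reverse_triangle[OF X X] unfolding dist_real_def by (meson order_le_less_trans)
  qed
  then obtain s where "(\<lambda>n. nrm (X n)) \<longlonglongrightarrow> s" using Cauchy_convergent_iff convergent_def by blast
  from tendsto_power[OF this, of 2] have s: "(\<lambda>n. ip (X n) (X n)) \<longlonglongrightarrow> s\<^sup>2" using X by (simp add: nrm_square)
  have "has_inner M F F (\<lambda>_. s\<^sup>2)"
    unfolding has_inner_def
  proof (intro conjI allI impI F)
    fix \<epsilon> :: real assume e: "\<epsilon> > 0"
    show "((\<lambda>ts. prob {\<omega> \<in> space M. \<epsilon> < \<bar>partition_sum F F ts \<omega> - s\<^sup>2\<bar>}) \<longlongrightarrow> 0) partition_filter"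
    proof (rule order_tendstoI)
      fix \<kappa> :: real assume k: "0 < \<kappa>"
      \<comment> \<open>The sum of the approximant is at most s^2 + 2 on the good event, so
        \<open>\<eta>\<close> times it is at most \<open>\<epsilon>\<close> / 4.
        \<open>\<delta>2\<close> makes the other term of \<open>partition_sum_perturb\<close> at
        most \<open>\<epsilon>\<close> / 4, and \<open>\<delta>1\<close>, used twice, accounts for
        the remaining half.\<close>
      define \<eta> where "\<eta> = \<epsilon> / (4 * (s\<^sup>2 + 2))"
      have s2: "s\<^sup>2 + 2 > 0" by (rule add_nonneg_pos) auto
      have eta: "\<eta> > 0" using e s2 by (simp add: \<eta>_def)
      define \<delta>1 where "\<delta>1 = min (\<epsilon> / 4) 1"
      have d1: "\<delta>1 > 0" "\<delta>1 \<le> 1" "\<delta>1 \<le> \<epsilon> / 4" using e by (auto simp: \<delta>1_def)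
      define \<delta>2 where "\<delta>2 = \<epsilon> / (4 * (1 + 1 / \<eta>))"
      have scale: "x * (y / (4 * x)) = y / 4" if "x > 0" for x y :: real using that by simp
      have i: "1 + 1 / \<eta> > 0" using eta by (simp add: add_pos_pos)
      then have d2: "\<delta>2 > 0" using e by (simp add: \<delta>2_def)
      have id: "(1 + 1 / \<eta>) * \<delta>2 = \<epsilon> / 4" using i using i by (simp only: \<delta>2_def scale)
      have es: "\<eta> * (s\<^sup>2 + 2) = \<epsilon> / 4" using scale[OF s2, of \<epsilon>] by (simp only: \<eta>_def mult.commute)
      obtain N1 where N1: "\<And>n. n \<ge> N1 \<Longrightarrow> \<forall>\<^sub>F ts in partition_filter.
         prob {\<omega> \<in> space M. partition_sum (sf_diff (X n) F) (sf_diff (X n) F) ts \<omega> > \<delta>2} < \<kappa> / 2"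
        using prob_convE[OF lim d2, of "\<kappa> / 2"] k by auto
      obtain N2 where N2: "\<And>n. n \<ge> N2 \<Longrightarrow> \<bar>ip (X n) (X n) - s\<^sup>2\<bar> < \<delta>1"
        using tendstoD[OF s d1(1)] by (auto simp: eventually_sequentially dist_real_def)
      define n where "n = max N1 N2"
      let ?D = "sf_diff (X n) F"
      have "\<forall>\<^sub>F ts in partition_filter. prob {\<omega> \<in> space M. partition_sum ?D ?D ts \<omega> > \<delta>2} < \<kappa> / 2"
        using N1 by (simp add: n_def)
      moreover have "\<forall>\<^sub>F ts in partition_filter. prob {\<omega> \<in> space M. \<bar>partition_sum (X n) (X n) ts \<omega> - ip (X n) (X n)\<bar> > \<delta>1} < \<kappa> / 2"
        using has_inner_eventually_near[OF has_inner_ip[OF X[of n] X[of n]] d1(1), of "\<kappa> / 2"] k by simp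
      ultimately show "\<forall>\<^sub>F ts in partition_filter. prob {\<omega> \<in> space M. \<epsilon> < \<bar>partition_sum F F ts \<omega> - s\<^sup>2\<bar>} < \<kappa>"
        using eventually_is_partition
      proof eventually_elim
        case (elim ts)
        have [measurable]: "partition_sum ?D ?D ts \<in> borel_measurable M" "partition_sum (X n) (X n) ts \<in> borel_measurable M"
          using X F elim(3) by (auto intro!: partition_sum_measurable random_setfun_diff random[OF X])
        have "prob {\<omega> \<in> space M. \<epsilon> < \<bar>partition_sum F F ts \<omega> - s\<^sup>2\<bar>} \<le> prob {\<omega> \<in> space M. partition_sum ?D ?D ts \<omega> > \<delta>2}
          + prob {\<omega> \<in> space M. \<bar>partition_sum (X n) (X n) ts \<omega> - ip (X n) (X n)\<bar> > \<delta>1}"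
        proof (rule measure_subadd2)
          show "{\<omega> \<in> space M. \<epsilon> < \<bar>partition_sum F F ts \<omega> - s\<^sup>2\<bar>} \<subseteq> {\<omega> \<in> space M. partition_sum ?D ?D ts \<omega> > \<delta>2}
            \<union> {\<omega> \<in> space M. \<bar>partition_sum (X n) (X n) ts \<omega> - ip (X n) (X n)\<bar> > \<delta>1}"
          proof (safe, rule ccontr)
            fix \<omega> assume w: "\<epsilon> < \<bar>partition_sum F F ts \<omega> - s\<^sup>2\<bar>" "\<not> \<delta>1 < \<bar>partition_sum (X n) (X n) ts \<omega> - ip (X n) (X n)\<bar>"
              "\<not> \<delta>2 < partition_sum ?D ?D ts \<omega>"
            let ?P = "partition_sum (X n) (X n) ts \<omega>"
            have "\<bar>ip (X n) (X n) - s\<^sup>2\<bar> < \<delta>1" by (rule N2) (simp add: n_def)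
            then have ps: "\<bar>?P - s\<^sup>2\<bar> < 2 * \<delta>1" using w(2) by linarith
            then have "\<eta> * ?P \<le> \<eta> * (s\<^sup>2 + 2)" using d1(2) eta by (intro mult_left_mono) auto
            moreover have "(1 + 1 / \<eta>) * partition_sum ?D ?D ts \<omega> \<le> (1 + 1 / \<eta>) * \<delta>2"
              using w(3) i by (intro mult_left_mono) auto
            ultimately have "\<bar>partition_sum F F ts \<omega> - ?P\<bar> \<le> \<epsilon> / 4 + \<epsilon> / 4"
              using partition_sum_perturb[OF elim(3) eta, of F \<omega> "X n"] id es by linarith
            then show False using ps w(1) d1(3) by linarith
          qed
        qed measurable
        then show ?case using elim by simp
      qed
    next
      fix a :: real assume "a < 0"
      then show "\<forall>\<^sub>F ts in partition_filter. a < prob {\<omega> \<in> space M. \<epsilon> < \<bar>partition_sum F F ts \<omega> - s\<^sup>2\<bar>}"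
        by (auto intro!: always_eventually intro: less_le_trans)
    qed
  qed simp
  then show ?thesis ..
qed

lemma prob_conv_const: "F \<in> S \<Longrightarrow> prob_conv M (\<lambda>_. F) F"
  by (auto simp: prob_conv_def sf_diff_def partition_sum_def)

text \<open>For fixed n the difference X n - F is itself a \<open>prob_conv\<close> limit of the
  elements X n - X m of the span, so its squared norm exists and is a constant. That these constants
  tend to 0 is read off at one partition and one sample point.\<close>

lemma prob_conv_imp_H:
  assumes X: "\<And>n. X n \<in> S" and F: "random_setfun M F" and lim: "prob_conv M X F"
  shows "sf_tendsto M X F"
proof -
  have "\<exists>r. has_inner M (sf_diff (X n) F) (sf_diff (X n) F) (\<lambda>_. r)" for n
  proof (rule prob_conv_has_inner_self)
    show "prob_conv M (\<lambda>m. sf_lincomb 1 (X n) (- 1) (X m)) (sf_diff (X n) F)"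
      unfolding sf_diff_lincomb using X F by (intro prob_conv_lincomb prob_conv_const lim) (auto intro: random)
  qed (auto intro!: lincomb X F random_setfun_diff[OF random])
  then obtain r where r: "\<And>n. has_inner M (sf_diff (X n) F) (sf_diff (X n) F) (\<lambda>_. r n)" by metis
  have "r \<longlonglongrightarrow> 0"
  proof (rule LIMSEQ_I)
    fix \<epsilon> :: real assume e: "\<epsilon> > 0"
    then obtain N where N: "\<And>n. n \<ge> N \<Longrightarrow> \<forall>\<^sub>F ts in partition_filter.
         prob {\<omega> \<in> space M. partition_sum (sf_diff (X n) F) (sf_diff (X n) F) ts \<omega> > \<epsilon> / 3} < 1 / 2"
      using prob_convE[OF lim, of "\<epsilon> / 3" "1 / 2"] by auto
    have "norm (r n - 0) < \<epsilon>" if n: "n \<ge> N" for n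
    proof -
      let ?D = "sf_diff (X n) F"
      have "\<forall>\<^sub>F ts in partition_filter. is_partition ts \<and>
         prob {\<omega> \<in> space M. partition_sum ?D ?D ts \<omega> > \<epsilon> / 3} < 1 / 2 \<and>
         prob {\<omega> \<in> space M. \<bar>partition_sum ?D ?D ts \<omega> - r n\<bar> > \<epsilon> / 3} < 1 / 2"
        using eventually_is_partition N[OF n] has_inner_eventually_near[OF r[of n], of "\<epsilon> / 3" "1 / 2"] e
        by (auto intro!: eventually_conj)
      then obtain ts where ts: "is_partition ts"
         "prob {\<omega> \<in> space M. partition_sum ?D ?D ts \<omega> > \<epsilon> / 3} < 1 / 2"
         "prob {\<omega> \<in> space M. \<bar>partition_sum ?D ?D ts \<omega> - r n\<bar> > \<epsilon> / 3} < 1 / 2"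
        using eventually_happens'[OF partition_filter_not_bot] by blast
      have [measurable]: "partition_sum ?D ?D ts \<in> borel_measurable M"
        using X F ts(1) by (auto intro!: partition_sum_measurable random_setfun_diff random[OF X])
      obtain \<omega> where w: "\<omega> \<in> space M" "\<omega> \<notin> {\<omega> \<in> space M. partition_sum ?D ?D ts \<omega> > \<epsilon> / 3}"
        "\<omega> \<notin> {\<omega> \<in> space M. \<bar>partition_sum ?D ?D ts \<omega> - r n\<bar> > \<epsilon> / 3}" "\<omega> \<notin> {}"
      proof (rule ex_outside3)
        show "prob {\<omega> \<in> space M. partition_sum ?D ?D ts \<omega> > \<epsilon> / 3}
          + prob {\<omega> \<in> space M. \<bar>partition_sum ?D ?D ts \<omega> - r n\<bar> > \<epsilon> / 3} + prob {} < 1" using ts by simp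
      qed auto
      then have "\<not> partition_sum ?D ?D ts \<omega> > \<epsilon> / 3" "\<not> \<bar>partition_sum ?D ?D ts \<omega> - r n\<bar> > \<epsilon> / 3" by auto
      then have "r n \<le> 2 * (\<epsilon> / 3)" by linarith
      moreover have "r n \<ge> 0" using has_inner_nonneg r by blast
      ultimately show ?thesis using e by simp
    qed
    then show "\<exists>N. \<forall>n\<ge>N. norm (r n - 0) < \<epsilon>" by blast
  qed
  then show ?thesis unfolding sf_tendsto_def using r by (intro exI[of _ "\<lambda>n \<omega>. r n"]) auto
qed

lemma H_E:
  assumes "F \<in> H"
  obtains X where "\<And>n. X n \<in> S" "prob_conv M X F" "sf_tendsto M X F" "random_setfun M F"
  using assms sf_tendsto_imp_prob_conv random unfolding H_def by blast

lemma prob_conv_in_H: "(\<And>n. X n \<in> S) \<Longrightarrow> random_setfun M F \<Longrightarrow> prob_conv M X F \<Longrightarrow> F \<in> H"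
  unfolding H_def using prob_conv_imp_H by blast

lemma S_subset_H: "F \<in> S \<Longrightarrow> F \<in> H"
  by (rule prob_conv_in_H[of "\<lambda>_. F"]) (auto intro: random prob_conv_const)

text \<open>Carried out with \<open>prob_conv\<close>: under \<open>sf_tendsto\<close> the squared
  distance of the combined sequences would have to exist beforehand.\<close>

lemma H_lincomb:
  assumes "F \<in> H" "G \<in> H"
  shows "sf_lincomb c F d G \<in> H"
proof -
  obtain X where X: "\<And>n. X n \<in> S" "prob_conv M X F" "random_setfun M F" using assms(1) by (rule H_E) blast
  obtain Y where Y: "\<And>n. Y n \<in> S" "prob_conv M Y G" "random_setfun M G" using assms(2) by (rule H_E) blast
  show ?thesis using X Y
    by (intro prob_conv_in_H[of "\<lambda>n. sf_lincomb c (X n) d (Y n)"] prob_conv_lincomb)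
       (auto intro: lincomb random random_setfun_lincomb)
qed

lemma H_has_inner_self: "F \<in> H \<Longrightarrow> \<exists>r. has_inner M F F (\<lambda>_. r)"
  by (erule H_E) (rule prob_conv_has_inner_self)

sublocale HH: const_inner M H
proof
  show "H \<noteq> {}" using nonempty S_subset_H by blast
  show r: "random_setfun M F" if "F \<in> H" for F using that by (simp add: H_def)
  show "sf_lincomb c F d G \<in> H" if "F \<in> H" "G \<in> H" for F G c d using that by (rule H_lincomb)
  show "\<exists>r. has_inner M F G (\<lambda>_. r)" if FG: "F \<in> H" "G \<in> H" for F G
    using H_has_inner_self[OF H_lincomb[OF FG, of 1 1]] H_has_inner_self[OF H_lincomb[OF FG, of 1 "- 1"]]
      has_inner_polarization[OF r[OF FG(1)] r[OF FG(2)]] by blast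
qed

lemma H_approx:
  assumes "F \<in> H"
  obtains X where "\<And>n. X n \<in> S" "(\<lambda>n. nrm (sf_diff (X n) F)) \<longlonglongrightarrow> 0"
proof -
  obtain X where X: "\<And>n. X n \<in> S" "sf_tendsto M X F" using assms by (rule H_E) blast
  then have "(\<lambda>n. nrm (sf_diff (X n) F)) \<longlonglongrightarrow> 0" using HH.sf_tendsto_iff[of X F] assms S_subset_H by blast
  then show ?thesis using that X by blast
qed


section \<open>Completeness of the closure\<close>

lemma interval_in_partition:
  fixes s t :: real
  assumes "0 \<le> s" "s < t" "t \<le> 1"
  obtains ts j where "is_partition ts" "j < length ts - 1" "ts ! j = s" "ts ! Suc j = t"
proof
  let ?ts = "(if s = 0 then [] else [0]) @ [s, t] @ (if t = 1 then [] else [1])"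
  let ?j = "if s = 0 then 0 else 1"
  show "is_partition ?ts" using assms by (auto simp: is_partition_def)
  show "?j < length ?ts - 1" by auto
  show "?ts ! ?j = s" "?ts ! Suc ?j = t" by auto
qed

text \<open>Every interval belongs to some partition, and the partition sum, having nonnegative
  terms, dominates the one term of that interval.\<close>

lemma second_moment_interval:
  assumes F: "F \<in> S" and st: "0 \<le> s" "s < t" "t \<le> 1"
  shows "(\<integral>\<^sup>+\<omega>. ennreal ((F s t \<omega>)\<^sup>2 * (t - s)) \<partial>M) \<le> ennreal (2 * ip F F)"
proof -
  obtain ts j where ts: "is_partition ts" "j < length ts - 1" "ts ! j = s" "ts ! Suc j = t"
    using interval_in_partition[OF st] .
  have "(F s t \<omega>)\<^sup>2 * (t - s) \<le> partition_sum F F ts \<omega>" for \<omega>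
  proof -
    let ?f = "\<lambda>j. F (ts ! j) (ts ! Suc j) \<omega> * F (ts ! j) (ts ! Suc j) \<omega> * (ts ! Suc j - ts ! j)"
    have "?f j \<le> sum ?f {..<length ts - 1}"
      using ts partition_interval(2)[OF ts(1)]
      by (intro member_le_sum mult_nonneg_nonneg[OF zero_le_square]) (auto simp: less_imp_le)
    then show ?thesis unfolding partition_sum_def by (simp add: ts(3,4) power2_eq_square)
  qed
  then have "(\<integral>\<^sup>+\<omega>. ennreal ((F s t \<omega>)\<^sup>2 * (t - s)) \<partial>M) \<le> (\<integral>\<^sup>+\<omega>. ennreal (partition_sum F F ts \<omega>) \<partial>M)"
    by (intro nn_integral_mono ennreal_leI)
  also have "\<dots> \<le> ennreal (2 * ip F F)" by (rule second_moment[OF F ts(1)])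
  finally show ?thesis .
qed

text \<open>The expected absolute increments along a fast sequence are summable, so almost surely
  the increments themselves are absolutely summable.\<close>

lemma AE_convergent_interval:
  assumes V: "\<And>n. V n \<in> S" and fast: "\<And>k. ip (sf_diff (V (Suc k)) (V k)) (sf_diff (V (Suc k)) (V k)) \<le> (1 / 4) ^ k"
    and st: "0 \<le> s" "s < t" "t \<le> 1"
  shows "AE \<omega> in M. convergent (\<lambda>k. V k s t \<omega>)"
proof -
  let ?d = "\<lambda>k \<omega>. \<bar>V (Suc k) s t \<omega> - V k s t \<omega>\<bar>"
  have [measurable]: "V k s t \<in> borel_measurable M" for k
    using random[OF V[of k]] st by (simp add: random_setfun_def)
  have bound: "(\<integral>\<^sup>+\<omega>. ennreal (?d k \<omega>) \<partial>M) \<le> ennreal ((1 / (t - s) + 1) * (1 / 2) ^ k)" for k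
  proof -
    let ?D = "sf_diff (V (Suc k)) (V k)"
    have D: "?D \<in> S" using V by (simp add: diff)
    have [measurable]: "?D s t \<in> borel_measurable M" using random[OF D] st by (simp add: random_setfun_def)
    \<comment> \<open>From the square (2^k |D| - 1)^2 / 2^k being nonnegative. The weight is chosen
      for a mean square of order 4^(-k): both summands then have expectation of order
      2^(-k).\<close>
    have "?d k \<omega> \<le> 2 ^ k / (2 * (t - s)) * ((?D s t \<omega>)\<^sup>2 * (t - s)) + (1 / 2) ^ k / 2" for \<omega>
    proof -
      have "0 \<le> (2 ^ k * \<bar>?D s t \<omega>\<bar> - 1)\<^sup>2 * (1 / 2) ^ k" by simp
      also have "\<dots> = 2 ^ k * \<bar>?D s t \<omega>\<bar>\<^sup>2 - 2 * \<bar>?D s t \<omega>\<bar> + (1 / 2) ^ k"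
        by (simp add: power2_eq_square power_one_over field_simps)
      finally have "\<bar>?D s t \<omega>\<bar> \<le> 2 ^ k * \<bar>?D s t \<omega>\<bar>\<^sup>2 / 2 + (1 / 2) ^ k / 2" by linarith
      moreover have "a / (2 * d) * (b * d) = a * b / 2" if "d \<noteq> 0" for a b d :: real using that by simp
      from this[of "t - s" "2 ^ k" "(?D s t \<omega>)\<^sup>2"]
      have "2 ^ k / (2 * (t - s)) * ((?D s t \<omega>)\<^sup>2 * (t - s)) = 2 ^ k * \<bar>?D s t \<omega>\<bar>\<^sup>2 / 2" using st by simp
      ultimately show ?thesis unfolding sf_diff_def by linarith
    qed
    then have "(\<integral>\<^sup>+\<omega>. ennreal (?d k \<omega>) \<partial>M) \<le> 
      (\<integral>\<^sup>+\<omega>. ennreal (2 ^ k / (2 * (t - s))) * ennreal ((?D s t \<omega>)\<^sup>2 * (t - s)) + ennreal ((1 / 2) ^ k / 2) \<partial>M)"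
      using st by (intro nn_integral_mono) (simp add: ennreal_mult[symmetric] ennreal_plus[symmetric] del: ennreal_plus)
    also have "\<dots> = ennreal (2 ^ k / (2 * (t - s))) * (\<integral>\<^sup>+\<omega>. ennreal ((?D s t \<omega>)\<^sup>2 * (t - s)) \<partial>M) + ennreal ((1 / 2) ^ k / 2)"
      by (subst nn_integral_add) (auto simp: nn_integral_cmult emeasure_space_1)
    also have "\<dots> \<le> ennreal (2 ^ k / (2 * (t - s))) * ennreal (2 * (1 / 4) ^ k) + ennreal ((1 / 2) ^ k / 2)"
      using second_moment_interval[OF D st] fast[of k]
      by (intro add_right_mono mult_left_mono) (auto elim!: order_trans intro!: ennreal_leI)
    also have "\<dots> = ennreal (2 ^ k / (2 * (t - s)) * (2 * (1 / 4) ^ k) + (1 / 2) ^ k / 2)"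
      using st by (simp add: ennreal_mult[symmetric] ennreal_plus[symmetric] del: ennreal_plus)
    also have "\<dots> \<le> ennreal ((1 / (t - s) + 1) * (1 / 2) ^ k)"
    proof (rule ennreal_leI)
      have "2 ^ k * (1 / 4 :: real) ^ k = (1 / 2) ^ k" by (simp add: power_mult_distrib[symmetric])
      then have "2 ^ k / (2 * (t - s)) * (2 * (1 / 4) ^ k) = 1 / (t - s) * (1 / 2) ^ k"
        using st by (simp add: field_simps)
      then show "2 ^ k / (2 * (t - s)) * (2 * (1 / 4) ^ k) + (1 / 2) ^ k / 2 \<le> (1 / (t - s) + 1) * (1 / 2) ^ k"
        by (simp add: distrib_right)
    qed
    finally show ?thesis .
  qed
  have "(\<integral>\<^sup>+\<omega>. (\<Sum>k. ennreal (?d k \<omega>)) \<partial>M) = (\<Sum>k. \<integral>\<^sup>+\<omega>. ennreal (?d k \<omega>) \<partial>M)"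
    by (rule nn_integral_suminf) measurable
  also have "\<dots> \<le> (\<Sum>k. ennreal ((1 / (t - s) + 1) * (1 / 2) ^ k))"
    by (intro suminf_le bound) auto
  also have "\<dots> = ennreal (\<Sum>k. (1 / (t - s) + 1) * (1 / 2) ^ k)"
    using st by (intro suminf_ennreal2 summable_mult summable_geometric) auto
  also have "\<dots> < \<infinity>" by simp
  finally have "AE \<omega> in M. (\<Sum>k. ennreal (?d k \<omega>)) \<noteq> \<infinity>"
    by (intro nn_integral_PInf_AE) auto
  then show ?thesis
  proof eventually_elim
    case (elim \<omega>)
    then have "summable (\<lambda>k. ?d k \<omega>)" by (intro summable_suminf_not_top) auto
    then have "summable (\<lambda>k. V (Suc k) s t \<omega> - V k s t \<omega>)" by (rule summable_rabs_cancel)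
    from summable_LIMSEQ[OF this]
    have "(\<lambda>n. V n s t \<omega> - V 0 s t \<omega>) \<longlonglongrightarrow> (\<Sum>k. V (Suc k) s t \<omega> - V k s t \<omega>)"
      unfolding sum_lessThan_telescope[of "\<lambda>k. V k s t \<omega>"] .
    from tendsto_add[OF this tendsto_const[of "V 0 s t \<omega>"]] show ?case by (auto simp: convergent_def)
  qed
qed

text \<open>The limit is built interval by interval as a pointwise limit along a fast subsequence.
  Its exceptional null set depends on the interval, but a partition involves only finitely many
  intervals; there Fatou's lemma carries the second moment bound to the limit, uniformly in the
  partition.\<close>

lemma S_complete:
  assumes Y: "\<And>n. Y n \<in> S" and Cauchy: "\<And>e. e > 0 \<Longrightarrow> \<exists>N. \<forall>m\<ge>N. \<forall>n\<ge>N. nrm (sf_diff (Y m) (Y n)) < e"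
  shows "\<exists>F\<in>H. (\<lambda>n. nrm (sf_diff (Y n) F)) \<longlonglongrightarrow> 0"
proof -
  have "\<exists>N. \<forall>m\<ge>N. \<forall>n\<ge>N. nrm (sf_diff (Y m) (Y n)) < (1 / 2) ^ k" for k using Cauchy by simp
  then obtain N where N: "\<And>k m n. m \<ge> N k \<Longrightarrow> n \<ge> N k \<Longrightarrow> nrm (sf_diff (Y m) (Y n)) < (1 / 2) ^ k" by metis
  \<comment> \<open>Summing all N i up to k gives indices that exceed N k for every later position
    as well.\<close>
  define r where "r k = (\<Sum>i\<le>k. N i)" for k
  have rN: "r m \<ge> N k" if "m \<ge> k" for m k
    unfolding r_def using that by (intro member_le_sum) auto
  define V where "V k = Y (r k)" for k
  have V: "V k \<in> S" for k by (simp add: V_def Y)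
  have fast: "ip (sf_diff (V m) (V n)) (sf_diff (V m) (V n)) \<le> (1 / 4) ^ k" if "m \<ge> k" "n \<ge> k" for m n k
  proof -
    have "(nrm (sf_diff (V m) (V n)))\<^sup>2 \<le> ((1 / 2) ^ k)\<^sup>2"
      using N[of k "r m" "r n"] rN that by (intro power_mono nrm_nonneg diff V) (auto simp: V_def less_imp_le)
    also have "((1 / 2 :: real) ^ k)\<^sup>2 = (1 / 4) ^ k"
      by (simp add: power2_eq_square power_mult_distrib[symmetric])
    finally show ?thesis by (simp add: nrm_square diff V)
  qed
  \<comment> \<open>Where the sequence diverges \<open>lim\<close> has an arbitrary value; F is
    measurable all the same, and for each interval this happens on a null set.\<close>
  define F where "F s t \<omega> = lim (\<lambda>k. V k s t \<omega>)" for s t \<omega>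
  have Vm: "V k s t \<in> borel_measurable M" if "0 \<le> s" "s < t" "t \<le> 1" for k s t
    using random[OF V[of k]] that by (simp add: random_setfun_def)
  have F: "random_setfun M F"
    unfolding random_setfun_def F_def[abs_def] by (intro allI impI borel_measurable_lim_metric Vm) auto
  have "prob_conv M V F"
    unfolding prob_conv_def
  proof (intro allI impI)
    fix \<delta> \<eta> :: real assume d: "\<delta> > 0" and e: "\<eta> > 0"
    have "(\<lambda>k. 2 / \<delta> * (1 / 4) ^ k) \<longlonglongrightarrow> 2 / \<delta> * 0" by (intro tendsto_intros) auto
    then have "\<forall>\<^sub>F k in sequentially. 2 / \<delta> * (1 / 4) ^ k < \<eta>" using e by (auto dest: order_tendstoD)
    then obtain K where K: "\<And>k. k \<ge> K \<Longrightarrow> 2 / \<delta> * (1 / 4) ^ k < \<eta>" by (auto simp: eventually_sequentially)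
    show "\<exists>N. \<forall>n\<ge>N. \<forall>\<^sub>F ts in partition_filter.
      prob {\<omega> \<in> space M. \<delta> < partition_sum (sf_diff (V n) F) (sf_diff (V n) F) ts \<omega>} < \<eta>"
    proof (intro exI[of _ K] allI impI eventually_mono[OF eventually_is_partition])
      fix n ts assume n: "n \<ge> K" and ts: "is_partition ts"
      let ?D = "sf_diff (V n) F" and ?E = "\<lambda>m. sf_diff (V n) (V m)"
      have E: "?E m \<in> S" for m using V by (simp add: diff)
      have [measurable]: "partition_sum ?D ?D ts \<in> borel_measurable M"
        by (intro partition_sum_measurable random_setfun_diff F random V ts)
      have [measurable]: "partition_sum (?E m) (?E m) ts \<in> borel_measurable M" for m
        by (intro partition_sum_measurable random E ts)
      have "AE \<omega> in M. \<forall>j<length ts - 1. convergent (\<lambda>k. V k (ts ! j) (ts ! Suc j) \<omega>)"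
        using partition_interval[OF ts] fast
        by (auto simp: AE_all_countable intro!: AE_convergent_interval V AE_impI)
      then have "AE \<omega> in M. (\<lambda>m. partition_sum (?E m) (?E m) ts \<omega>) \<longlonglongrightarrow> partition_sum ?D ?D ts \<omega>"
      proof eventually_elim
        case (elim \<omega>)
        then have "(\<lambda>k. V k (ts ! j) (ts ! Suc j) \<omega>) \<longlonglongrightarrow> F (ts ! j) (ts ! Suc j) \<omega>" if "j < length ts - 1" for j
          using that by (simp add: F_def convergent_LIMSEQ_iff)
        then show ?case unfolding partition_sum_def sf_diff_def by (intro tendsto_intros) auto
      qed
      then have "(\<integral>\<^sup>+\<omega>. ennreal (partition_sum ?D ?D ts \<omega>) \<partial>M) = 
        (\<integral>\<^sup>+\<omega>. liminf (\<lambda>m. ennreal (partition_sum (?E m) (?E m) ts \<omega>)) \<partial>M)"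
        by (intro nn_integral_cong_AE, eventually_elim)
           (auto intro!: lim_imp_Liminf[symmetric] tendsto_ennrealI)
      \<comment> \<open>Fatou's lemma, with n fixed and m tending to infinity.\<close>
      also have "\<dots> \<le> liminf (\<lambda>m. \<integral>\<^sup>+\<omega>. ennreal (partition_sum (?E m) (?E m) ts \<omega>) \<partial>M)"
        by (rule nn_integral_liminf) measurable
      also have "\<dots> \<le> liminf (\<lambda>m. ennreal (2 * (1 / 4) ^ n))"
      proof (rule Liminf_mono, rule eventually_sequentiallyI[of n])
        fix m assume "m \<ge> n"
        then show "(\<integral>\<^sup>+\<omega>. ennreal (partition_sum (?E m) (?E m) ts \<omega>) \<partial>M) \<le> ennreal (2 * (1 / 4) ^ n)"
          using second_moment[OF E ts, of m] fast[of n n m] by (auto elim!: order_trans intro!: ennreal_leI)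
      qed
      also have "\<dots> = ennreal (2 * (1 / 4) ^ n)" by (simp add: Liminf_const)
      finally have *: "(\<integral>\<^sup>+\<omega>. ennreal (partition_sum ?D ?D ts \<omega>) \<partial>M) \<le> ennreal (2 * (1 / 4) ^ n)" .
      have "ennreal (prob {\<omega> \<in> space M. \<delta> < partition_sum ?D ?D ts \<omega>}) \<le> 
        emeasure M {\<omega> \<in> space M. 1 \<le> ennreal (1 / \<delta>) * ennreal (partition_sum ?D ?D ts \<omega>)}"
      proof -
        have "{\<omega> \<in> space M. \<delta> < partition_sum ?D ?D ts \<omega>} \<subseteq> 
          {\<omega> \<in> space M. 1 \<le> ennreal (1 / \<delta>) * ennreal (partition_sum ?D ?D ts \<omega>)}"
          using d by (auto simp: ennreal_mult[symmetric] partition_sum_nonneg[OF ts] simp flip: ennreal_1 intro!: ennreal_leI)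
        then show ?thesis unfolding emeasure_eq_measure[symmetric] by (intro emeasure_mono) auto
      qed
      also have "\<dots> \<le> ennreal (1 / \<delta>) * (\<integral>\<^sup>+\<omega>. ennreal (partition_sum ?D ?D ts \<omega>) * indicator (space M) \<omega> \<partial>M)"
        by (rule nn_integral_Markov_inequality) auto
      also have "\<dots> = ennreal (1 / \<delta>) * (\<integral>\<^sup>+\<omega>. ennreal (partition_sum ?D ?D ts \<omega>) \<partial>M)"
        by (intro arg_cong[where f = "\<lambda>x. _ * x"] nn_integral_cong) auto
      also have "\<dots> \<le> ennreal (1 / \<delta>) * ennreal (2 * (1 / 4) ^ n)" by (intro mult_left_mono *) auto
      also have "\<dots> = ennreal (2 / \<delta> * (1 / 4) ^ n)" using d by (simp add: ennreal_mult[symmetric])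
      finally have "prob {\<omega> \<in> space M. \<delta> < partition_sum ?D ?D ts \<omega>} \<le> 2 / \<delta> * (1 / 4) ^ n"
        using d by (subst (asm) ennreal_le_iff) auto
      then show "prob {\<omega> \<in> space M. \<delta> < partition_sum ?D ?D ts \<omega>} < \<eta>" using K[OF n] by simp
    qed
  qed
  then have FH: "F \<in> H" and "sf_tendsto M V F" using prob_conv_in_H prob_conv_imp_H V F by blast+
  then have VF: "(\<lambda>k. nrm (sf_diff (V k) F)) \<longlonglongrightarrow> 0" using HH.sf_tendsto_iff[of V F] V S_subset_H by blast
  have "(\<lambda>n. nrm (sf_diff (Y n) F)) \<longlonglongrightarrow> 0"
  proof (rule LIMSEQ_I)
    fix e :: real assume e: "e > 0"
    obtain N1 where N1: "\<And>m n. m \<ge> N1 \<Longrightarrow> n \<ge> N1 \<Longrightarrow> nrm (sf_diff (Y m) (Y n)) < e / 2" 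
      using Cauchy[of "e / 2"] e by auto
    obtain k1 where k1: "\<And>k. k \<ge> k1 \<Longrightarrow> nrm (sf_diff (V k) F) < e / 2"
      using order_tendstoD(2)[OF VF, of "e / 2"] e unfolding eventually_sequentially by auto
    obtain k2 where k2: "(1 / 2 :: real) ^ k2 < e / 2" using real_arch_pow_inv[of "e / 2" "1 / 2"] e by auto
    define k where "k = max k1 k2"
    have "norm (nrm (sf_diff (Y n) F) - 0) < e" if n: "n \<ge> N k2" for n
    proof -
      have "nrm (sf_diff (Y n) F) \<le> nrm (sf_diff (Y n) (V k)) + nrm (sf_diff (V k) F)"
        by (intro HH.nrm_diff_triangle S_subset_H Y V FH)
      moreover have "nrm (sf_diff (Y n) (V k)) < e / 2"
        using N[OF n rN[of k2 k]] k2 by (simp add: V_def k_def)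
      moreover have "nrm (sf_diff (V k) F) < e / 2" using k1 by (simp add: k_def)
      moreover have "0 \<le> nrm (sf_diff (Y n) F)" by (intro HH.nrm_nonneg HH.diff S_subset_H Y FH)
      ultimately show ?thesis by simp
    qed
    then show "\<exists>N. \<forall>n\<ge>N. norm (nrm (sf_diff (Y n) F) - 0) < e" by blast
  qed
  with FH show ?thesis by blast
qed

text \<open>Each term is replaced by an element of the span at distance below 1 / (n + 1), which
  preserves the Cauchy property and the limit; this reduces the claim to sequences in the
  span.\<close>

lemma H_complete:
  assumes X: "\<And>n. X n \<in> H" and Cauchy: "\<And>e. e > 0 \<Longrightarrow> \<exists>N. \<forall>m\<ge>N. \<forall>n\<ge>N. nrm (sf_diff (X m) (X n)) < e"
  shows "\<exists>F\<in>H. (\<lambda>n. nrm (sf_diff (X n) F)) \<longlonglongrightarrow> 0"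
proof -
  have "\<exists>Y\<in>S. nrm (sf_diff Y (X n)) < inverse (real (Suc n))" for n
  proof -
    obtain Z where Z: "\<And>k. Z k \<in> S" "(\<lambda>k. nrm (sf_diff (Z k) (X n))) \<longlonglongrightarrow> 0" using H_approx[OF X[of n]] by blast
    from LIMSEQ_D[OF Z(2), of "inverse (real (Suc n))"] obtain k where
      "\<forall>i\<ge>k. norm (nrm (sf_diff (Z i) (X n)) - 0) < inverse (real (Suc n))" by auto
    then have "nrm (sf_diff (Z k) (X n)) < inverse (real (Suc n))" by (auto simp: abs_less_iff)
    with Z(1) show ?thesis by blast
  qed
  then obtain Y where Y: "\<And>n. Y n \<in> S" "\<And>n. nrm (sf_diff (Y n) (X n)) < inverse (real (Suc n))" by metis
  have YH: "Y n \<in> H" for n using Y(1) S_subset_H by blast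
  have YX: "(\<lambda>n. nrm (sf_diff (Y n) (X n))) \<longlonglongrightarrow> 0"
  proof (rule Lim_null_comparison[OF _ LIMSEQ_inverse_real_of_nat], rule always_eventually, rule allI)
    fix n show "norm (nrm (sf_diff (Y n) (X n))) \<le> inverse (real (Suc n))"
      using Y(2)[of n] HH.nrm_nonneg[OF HH.diff[OF YH X], of n n] by simp
  qed
  have "\<exists>N. \<forall>m\<ge>N. \<forall>n\<ge>N. nrm (sf_diff (Y m) (Y n)) < e" if e: "e > 0" for e
  proof -
    obtain N1 where N1: "\<And>m n. m \<ge> N1 \<Longrightarrow> n \<ge> N1 \<Longrightarrow> nrm (sf_diff (X m) (X n)) < e / 3" using Cauchy[of "e / 3"] e by auto
    obtain N2 where N2: "\<And>n. n \<ge> N2 \<Longrightarrow> nrm (sf_diff (Y n) (X n)) < e / 3" using order_tendstoD(2)[OF YX, of "e / 3"] e unfolding eventually_sequentially by auto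
    have "nrm (sf_diff (Y m) (Y n)) < e" if mn: "m \<ge> max N1 N2" "n \<ge> max N1 N2" for m n
    proof -
      have "nrm (sf_diff (Y m) (Y n)) \<le> nrm (sf_diff (Y m) (X m)) + (nrm (sf_diff (X m) (X n)) + nrm (sf_diff (X n) (Y n)))"
        using HH.nrm_diff_triangle[OF YH[of m] X[of m] YH[of n]] HH.nrm_diff_triangle[OF X[of m] X[of n] YH[of n]] by simp
      moreover have "nrm (sf_diff (X n) (Y n)) = nrm (sf_diff (Y n) (X n))" by (rule HH.nrm_diff_commute[OF X YH])
      ultimately show ?thesis using N1[of m n] N2[of m] N2[of n] mn by simp
    qed
    then show ?thesis by blast
  qed
  from S_complete[OF Y(1) this] obtain F where F: "F \<in> H" "(\<lambda>n. nrm (sf_diff (Y n) F)) \<longlonglongrightarrow> 0" by blast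
  have "(\<lambda>n. nrm (sf_diff (X n) F)) \<longlonglongrightarrow> 0"
  proof (rule Lim_null_comparison, rule always_eventually, rule allI)
    fix n
    show "norm (nrm (sf_diff (X n) F)) \<le> nrm (sf_diff (Y n) (X n)) + nrm (sf_diff (Y n) F)"
      using HH.nrm_diff_triangle[OF X[of n] YH[of n] F(1)] HH.nrm_diff_commute[OF X[of n] YH[of n]] 
        HH.nrm_nonneg[OF HH.diff[OF X[of n] F(1)]] by simp
  next
    show "(\<lambda>n. nrm (sf_diff (Y n) (X n)) + nrm (sf_diff (Y n) F)) \<longlonglongrightarrow> 0" using tendsto_add[OF YX F(2)] by simp
  qed
  with F(1) show ?thesis by blast
qed

lemma hilbert_space_on_H: "hilbert_space_on H (sf_equiv M) (const_ip M)"
  unfolding hilbert_space_on_def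
proof (intro conjI ballI allI impI)
  show "H \<noteq> {}" by (rule HH.nonempty)
  show "sf_lincomb c F d G \<in> H" if "F \<in> H" "G \<in> H" for F G c d using that by (rule H_lincomb)
  show "ip F G = ip G F" if "F \<in> H" "G \<in> H" for F G using that by (rule HH.ip_commute)
  show "ip (sf_lincomb c F d G) K = c * ip F K + d * ip G K" if "F \<in> H" "G \<in> H" "K \<in> H" for F G K c d
    using that by (rule HH.ip_lincomb_left)
  show "0 \<le> ip F F" if "F \<in> H" for F using that by (rule HH.ip_nonneg)
  show "(ip (sf_diff F G) (sf_diff F G) = 0) = sf_equiv M F G" if "F \<in> H" "G \<in> H" for F G
    using HH.sf_equiv_iff[OF that] by (simp add: const_nrm_def)
next
  fix X assume X: "(\<forall>n::nat. X n \<in> H) \<and>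
     (\<forall>\<epsilon>>0. \<exists>N. \<forall>m\<ge>N. \<forall>n\<ge>N. sqrt (ip (sf_diff (X m) (X n)) (sf_diff (X m) (X n))) < \<epsilon>)"
  then show "\<exists>F\<in>H. (\<lambda>n. sqrt (ip (sf_diff (X n) F) (sf_diff (X n) F))) \<longlonglongrightarrow> 0"
    using H_complete[of X] unfolding const_nrm_def by blast
qed

end

section \<open>Gaussian sheets\<close>

text \<open>The fourth moment is expressed by the second one, so that \<open>\<sigma>\<close>, which
  varies with the linear combination and is only known to exist, disappears. The degenerate law is
  included.\<close>

lemma centered_gaussian_moments:
  assumes "\<sigma> \<ge> 0"
  shows "integrable (centered_gaussian \<sigma>) (\<lambda>x. x ^ k)" "(LINT x|centered_gaussian \<sigma>. x) = 0"
    "(LINT x|centered_gaussian \<sigma>. x ^ 4) = 3 * (LINT x|centered_gaussian \<sigma>. x ^ 2)\<^sup>2"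
proof -
  have "integrable (centered_gaussian \<sigma>) (\<lambda>x. x ^ k) \<and> (LINT x|centered_gaussian \<sigma>. x) = 0 \<and>
    (LINT x|centered_gaussian \<sigma>. x ^ 4) = 3 * (LINT x|centered_gaussian \<sigma>. x ^ 2)\<^sup>2"
  proof (cases "\<sigma> = 0")
    case True
    have "integrable (return borel (0::real)) (\<lambda>x. x ^ k)"
      by (rule integrableI_bounded) (auto simp: nn_integral_return)
    then show ?thesis by (simp add: True centered_gaussian_def integral_return)
  next
    case False
    then have s: "\<sigma> > 0" using assms by simp
    have d: "centered_gaussian \<sigma> = density lborel (\<lambda>x. ennreal (normal_density 0 \<sigma> x))"
      using False by (simp add: centered_gaussian_def)
    have "(LINT x|centered_gaussian \<sigma>. x) = 0"
      unfolding d using integral_normal_moment_odd[OF s, of 0 0] by (subst integral_density) auto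
    moreover have "(LINT x|centered_gaussian \<sigma>. x ^ 2) = \<sigma>\<^sup>2"
      unfolding d using integral_normal_moment_even[OF s, of 0 1] by (subst integral_density) auto
    moreover have "(LINT x|centered_gaussian \<sigma>. x ^ 4) = 3 * \<sigma> ^ 4"
      unfolding d using integral_normal_moment_even[OF s, of 0 2]
      by (subst integral_density) (auto simp: fact_numeral power2_eq_square power_divide eval_nat_numeral)
    moreover have "integrable (centered_gaussian \<sigma>) (\<lambda>x. x ^ k)"
      unfolding d using integrable_normal_moment[OF s, of 0 k] by (subst integrable_density) auto
    ultimately show ?thesis by simp
  qed
  then show "integrable (centered_gaussian \<sigma>) (\<lambda>x. x ^ k)" "(LINT x|centered_gaussian \<sigma>. x) = 0"
    "(LINT x|centered_gaussian \<sigma>. x ^ 4) = 3 * (LINT x|centered_gaussian \<sigma>. x ^ 2)\<^sup>2" by auto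
qed

text \<open>A linear space of centered Gaussian variables. Gaussianity is given for linear
  combinations within one sheet, so there is one such space for each order, and different orders are
  combined by independence.\<close>

locale gaussian_space = prob_space M for M :: "'w measure" +
  fixes V :: "('w \<Rightarrow> real) set"
  assumes measurable_V: "Z \<in> V \<Longrightarrow> Z \<in> borel_measurable M"
    and gaussian: "Z \<in> V \<Longrightarrow> \<exists>\<sigma>\<ge>0. distr M borel Z = centered_gaussian \<sigma>"
    and lincomb: "X \<in> V \<Longrightarrow> Y \<in> V \<Longrightarrow> (\<lambda>\<omega>. c * X \<omega> + d * Y \<omega>) \<in> V"
begin

lemma integrable_power_V: "Z \<in> V \<Longrightarrow> integrable M (\<lambda>\<omega>. Z \<omega> ^ k)"
  and mean_V: "Z \<in> V \<Longrightarrow> expectation Z = 0"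
  and fourth_moment_V: "Z \<in> V \<Longrightarrow> expectation (\<lambda>\<omega>. Z \<omega> ^ 4) = 3 * (expectation (\<lambda>\<omega>. (Z \<omega>)\<^sup>2))\<^sup>2"
proof -
  have *: "integrable M (\<lambda>\<omega>. Z \<omega> ^ k) \<and> expectation Z = 0 \<and>
    expectation (\<lambda>\<omega>. Z \<omega> ^ 4) = 3 * (expectation (\<lambda>\<omega>. (Z \<omega>)\<^sup>2))\<^sup>2" if Z: "Z \<in> V"
  proof -
    have [measurable]: "Z \<in> borel_measurable M" using Z by (rule measurable_V)
    obtain \<sigma> where s: "\<sigma> \<ge> 0" "distr M borel Z = centered_gaussian \<sigma>" using gaussian[OF Z] by blast
    show ?thesis
      using centered_gaussian_moments(1)[OF s(1), of k] centered_gaussian_moments(1)[OF s(1), of 1]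
        centered_gaussian_moments(2,3)[OF s(1)] unfolding s(2)[symmetric]
      by (simp add: integrable_distr_eq integral_distr)
  qed
  show "Z \<in> V \<Longrightarrow> integrable M (\<lambda>\<omega>. Z \<omega> ^ k)" "Z \<in> V \<Longrightarrow> expectation Z = 0"
    "Z \<in> V \<Longrightarrow> expectation (\<lambda>\<omega>. Z \<omega> ^ 4) = 3 * (expectation (\<lambda>\<omega>. (Z \<omega>)\<^sup>2))\<^sup>2"
    using * by auto
qed

lemma add_V: "X \<in> V \<Longrightarrow> Y \<in> V \<Longrightarrow> (\<lambda>\<omega>. X \<omega> + Y \<omega>) \<in> V"
  using lincomb[of X Y 1 1] by simp

lemma diff_V: "X \<in> V \<Longrightarrow> Y \<in> V \<Longrightarrow> (\<lambda>\<omega>. X \<omega> - Y \<omega>) \<in> V"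
  using lincomb[of X Y 1 "- 1"] by simp

lemma integrable_V: "X \<in> V \<Longrightarrow> integrable M X"
  using integrable_power_V[of X 1] by simp

lemma integrable_mult4:
  assumes V: "X \<in> V" "Y \<in> V" "Z \<in> V" "U \<in> V"
  shows "integrable M (\<lambda>\<omega>. X \<omega> * Y \<omega> * Z \<omega> * U \<omega>)"
proof (rule Bochner_Integration.integrable_bound)
  show "integrable M (\<lambda>\<omega>. X \<omega> ^ 4 + Y \<omega> ^ 4 + Z \<omega> ^ 4 + U \<omega> ^ 4)"
    using V by (intro Bochner_Integration.integrable_add integrable_power_V)
  show "(\<lambda>\<omega>. X \<omega> * Y \<omega> * Z \<omega> * U \<omega>) \<in> borel_measurable M"
    using V measurable_V by (intro borel_measurable_times) auto
  have m: "a * b \<le> (a\<^sup>2 + b\<^sup>2) / 2" for a b :: real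
    using sum_squares_bound[of a b] by simp
  have "\<bar>x * y * z * u\<bar> \<le> x ^ 4 + y ^ 4 + z ^ 4 + u ^ 4" for x y z u :: real
  proof -
    have "\<bar>x * y * z * u\<bar> = (\<bar>x\<bar> * \<bar>y\<bar>) * (\<bar>z\<bar> * \<bar>u\<bar>)" by (simp add: abs_mult)
    also have "\<dots> \<le> ((\<bar>x\<bar> * \<bar>y\<bar>)\<^sup>2 + (\<bar>z\<bar> * \<bar>u\<bar>)\<^sup>2) / 2" by (rule m)
    also have "\<dots> = (x\<^sup>2 * y\<^sup>2 + z\<^sup>2 * u\<^sup>2) / 2" by (simp add: power_mult_distrib)
    also have "\<dots> \<le> (((x\<^sup>2)\<^sup>2 + (y\<^sup>2)\<^sup>2) / 2 + ((z\<^sup>2)\<^sup>2 + (u\<^sup>2)\<^sup>2) / 2) / 2"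
      by (intro divide_right_mono add_mono m) auto
    also have "\<dots> = (x ^ 4 + y ^ 4 + z ^ 4 + u ^ 4) / 4" by (simp add: power_mult[symmetric] field_simps)
    also have "\<dots> \<le> x ^ 4 + y ^ 4 + z ^ 4 + u ^ 4"
      using zero_le_even_power[of 4 x] zero_le_even_power[of 4 y] zero_le_even_power[of 4 z] zero_le_even_power[of 4 u] by simp
    finally show ?thesis .
  qed
  then show "AE \<omega> in M. norm (X \<omega> * Y \<omega> * Z \<omega> * U \<omega>) \<le> norm (X \<omega> ^ 4 + Y \<omega> ^ 4 + Z \<omega> ^ 4 + U \<omega> ^ 4)"
    by (intro AE_I2) (auto intro!: order_trans[OF _ abs_ge_self])
qed

lemma integrable_mult:
  assumes V: "X \<in> V" "Y \<in> V"
  shows "integrable M (\<lambda>\<omega>. X \<omega> * Y \<omega>)"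
proof (rule Bochner_Integration.integrable_bound)
  show "integrable M (\<lambda>\<omega>. X \<omega> ^ 2 + Y \<omega> ^ 2)"
    using V by (intro Bochner_Integration.integrable_add integrable_power_V)
  show "(\<lambda>\<omega>. X \<omega> * Y \<omega>) \<in> borel_measurable M"
    using V measurable_V by (intro borel_measurable_times) auto
  have "\<bar>x * y\<bar> \<le> x\<^sup>2 + y\<^sup>2" for x y :: real
    using sum_squares_bound[of "\<bar>x\<bar>" "\<bar>y\<bar>"] mult_nonneg_nonneg[OF abs_ge_zero abs_ge_zero, of x y]
    unfolding abs_mult by (simp only: power2_abs)
  then show "AE \<omega> in M. norm (X \<omega> * Y \<omega>) \<le> norm (X \<omega> ^ 2 + Y \<omega> ^ 2)" by (intro AE_I2) auto
qed

lemma expectation_lincomb_mult: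
  assumes V: "X \<in> V" "Y \<in> V" "Z \<in> V"
  shows "expectation (\<lambda>\<omega>. (c * X \<omega> + d * Y \<omega>) * Z \<omega>) = c * expectation (\<lambda>\<omega>. X \<omega> * Z \<omega>) + d * expectation (\<lambda>\<omega>. Y \<omega> * Z \<omega>)"
proof -
  have "(\<lambda>\<omega>. (c * X \<omega> + d * Y \<omega>) * Z \<omega>) = (\<lambda>\<omega>. c * (X \<omega> * Z \<omega>) + d * (Y \<omega> * Z \<omega>))"
    by (simp add: algebra_simps)
  then show ?thesis using integrable_mult[OF V(1,3)] integrable_mult[OF V(2,3)] by simp
qed

lemma expectation_add_mult:
  "X \<in> V \<Longrightarrow> Y \<in> V \<Longrightarrow> Z \<in> V \<Longrightarrow> 
    expectation (\<lambda>\<omega>. (X \<omega> + Y \<omega>) * Z \<omega>) = expectation (\<lambda>\<omega>. X \<omega> * Z \<omega>) + expectation (\<lambda>\<omega>. Y \<omega> * Z \<omega>)"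
  using expectation_lincomb_mult[of X Y Z 1 1] by simp

lemma expectation_diff_mult:
  "X \<in> V \<Longrightarrow> Y \<in> V \<Longrightarrow> Z \<in> V \<Longrightarrow> 
    expectation (\<lambda>\<omega>. (X \<omega> - Y \<omega>) * Z \<omega>) = expectation (\<lambda>\<omega>. X \<omega> * Z \<omega>) - expectation (\<lambda>\<omega>. Y \<omega> * Z \<omega>)"
  using expectation_lincomb_mult[of X Y Z 1 "- 1"] by simp

lemma expectation_mult_add:
  "X \<in> V \<Longrightarrow> Y \<in> V \<Longrightarrow> Z \<in> V \<Longrightarrow> 
    expectation (\<lambda>\<omega>. Z \<omega> * (X \<omega> + Y \<omega>)) = expectation (\<lambda>\<omega>. Z \<omega> * X \<omega>) + expectation (\<lambda>\<omega>. Z \<omega> * Y \<omega>)"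
  using expectation_add_mult[of X Y Z] by (simp add: mult.commute)

lemma expectation_mult_diff:
  "X \<in> V \<Longrightarrow> Y \<in> V \<Longrightarrow> Z \<in> V \<Longrightarrow> 
    expectation (\<lambda>\<omega>. Z \<omega> * (X \<omega> - Y \<omega>)) = expectation (\<lambda>\<omega>. Z \<omega> * X \<omega>) - expectation (\<lambda>\<omega>. Z \<omega> * Y \<omega>)"
  using expectation_diff_mult[of X Y Z] by (simp add: mult.commute)

text \<open>Wick's formula is obtained from the fourth moments of linear combinations by polarizing twice.\<close>

lemma wick_squares:
  assumes V: "X \<in> V" "Y \<in> V"
  shows "expectation (\<lambda>\<omega>. X \<omega> * X \<omega> * Y \<omega> * Y \<omega>) =
    expectation (\<lambda>\<omega>. X \<omega> * X \<omega>) * expectation (\<lambda>\<omega>. Y \<omega> * Y \<omega>) + 2 * (expectation (\<lambda>\<omega>. X \<omega> * Y \<omega>))\<^sup>2"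
proof -
  let ?E = "\<lambda>A B. expectation (\<lambda>\<omega>. A \<omega> * B \<omega>)"
  have four: "expectation (\<lambda>\<omega>. Z \<omega> ^ 4) = 3 * (?E Z Z)\<^sup>2" if "Z \<in> V" for Z
    using fourth_moment_V[OF that] by (simp add: power2_eq_square)
  have sq: "?E (\<lambda>\<omega>. X \<omega> + Y \<omega>) (\<lambda>\<omega>. X \<omega> + Y \<omega>) = ?E X X + 2 * ?E X Y + ?E Y Y"
    "?E (\<lambda>\<omega>. X \<omega> - Y \<omega>) (\<lambda>\<omega>. X \<omega> - Y \<omega>) = ?E X X - 2 * ?E X Y + ?E Y Y"
    using V add_V[OF V] diff_V[OF V]
    by (simp_all add: expectation_add_mult expectation_mult_add expectation_diff_mult expectation_mult_diff mult.commute[of "Y _" "X _"])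
  \<comment> \<open>Adding the fourth powers of the sum and of the difference cancels the odd mixed
    terms and leaves 12 X^2 Y^2 as the only mixed one.\<close>
  have "expectation (\<lambda>\<omega>. (X \<omega> + Y \<omega>) ^ 4 + (X \<omega> - Y \<omega>) ^ 4)
     = expectation (\<lambda>\<omega>. 12 * (X \<omega> * X \<omega> * Y \<omega> * Y \<omega>) + (2 * X \<omega> ^ 4 + 2 * Y \<omega> ^ 4))"
    by (rule arg_cong[where f = expectation], rule ext) (simp add: eval_nat_numeral algebra_simps)
  also have "\<dots> = 12 * expectation (\<lambda>\<omega>. X \<omega> * X \<omega> * Y \<omega> * Y \<omega>) + (2 * expectation (\<lambda>\<omega>. X \<omega> ^ 4) + 2 * expectation (\<lambda>\<omega>. Y \<omega> ^ 4))"
    using integrable_mult4[OF V(1) V(1) V(2) V(2)] integrable_power_V[OF V(1), of 4] integrable_power_V[OF V(2), of 4] by simp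
  finally have "12 * expectation (\<lambda>\<omega>. X \<omega> * X \<omega> * Y \<omega> * Y \<omega>) = 3 * (?E X X + 2 * ?E X Y + ?E Y Y)\<^sup>2
    + 3 * (?E X X - 2 * ?E X Y + ?E Y Y)\<^sup>2 - 6 * (?E X X)\<^sup>2 - 6 * (?E Y Y)\<^sup>2"
    using integrable_power_V[OF add_V[OF V], of 4] integrable_power_V[OF diff_V[OF V], of 4]
      four[OF add_V[OF V]] four[OF diff_V[OF V]] four[OF V(1)] four[OF V(2)] by (simp add: sq)
  then show ?thesis by (simp add: power2_eq_square algebra_simps)
qed

lemma wick_square:
  assumes V: "X \<in> V" "Y \<in> V" "Z \<in> V"
  shows "expectation (\<lambda>\<omega>. X \<omega> * Z \<omega> * Y \<omega> * Y \<omega>) =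
    expectation (\<lambda>\<omega>. X \<omega> * Z \<omega>) * expectation (\<lambda>\<omega>. Y \<omega> * Y \<omega>) 
    + 2 * expectation (\<lambda>\<omega>. X \<omega> * Y \<omega>) * expectation (\<lambda>\<omega>. Z \<omega> * Y \<omega>)"
proof -
  let ?A = "\<lambda>\<omega>. X \<omega> + Z \<omega>" and ?B = "\<lambda>\<omega>. X \<omega> - Z \<omega>"
  let ?E = "\<lambda>A B. expectation (\<lambda>\<omega>. A \<omega> * B \<omega>)"
  have AB: "?A \<in> V" "?B \<in> V" using V by (auto intro: add_V diff_V)
  have sq: "?E ?A ?A = ?E X X + 2 * ?E X Z + ?E Z Z" "?E ?B ?B = ?E X X - 2 * ?E X Z + ?E Z Z"
    using V AB
    by (simp_all add: expectation_add_mult expectation_mult_add expectation_diff_mult expectation_mult_diff mult.commute[of "Z _" "X _"])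
  have c: "?E ?A Y = ?E X Y + ?E Z Y" "?E ?B Y = ?E X Y - ?E Z Y"
    using V by (simp_all add: expectation_add_mult expectation_diff_mult)
  have "4 * expectation (\<lambda>\<omega>. X \<omega> * Z \<omega> * Y \<omega> * Y \<omega>) = expectation (\<lambda>\<omega>. 4 * (X \<omega> * Z \<omega> * Y \<omega> * Y \<omega>))" by simp
  also have "\<dots> = expectation (\<lambda>\<omega>. ?A \<omega> * ?A \<omega> * Y \<omega> * Y \<omega> - ?B \<omega> * ?B \<omega> * Y \<omega> * Y \<omega>)"
    by (rule arg_cong[where f = expectation], rule ext) (simp add: algebra_simps)
  also have "\<dots> = expectation (\<lambda>\<omega>. ?A \<omega> * ?A \<omega> * Y \<omega> * Y \<omega>) - expectation (\<lambda>\<omega>. ?B \<omega> * ?B \<omega> * Y \<omega> * Y \<omega>)"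
    by (rule Bochner_Integration.integral_diff) (rule integrable_mult4[OF AB(1) AB(1) V(2) V(2)], rule integrable_mult4[OF AB(2) AB(2) V(2) V(2)])
  also have "\<dots> = 4 * (?E X Z * ?E Y Y + 2 * ?E X Y * ?E Z Y)"
    unfolding wick_squares[OF AB(1) V(2)] wick_squares[OF AB(2) V(2)] sq c
    by (simp add: power2_eq_square algebra_simps)
  finally show ?thesis by simp
qed

lemma wick:
  assumes V: "X \<in> V" "Y \<in> V" "Z \<in> V" "U \<in> V"
  shows "expectation (\<lambda>\<omega>. X \<omega> * Y \<omega> * Z \<omega> * U \<omega>) =
    expectation (\<lambda>\<omega>. X \<omega> * Y \<omega>) * expectation (\<lambda>\<omega>. Z \<omega> * U \<omega>) 
    + expectation (\<lambda>\<omega>. X \<omega> * Z \<omega>) * expectation (\<lambda>\<omega>. Y \<omega> * U \<omega>)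
    + expectation (\<lambda>\<omega>. X \<omega> * U \<omega>) * expectation (\<lambda>\<omega>. Y \<omega> * Z \<omega>)"
proof -
  let ?A = "\<lambda>\<omega>. Z \<omega> + U \<omega>" and ?B = "\<lambda>\<omega>. Z \<omega> - U \<omega>"
  let ?E = "\<lambda>A B. expectation (\<lambda>\<omega>. A \<omega> * B \<omega>)"
  have AB: "?A \<in> V" "?B \<in> V" using V by (auto intro: add_V diff_V)
  have sq: "?E ?A ?A = ?E Z Z + 2 * ?E Z U + ?E U U" "?E ?B ?B = ?E Z Z - 2 * ?E Z U + ?E U U"
    using V AB
    by (simp_all add: expectation_add_mult expectation_mult_add expectation_diff_mult expectation_mult_diff mult.commute[of "U _" "Z _"])
  have c: "?E T ?A = ?E T Z + ?E T U" "?E T ?B = ?E T Z - ?E T U" if "T \<in> V" for T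
    using V that by (simp_all add: expectation_mult_add expectation_mult_diff)
  have "4 * expectation (\<lambda>\<omega>. X \<omega> * Y \<omega> * Z \<omega> * U \<omega>) = expectation (\<lambda>\<omega>. 4 * (X \<omega> * Y \<omega> * Z \<omega> * U \<omega>))" by simp
  also have "\<dots> = expectation (\<lambda>\<omega>. X \<omega> * Y \<omega> * ?A \<omega> * ?A \<omega> - X \<omega> * Y \<omega> * ?B \<omega> * ?B \<omega>)"
    by (rule arg_cong[where f = expectation], rule ext) (simp add: algebra_simps)
  also have "\<dots> = expectation (\<lambda>\<omega>. X \<omega> * Y \<omega> * ?A \<omega> * ?A \<omega>) - expectation (\<lambda>\<omega>. X \<omega> * Y \<omega> * ?B \<omega> * ?B \<omega>)"
    by (rule Bochner_Integration.integral_diff) (rule integrable_mult4[OF V(1,2) AB(1) AB(1)], rule integrable_mult4[OF V(1,2) AB(2) AB(2)])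
  also have "\<dots> = 4 * (?E X Y * ?E Z U + ?E X Z * ?E Y U + ?E X U * ?E Y Z)"
    unfolding wick_square[OF V(1) AB(1) V(2)] wick_square[OF V(1) AB(2) V(2)] sq c[OF V(1)] c[OF V(2)]
    by (simp add: algebra_simps)
  finally show ?thesis by simp
qed

end

text \<open>For \<open>s \<le> t\<close> and \<open>u \<le> v\<close> this is the length of the intersection of the two intervals; written
  without case distinctions it is additive in both of them.\<close>

definition overlap :: "real \<Rightarrow> real \<Rightarrow> real \<Rightarrow> real \<Rightarrow> real" where
  "overlap s t u v = min t v - min t u - min s v + min s u"

lemma overlap_commute: "overlap s t u v = overlap u v s t"
  by (simp add: overlap_def min.commute)

lemma overlap_eq: "s \<le> t \<Longrightarrow> u \<le> v \<Longrightarrow> overlap s t u v = max 0 (min t v - max s u)"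
  by (auto simp: overlap_def min_def max_def)

lemma overlap_bounds: "s \<le> t \<Longrightarrow> u \<le> v \<Longrightarrow> 0 \<le> overlap s t u v \<and> overlap s t u v \<le> t - s"
  by (auto simp: overlap_def min_def)

lemma overlap_disjoint: "s \<le> t \<Longrightarrow> t \<le> u \<Longrightarrow> u \<le> v \<Longrightarrow> overlap s t u v = 0"
  by (auto simp: overlap_def min_def)

lemma overlap_self: "s \<le> t \<Longrightarrow> overlap s t s t = t - s"
  by (auto simp: overlap_def min_def)

lemma set_integral_indicator_overlap:
  assumes "s \<le> t" "u \<le> v"
  shows "(LINT x:{s<..t}|lebesgue. indicator {u<..v} x) = overlap s t u v"
proof -
  have "(LINT x:{s<..t}|lebesgue. indicator {u<..v} x) = (LINT x|lebesgue. indicator {max s u<..min t v} x :: real)"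
    unfolding set_lebesgue_integral_def by (intro Bochner_Integration.integral_cong) (auto simp: indicator_def)
  also have "\<dots> = measure lebesgue {max s u<..min t v}" by simp
  also have "\<dots> = overlap s t u v"
  proof (cases "max s u \<le> min t v")
    case True
    then show ?thesis using assms by (simp add: overlap_eq max_absorb2)
  next
    case False
    then have "{max s u<..min t v} = {}" using greaterThanAtMost_empty[of "min t v" "max s u"] by linarith
    moreover have "overlap s t u v = 0"
      using overlap_eq[of s t u v] max_absorb1[of "min t v - max s u" 0] assms False by linarith
    ultimately show ?thesis by (simp only: measure_empty)
  qed
  finally show ?thesis .
qed

lemma average_sf_indicator:
  assumes "s < t" "u \<le> v"
  shows "average_sf (indicator {u<..v}) s t \<omega> = overlap s t u v / (t - s)"
  using set_integral_indicator_overlap[of s t u v] assms by (simp add: average_sf_def)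

text \<open>Order 0 stands for the indicators and order \<open>m \<ge> 1\<close> for the symmetrization of the \<open>m\<close>-th sheet;
  in the picture \<open>L\<^sup>2[0,1] \<otimes> L\<^sup>2\<close> of the semicircular law, \<open>gen m i\<close> is the indicator of the \<open>i\<close>-th interval
  times the \<open>m\<close>-th Chebyshev polynomial of the second kind.\<close>

definition sheet_incr :: "(nat \<Rightarrow> real \<Rightarrow> real \<Rightarrow> 'w \<Rightarrow> real) \<Rightarrow> (nat \<Rightarrow> real) \<Rightarrow> (nat \<Rightarrow> real)
    \<Rightarrow> nat \<Rightarrow> nat \<Rightarrow> real \<Rightarrow> 'w \<Rightarrow> real" where
  "sheet_incr B a b m i x \<omega> = ((B m x (b i) \<omega> - B m x (a i) \<omega>) + (B m (b i) x \<omega> - B m (a i) x \<omega>)) / sqrt 2"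

definition gen :: "(nat \<Rightarrow> real \<Rightarrow> real \<Rightarrow> 'w \<Rightarrow> real) \<Rightarrow> (nat \<Rightarrow> real) \<Rightarrow> (nat \<Rightarrow> real)
    \<Rightarrow> nat \<Rightarrow> nat \<Rightarrow> 'w setfun" where
  "gen B a b m i = (if m = 0 then ind_sf a b i else d_over_sqrt_dx (sheet_incr B a b m i))"

locale sheets = prob_space M for M :: "'w measure" +
  fixes B :: "nat \<Rightarrow> real \<Rightarrow> real \<Rightarrow> 'w \<Rightarrow> real" and a b :: "nat \<Rightarrow> real"
  assumes sheet: "m \<ge> 1 \<Longrightarrow> brownian_sheet M (B m)"
    and indep: "independent_sheets M B"
    and enum: "bij_betw (\<lambda>i. (a i, b i)) UNIV {(p, r). p \<in> \<rat> \<and> r \<in> \<rat> \<and> 0 \<le> p \<and> p < r \<and> r \<le> 1}"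
begin

lemma endpoints: "0 \<le> a i" "a i < b i" "b i \<le> 1"
proof -
  have "(a i, b i) \<in> {(p, r). p \<in> \<rat> \<and> r \<in> \<rat> \<and> 0 \<le> p \<and> p < r \<and> r \<le> 1}"
    using bij_betwE[OF enum] by blast
  then show "0 \<le> a i" "a i < b i" "b i \<le> 1" by auto
qed

lemma endpoints_in: "a i \<in> {0..1}" "b i \<in> {0..1}"
  using endpoints[of i] by auto

abbreviation "square \<equiv> {0..1::real} \<times> {0..1::real}"

abbreviation "sheet_sp \<equiv> PiM square (\<lambda>_. borel :: real measure)"

definition sheet_fun :: "nat \<Rightarrow> 'w \<Rightarrow> real \<times> real \<Rightarrow> real" where
  "sheet_fun m \<omega> = (\<lambda>(x, y)\<in>square. B m x y \<omega>)"

lemma sheet_fun_indep: "indep_vars (\<lambda>_. sheet_sp) sheet_fun {1..}"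
  using indep unfolding independent_sheets_def sheet_fun_def[abs_def] by simp

section \<open>Covariances of sheet increments\<close>

definition sheet_lin :: "nat \<Rightarrow> ('w \<Rightarrow> real) set" where
  "sheet_lin m = {\<lambda>\<omega>. \<Sum>(x, y)\<in>I. c (x, y) * B m x y \<omega> | I c. finite I \<and> I \<subseteq> square}"

lemma gaussian_sheet_lin:
  assumes "m \<ge> 1"
  shows "gaussian_space M (sheet_lin m)"
proof unfold_locales
  have sh: "brownian_sheet M (B m)" by (rule sheet[OF assms])
  show "Z \<in> borel_measurable M" if Z: "Z \<in> sheet_lin m" for Z
  proof -
    obtain I c where I: "Z = (\<lambda>\<omega>. \<Sum>(x, y)\<in>I. c (x, y) * B m x y \<omega>)" "finite I" "I \<subseteq> square"
      using Z by (auto simp: sheet_lin_def)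
    then show ?thesis using sh unfolding I(1) brownian_sheet_def
      by (intro borel_measurable_sum) (auto intro!: borel_measurable_times)
  qed
  show "\<exists>\<sigma>\<ge>0. distr M borel Z = centered_gaussian \<sigma>" if "Z \<in> sheet_lin m" for Z
    using that sh unfolding sheet_lin_def brownian_sheet_def by blast
  show "(\<lambda>\<omega>. c * X \<omega> + d * Y \<omega>) \<in> sheet_lin m" if XY: "X \<in> sheet_lin m" "Y \<in> sheet_lin m" for X Y c d
  proof -
    obtain I e where I: "X = (\<lambda>\<omega>. \<Sum>(x, y)\<in>I. e (x, y) * B m x y \<omega>)" "finite I" "I \<subseteq> square"
      using XY(1) by (auto simp: sheet_lin_def)
    obtain J f where J: "Y = (\<lambda>\<omega>. \<Sum>(x, y)\<in>J. f (x, y) * B m x y \<omega>)" "finite J" "J \<subseteq> square"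
      using XY(2) by (auto simp: sheet_lin_def)
    let ?g = "\<lambda>p. c * (if p \<in> I then e p else 0) + d * (if p \<in> J then f p else 0)"
    let ?B = "\<lambda>\<omega> p. B m (fst p) (snd p) \<omega>"
    have "c * X \<omega> + d * Y \<omega> = (\<Sum>(x, y)\<in>I \<union> J. ?g (x, y) * B m x y \<omega>)" for \<omega>
    proof -
      have "(\<Sum>p\<in>I. e p * ?B \<omega> p) = (\<Sum>p\<in>I \<union> J. (if p \<in> I then e p else 0) * ?B \<omega> p)"
        using I(2) J(2) by (intro sum.mono_neutral_cong_left) auto
      moreover have "(\<Sum>p\<in>J. f p * ?B \<omega> p) = (\<Sum>p\<in>I \<union> J. (if p \<in> J then f p else 0) * ?B \<omega> p)"
        using I(2) J(2) by (intro sum.mono_neutral_cong_left) auto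
      ultimately show ?thesis
        unfolding I(1) J(1) case_prod_beta' prod.collapse
        by (simp only: sum_distrib_left sum.distrib[symmetric] distrib_right mult.assoc)
    qed
    then have "(\<lambda>\<omega>. c * X \<omega> + d * Y \<omega>) = (\<lambda>\<omega>. \<Sum>(x, y)\<in>I \<union> J. ?g (x, y) * B m x y \<omega>)" by blast
    moreover have "(\<lambda>\<omega>. \<Sum>(x, y)\<in>I \<union> J. ?g (x, y) * B m x y \<omega>) \<in> sheet_lin m"
      unfolding sheet_lin_def mem_Collect_eq using I J by (intro exI[of _ "I \<union> J"] exI[of _ ?g]) blast
    ultimately show ?thesis by simp
  qed
qed

lemma sheet_in_lin: "x \<in> {0..1} \<Longrightarrow> y \<in> {0..1} \<Longrightarrow> B m x y \<in> sheet_lin m"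
  unfolding sheet_lin_def mem_Collect_eq by (intro exI[of _ "{(x, y)}"] exI[of _ "\<lambda>_. 1"]) auto

lemma sheet_incr_in_lin:
  assumes "m \<ge> 1" "x \<in> {0..1}"
  shows "sheet_incr B a b m i x \<in> sheet_lin m"
proof -
  interpret gaussian_space M "sheet_lin m" by (rule gaussian_sheet_lin) fact
  have "(\<lambda>\<omega>. 1 / sqrt 2 * (B m x (b i) \<omega> - B m x (a i) \<omega>) + 1 / sqrt 2 * (B m (b i) x \<omega> - B m (a i) x \<omega>)) \<in> sheet_lin m"
    by (intro lincomb diff_V sheet_in_lin endpoints_in assms)
  moreover have "sheet_incr B a b m i x = 
     (\<lambda>\<omega>. 1 / sqrt 2 * (B m x (b i) \<omega> - B m x (a i) \<omega>) + 1 / sqrt 2 * (B m (b i) x \<omega> - B m (a i) x \<omega>))"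
    by (simp add: sheet_incr_def fun_eq_iff add_divide_distrib)
  ultimately show ?thesis by simp
qed

definition incr :: "nat \<Rightarrow> nat \<Rightarrow> real \<Rightarrow> real \<Rightarrow> 'w \<Rightarrow> real" where
  "incr m i s t \<omega> = sheet_incr B a b m i t \<omega> - sheet_incr B a b m i s \<omega>"

lemma incr_in_lin:
  assumes "m \<ge> 1" "s \<in> {0..1}" "t \<in> {0..1}"
  shows "incr m i s t \<in> sheet_lin m"
proof -
  interpret gaussian_space M "sheet_lin m" by (rule gaussian_sheet_lin) fact
  show ?thesis unfolding incr_def[abs_def] using assms by (intro diff_V sheet_incr_in_lin)
qed

text \<open>Symmetrization produces four products. The two in which the sheets have equal
  orientation both give the first term, the two with opposite orientation both give the second, and
  the factor 1/2 from the two square roots compensates the doubling.\<close>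

lemma cov_sheet_incr:
  assumes "m \<ge> 1" "x \<in> {0..1}" "y \<in> {0..1}"
  shows "expectation (\<lambda>\<omega>. sheet_incr B a b m i x \<omega> * sheet_incr B a b m j y \<omega>) =
    min x y * overlap (a i) (b i) (a j) (b j) 
    + (min x (b j) - min x (a j)) * (min y (b i) - min y (a i))"
proof -
  interpret gaussian_space M "sheet_lin m" by (rule gaussian_sheet_lin) fact
  have E: "expectation (\<lambda>\<omega>. B m x1 y1 \<omega> * B m x2 y2 \<omega>) = min x1 x2 * min y1 y2"
    if "x1 \<in> {0..1}" "y1 \<in> {0..1}" "x2 \<in> {0..1}" "y2 \<in> {0..1}" for x1 y1 x2 y2
    using sheet[OF assms(1)] that unfolding brownian_sheet_def by blast
  let ?R = "\<lambda>i x \<omega>. (B m x (b i) \<omega> - B m x (a i) \<omega>) + (B m (b i) x \<omega> - B m (a i) x \<omega>)"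
  have V: "B m x (b i) \<in> sheet_lin m" "B m x (a i) \<in> sheet_lin m" "B m (b i) x \<in> sheet_lin m" "B m (a i) x \<in> sheet_lin m"
    if "x \<in> {0..1}" for x i using that endpoints_in by (auto intro: sheet_in_lin)
  have D: "(\<lambda>\<omega>. B m x (b i) \<omega> - B m x (a i) \<omega>) \<in> sheet_lin m" "(\<lambda>\<omega>. B m (b i) x \<omega> - B m (a i) x \<omega>) \<in> sheet_lin m"
    if "x \<in> {0..1}" for x i using V[OF that] by (auto intro: diff_V)
  have R: "?R i x \<in> sheet_lin m" if "x \<in> {0..1}" for x i using D[OF that] by (auto intro: add_V)
  have "expectation (\<lambda>\<omega>. ?R i x \<omega> * ?R j y \<omega>) = 2 * (min x y * overlap (a i) (b i) (a j) (b j) 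
    + (min x (b j) - min x (a j)) * (min y (b i) - min y (a i)))"
  proof -
    have l: "expectation (\<lambda>\<omega>. ?R i x \<omega> * Z \<omega>) = expectation (\<lambda>\<omega>. B m x (b i) \<omega> * Z \<omega>) - expectation (\<lambda>\<omega>. B m x (a i) \<omega> * Z \<omega>)
      + (expectation (\<lambda>\<omega>. B m (b i) x \<omega> * Z \<omega>) - expectation (\<lambda>\<omega>. B m (a i) x \<omega> * Z \<omega>))" if "Z \<in> sheet_lin m" for Z
      using V[OF assms(2), of i] D[OF assms(2), of i] that by (simp add: expectation_add_mult expectation_diff_mult)
    have r: "expectation (\<lambda>\<omega>. Z \<omega> * ?R j y \<omega>) = expectation (\<lambda>\<omega>. Z \<omega> * B m y (b j) \<omega>) - expectation (\<lambda>\<omega>. Z \<omega> * B m y (a j) \<omega>)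
      + (expectation (\<lambda>\<omega>. Z \<omega> * B m (b j) y \<omega>) - expectation (\<lambda>\<omega>. Z \<omega> * B m (a j) y \<omega>))" if "Z \<in> sheet_lin m" for Z
      using V[OF assms(3), of j] D[OF assms(3), of j] that by (simp add: expectation_mult_add expectation_mult_diff)
    show ?thesis
      unfolding l[OF R[OF assms(3)]] r[OF V(1)[OF assms(2)]] r[OF V(2)[OF assms(2)]] r[OF V(3)[OF assms(2)]] r[OF V(4)[OF assms(2)]]
      using assms(2,3) endpoints_in[of i] endpoints_in[of j]
      by (simp only: E) (simp only: overlap_def min.commute[of "b i" y] min.commute[of "a i" y], simp add: algebra_simps)
  qed
  moreover have "(\<lambda>\<omega>. sheet_incr B a b m i x \<omega> * sheet_incr B a b m j y \<omega>) = (\<lambda>\<omega>. (?R i x \<omega> * ?R j y \<omega>) / 2)"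
    by (simp add: sheet_incr_def fun_eq_iff)
  ultimately show ?thesis by simp
qed

lemma cov_incr_same:
  assumes "m \<ge> 1" "s \<in> {0..1}" "t \<in> {0..1}" "u \<in> {0..1}" "v \<in> {0..1}"
  shows "expectation (\<lambda>\<omega>. incr m i s t \<omega> * incr m j u v \<omega>) =
    overlap s t u v * overlap (a i) (b i) (a j) (b j) + overlap s t (a j) (b j) * overlap u v (a i) (b i)"
proof -
  interpret gaussian_space M "sheet_lin m" by (rule gaussian_sheet_lin) fact
  have "expectation (\<lambda>\<omega>. incr m i s t \<omega> * incr m j u v \<omega>) = 
    (expectation (\<lambda>\<omega>. sheet_incr B a b m i t \<omega> * sheet_incr B a b m j v \<omega>) - 
     expectation (\<lambda>\<omega>. sheet_incr B a b m i t \<omega> * sheet_incr B a b m j u \<omega>)) - 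
    (expectation (\<lambda>\<omega>. sheet_incr B a b m i s \<omega> * sheet_incr B a b m j v \<omega>) - 
     expectation (\<lambda>\<omega>. sheet_incr B a b m i s \<omega> * sheet_incr B a b m j u \<omega>))"
    using assms unfolding incr_def
    by (simp add: expectation_diff_mult expectation_mult_diff sheet_incr_in_lin diff_V)
  also have "\<dots> = overlap s t u v * overlap (a i) (b i) (a j) (b j) + overlap s t (a j) (b j) * overlap u v (a i) (b i)"
    unfolding cov_sheet_incr[OF assms(1,3,5)] cov_sheet_incr[OF assms(1,3,4)] cov_sheet_incr[OF assms(1,2,5)] cov_sheet_incr[OF assms(1,2,4)]
    by (simp add: overlap_def algebra_simps)
  finally show ?thesis .
qed

text \<open>Independence is formulated for whole sheets as elements of a product space. To apply it,
  a variable has to be exhibited as a measurable function of its sheet.\<close>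

lemma sheet_lin_factor:
  assumes "Z \<in> sheet_lin m"
  obtains f where "f \<in> borel_measurable sheet_sp" "\<And>\<omega>. Z \<omega> = f (sheet_fun m \<omega>)"
proof -
  obtain I c where I: "Z = (\<lambda>\<omega>. \<Sum>(x, y)\<in>I. c (x, y) * B m x y \<omega>)" "finite I" "I \<subseteq> square"
    using assms by (auto simp: sheet_lin_def)
  show ?thesis
  proof
    show "(\<lambda>g. \<Sum>p\<in>I. c p * g p) \<in> borel_measurable sheet_sp"
      using I(3) by (intro borel_measurable_sum borel_measurable_times measurable_component_singleton) auto
    show "Z \<omega> = (\<Sum>p\<in>I. c p * sheet_fun m \<omega> p)" for \<omega>
      unfolding I(1) using I(3) by (intro sum.cong) (auto simp: sheet_fun_def)
  qed
qed

lemma indep_sheets_expectation: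
  fixes f g :: "(real \<times> real \<Rightarrow> real) \<Rightarrow> real"
  assumes "m \<ge> 1" "n \<ge> 1" "m \<noteq> n" and f: "f \<in> borel_measurable sheet_sp" and g: "g \<in> borel_measurable sheet_sp"
    and int: "integrable M (\<lambda>\<omega>. f (sheet_fun m \<omega>))" "integrable M (\<lambda>\<omega>. g (sheet_fun n \<omega>))"
  shows "expectation (\<lambda>\<omega>. f (sheet_fun m \<omega>) * g (sheet_fun n \<omega>)) 
      = expectation (\<lambda>\<omega>. f (sheet_fun m \<omega>)) * expectation (\<lambda>\<omega>. g (sheet_fun n \<omega>))"
    and "integrable M (\<lambda>\<omega>. f (sheet_fun m \<omega>) * g (sheet_fun n \<omega>))"
proof -
  let ?h = "\<lambda>k. if k = m then f else g"
  have "indep_vars (\<lambda>_. borel) (\<lambda>k \<omega>. ?h k (sheet_fun k \<omega>)) {m, n}"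
    using f g assms(1,2) by (intro indep_vars_compose2[OF indep_vars_subset[OF sheet_fun_indep]]) auto
  then have "expectation (\<lambda>\<omega>. \<Prod>k\<in>{m, n}. ?h k (sheet_fun k \<omega>)) = (\<Prod>k\<in>{m, n}. expectation (\<lambda>\<omega>. ?h k (sheet_fun k \<omega>)))"
    "integrable M (\<lambda>\<omega>. \<Prod>k\<in>{m, n}. ?h k (sheet_fun k \<omega>))"
    using int by (intro indep_vars_lebesgue_integral indep_vars_integrable; auto)+
  then show "expectation (\<lambda>\<omega>. f (sheet_fun m \<omega>) * g (sheet_fun n \<omega>)) 
      = expectation (\<lambda>\<omega>. f (sheet_fun m \<omega>)) * expectation (\<lambda>\<omega>. g (sheet_fun n \<omega>))"
    and "integrable M (\<lambda>\<omega>. f (sheet_fun m \<omega>) * g (sheet_fun n \<omega>))"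
    using assms(3) by auto
qed

definition cov :: "nat \<Rightarrow> nat \<Rightarrow> real \<Rightarrow> real \<Rightarrow> nat \<Rightarrow> nat \<Rightarrow> real \<Rightarrow> real \<Rightarrow> real" where
  "cov m i s t n j u v = (if m = n then overlap s t u v * overlap (a i) (b i) (a j) (b j)
     + overlap s t (a j) (b j) * overlap u v (a i) (b i) else 0)"

lemma cov_incr:
  assumes mn: "m \<ge> 1" "n \<ge> 1" and I: "s \<in> {0..1}" "t \<in> {0..1}" "u \<in> {0..1}" "v \<in> {0..1}"
  shows "expectation (\<lambda>\<omega>. incr m i s t \<omega> * incr n j u v \<omega>) = cov m i s t n j u v"
    and "integrable M (\<lambda>\<omega>. incr m i s t \<omega> * incr n j u v \<omega>)"
proof -
  interpret m: gaussian_space M "sheet_lin m" by (rule gaussian_sheet_lin) fact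
  interpret n: gaussian_space M "sheet_lin n" by (rule gaussian_sheet_lin) fact
  have V: "incr m i s t \<in> sheet_lin m" "incr n j u v \<in> sheet_lin n" using mn I by (auto intro: incr_in_lin)
  have "expectation (\<lambda>\<omega>. incr m i s t \<omega> * incr n j u v \<omega>) = cov m i s t n j u v \<and>
     integrable M (\<lambda>\<omega>. incr m i s t \<omega> * incr n j u v \<omega>)"
  proof (cases "m = n")
    case True
    then show ?thesis using cov_incr_same[OF mn(1) I] m.integrable_mult V by (simp add: cov_def)
  next
    case False
    obtain f where f: "f \<in> borel_measurable sheet_sp" "\<And>\<omega>. incr m i s t \<omega> = f (sheet_fun m \<omega>)"
      using sheet_lin_factor[OF V(1)] by blast
    obtain g where g: "g \<in> borel_measurable sheet_sp" "\<And>\<omega>. incr n j u v \<omega> = g (sheet_fun n \<omega>)"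
      using sheet_lin_factor[OF V(2)] by blast
    have int: "integrable M (\<lambda>\<omega>. f (sheet_fun m \<omega>))" "integrable M (\<lambda>\<omega>. g (sheet_fun n \<omega>))"
      "expectation (\<lambda>\<omega>. f (sheet_fun m \<omega>)) = 0"
      using m.integrable_V[OF V(1)] n.integrable_V[OF V(2)] m.mean_V[OF V(1)]
      unfolding f(2)[abs_def, symmetric] g(2)[abs_def, symmetric] by auto
    show ?thesis
      using indep_sheets_expectation[OF mn False f(1) g(1) int(1,2)] int(3) False
      by (simp add: f(2) g(2) cov_def)
  qed
  then show "expectation (\<lambda>\<omega>. incr m i s t \<omega> * incr n j u v \<omega>) = cov m i s t n j u v"
    and "integrable M (\<lambda>\<omega>. incr m i s t \<omega> * incr n j u v \<omega>)" by auto
qed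

text \<open>For equal orders this is Wick's formula. For different orders the expectation factors by
  independence, and the result is again Wick's formula because the mixed covariances are 0; one
  expression thus covers both cases.\<close>

lemma expectation_incr4:
  assumes mn: "m \<ge> 1" "n \<ge> 1" and I: "s \<in> {0..1}" "t \<in> {0..1}" "u \<in> {0..1}" "v \<in> {0..1}"
  shows "expectation (\<lambda>\<omega>. (incr m i s t \<omega> * incr n j s t \<omega>) * (incr m i u v \<omega> * incr n j u v \<omega>)) =
      cov m i s t n j s t * cov m i u v n j u v + cov m i s t m i u v * cov n j s t n j u v 
      + cov m i s t n j u v * cov n j s t m i u v"
    and "integrable M (\<lambda>\<omega>. (incr m i s t \<omega> * incr n j s t \<omega>) * (incr m i u v \<omega> * incr n j u v \<omega>))"
proof -
  interpret m: gaussian_space M "sheet_lin m" by (rule gaussian_sheet_lin) fact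
  interpret n: gaussian_space M "sheet_lin n" by (rule gaussian_sheet_lin) fact
  have V: "incr m i s t \<in> sheet_lin m" "incr n j s t \<in> sheet_lin n" "incr m i u v \<in> sheet_lin m" "incr n j u v \<in> sheet_lin n" 
    using mn I by (auto intro: incr_in_lin)
  have "expectation (\<lambda>\<omega>. (incr m i s t \<omega> * incr n j s t \<omega>) * (incr m i u v \<omega> * incr n j u v \<omega>)) =
      cov m i s t n j s t * cov m i u v n j u v + cov m i s t m i u v * cov n j s t n j u v 
      + cov m i s t n j u v * cov n j s t m i u v
    \<and> integrable M (\<lambda>\<omega>. (incr m i s t \<omega> * incr n j s t \<omega>) * (incr m i u v \<omega> * incr n j u v \<omega>))"
  proof (cases "m = n")
    case True
    have V': "incr n j s t \<in> sheet_lin m" "incr n j u v \<in> sheet_lin m" using V True by auto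
    show ?thesis using m.wick[OF V(1) V'(1) V(3) V'(2)] m.integrable_mult4[OF V(1) V'(1) V(3) V'(2)] mn I
      by (simp add: cov_incr mult.assoc)
  next
    case False
    obtain f where f: "f \<in> borel_measurable sheet_sp" "\<And>\<omega>. incr m i s t \<omega> = f (sheet_fun m \<omega>)"
      using sheet_lin_factor[OF V(1)] by blast
    obtain f' where f': "f' \<in> borel_measurable sheet_sp" "\<And>\<omega>. incr m i u v \<omega> = f' (sheet_fun m \<omega>)"
      using sheet_lin_factor[OF V(3)] by blast
    obtain g where g: "g \<in> borel_measurable sheet_sp" "\<And>\<omega>. incr n j s t \<omega> = g (sheet_fun n \<omega>)"
      using sheet_lin_factor[OF V(2)] by blast
    obtain g' where g': "g' \<in> borel_measurable sheet_sp" "\<And>\<omega>. incr n j u v \<omega> = g' (sheet_fun n \<omega>)"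
      using sheet_lin_factor[OF V(4)] by blast
    have mm: "(\<lambda>x. f x * f' x) \<in> borel_measurable sheet_sp" "(\<lambda>x. g x * g' x) \<in> borel_measurable sheet_sp"
      using f g f' g' by auto
    have int: "integrable M (\<lambda>\<omega>. f (sheet_fun m \<omega>) * f' (sheet_fun m \<omega>))"
      "integrable M (\<lambda>\<omega>. g (sheet_fun n \<omega>) * g' (sheet_fun n \<omega>))"
      "expectation (\<lambda>\<omega>. f (sheet_fun m \<omega>) * f' (sheet_fun m \<omega>)) = cov m i s t m i u v"
      "expectation (\<lambda>\<omega>. g (sheet_fun n \<omega>) * g' (sheet_fun n \<omega>)) = cov n j s t n j u v"
      using cov_incr[OF mn(1) mn(1) I, of i i] cov_incr[OF mn(2) mn(2) I, of j j] by (simp_all add: f f' g g')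
    have e: "(\<lambda>\<omega>. (incr m i s t \<omega> * incr n j s t \<omega>) * (incr m i u v \<omega> * incr n j u v \<omega>))
      = (\<lambda>\<omega>. (f (sheet_fun m \<omega>) * f' (sheet_fun m \<omega>)) * (g (sheet_fun n \<omega>) * g' (sheet_fun n \<omega>)))"
      by (simp add: f f' g g' algebra_simps)
    have z: "cov m i s t n j s t = 0" "cov m i s t n j u v = 0" using False by (simp_all add: cov_def)
    show ?thesis
      using indep_sheets_expectation[OF mn False mm int(1,2)] int(3,4) unfolding e z by simp
  qed
  then show "expectation (\<lambda>\<omega>. (incr m i s t \<omega> * incr n j s t \<omega>) * (incr m i u v \<omega> * incr n j u v \<omega>)) =
      cov m i s t n j s t * cov m i u v n j u v + cov m i s t m i u v * cov n j s t n j u v 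
      + cov m i s t n j u v * cov n j s t m i u v"
    and "integrable M (\<lambda>\<omega>. (incr m i s t \<omega> * incr n j s t \<omega>) * (incr m i u v \<omega> * incr n j u v \<omega>))" by auto
qed

end

section \<open>Inner products of the generators\<close>

lemma (in prob_space) has_inner_sum_left:
  assumes "finite A" "\<And>p. p \<in> A \<Longrightarrow> has_inner M (F p) G (\<lambda>_. r p)" "random_setfun M G"
  shows "has_inner M (\<lambda>s t \<omega>. \<Sum>p\<in>A. c p * F p s t \<omega>) G (\<lambda>_. \<Sum>p\<in>A. c p * r p)"
  using assms(1,2)
proof (induction A)
  case empty
  then show ?case using assms(3) by (simp add: has_inner_def random_setfun_def partition_sum_def)
next
  case (insert p A)
  have "has_inner M (sf_lincomb (c p) (F p) 1 (\<lambda>s t \<omega>. \<Sum>p\<in>A. c p * F p s t \<omega>)) G (\<lambda>_. c p * r p + 1 * (\<Sum>p\<in>A. c p * r p))"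
    using insert by (intro has_inner_lincomb_left) auto
  then show ?case using insert(1,2) by (simp add: sf_lincomb_def)
qed

lemma (in prob_space) has_inner_sum_right:
  assumes "finite A" "\<And>p. p \<in> A \<Longrightarrow> has_inner M G (F p) (\<lambda>_. r p)" "random_setfun M G"
  shows "has_inner M G (\<lambda>s t \<omega>. \<Sum>p\<in>A. c p * F p s t \<omega>) (\<lambda>_. \<Sum>p\<in>A. c p * r p)"
  using has_inner_sum_left[of A F G r c] assms by (auto intro: has_inner_commute)

section \<open>Averages of square integrable functions and sums of lengths over a partition\<close>

lemma square_integrable_imp_set_integrable:
  fixes g :: "real \<Rightarrow> real"
  assumes g: "g \<in> borel_measurable lebesgue" "integrable lebesgue (\<lambda>x. (g x)\<^sup>2)"
  shows "set_integrable lebesgue {s<..t} g" "set_integrable lebesgue {s<..t} (\<lambda>x. (g x)\<^sup>2)"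
proof -
  show 2: "set_integrable lebesgue {s<..t} (\<lambda>x. (g x)\<^sup>2)"
    unfolding set_integrable_def using g(2) by (intro integrable_mult_indicator) auto
  have one: "integrable lebesgue (\<lambda>x. indicator {s<..t} x :: real)"
    by (cases "s \<le> t") (auto intro!: integrable_real_indicator)
  show "set_integrable lebesgue {s<..t} g"
    unfolding set_integrable_def
  proof (rule Bochner_Integration.integrable_bound)
    show "integrable lebesgue (\<lambda>x. indicator {s<..t} x + indicator {s<..t} x *\<^sub>R (g x)\<^sup>2)"
      using one 2 unfolding set_integrable_def by (rule Bochner_Integration.integrable_add)
    show "(\<lambda>x. indicator {s<..t} x *\<^sub>R g x) \<in> borel_measurable lebesgue"
      using g(1) by (intro borel_measurable_scaleR borel_measurable_indicator) auto
    have "\<bar>y\<bar> \<le> 1 + y\<^sup>2" for y :: real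
      using sum_squares_bound[of 1 "\<bar>y\<bar>"] abs_ge_zero[of y] by simp
    then show "AE x in lebesgue. norm (indicator {s<..t} x *\<^sub>R g x) \<le> norm (indicator {s<..t} x + indicator {s<..t} x *\<^sub>R (g x)\<^sup>2)"
      by (intro AE_I2) (auto simp: indicator_def)
  qed
qed

text \<open>The variance of g on the interval, the integral of (g - \<mu>)^2 with the mean \<mu>, is
  nonnegative.\<close>

lemma interval_Cauchy_Schwarz:
  fixes g :: "real \<Rightarrow> real"
  assumes g: "g \<in> borel_measurable lebesgue" "integrable lebesgue (\<lambda>x. (g x)\<^sup>2)" and st: "s < t"
  shows "(LINT x:{s<..t}|lebesgue. g x)\<^sup>2 / (t - s) \<le> (LINT x:{s<..t}|lebesgue. (g x)\<^sup>2)"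
proof -
  let ?I = "LINT x:{s<..t}|lebesgue. g x"
  define \<mu> where "\<mu> = ?I / (t - s)"
  note int = square_integrable_imp_set_integrable[OF g, of s t]
  have one: "set_integrable lebesgue {s<..t} (\<lambda>x. \<mu>\<^sup>2)" unfolding set_integrable_def
    using st by auto
  have mu: "(LINT x:{s<..t}|lebesgue. \<mu>\<^sup>2) = \<mu>\<^sup>2 * (t - s)"
    unfolding set_lebesgue_integral_def using st by simp
  have "0 \<le> (LINT x:{s<..t}|lebesgue. (g x - \<mu>)\<^sup>2)"
    unfolding set_lebesgue_integral_def by (intro integral_nonneg_AE) auto
  also have "\<dots> = (LINT x:{s<..t}|lebesgue. ((g x)\<^sup>2 - 2 * \<mu> * g x) + \<mu>\<^sup>2)"
    by (simp add: power2_diff algebra_simps)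
  also have "\<dots> = (LINT x:{s<..t}|lebesgue. (g x)\<^sup>2) - 2 * \<mu> * ?I + (LINT x:{s<..t}|lebesgue. \<mu>\<^sup>2)"
    using int one by (simp add: set_integral_add set_integral_diff)
  also have "\<dots> = (LINT x:{s<..t}|lebesgue. (g x)\<^sup>2) - ?I\<^sup>2 / (t - s)"
  proof -
    have "?I\<^sup>2 / (t - s) = \<mu> * ?I" "\<mu>\<^sup>2 * (t - s) = \<mu> * ?I" using st by (simp_all add: \<mu>_def power2_eq_square)
    then show ?thesis unfolding mu by linarith
  qed
  finally show ?thesis by simp
qed

text \<open>Averaging over the cells of a partition is a contraction of L^2; the left side is the
  partition sum of \<open>average_sf g\<close> with itself. The local integrals are written as
  differences of integrals from 0 and telescope.\<close>

lemma sum_average_squares_le: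
  fixes g :: "real \<Rightarrow> real"
  assumes g: "g \<in> borel_measurable lebesgue" "integrable lebesgue (\<lambda>x. (g x)\<^sup>2)" and ts: "is_partition ts"
  shows "(\<Sum>j<length ts - 1. (LINT x:{ts ! j<..ts ! Suc j}|lebesgue. g x)\<^sup>2 / (ts ! Suc j - ts ! j))
     \<le> (LINT x|lebesgue. (g x)\<^sup>2)"
proof -
  note int = square_integrable_imp_set_integrable(2)[OF g]
  have "(\<Sum>j<length ts - 1. (LINT x:{ts ! j<..ts ! Suc j}|lebesgue. g x)\<^sup>2 / (ts ! Suc j - ts ! j))
    \<le> (\<Sum>j<length ts - 1. (LINT x:{0<..ts ! Suc j}|lebesgue. (g x)\<^sup>2) - (LINT x:{0<..ts ! j}|lebesgue. (g x)\<^sup>2))"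
  proof (intro sum_mono)
    fix j assume "j \<in> {..<length ts - 1}"
    then have j: "0 \<le> ts ! j" "ts ! j < ts ! Suc j" using partition_interval[OF ts] by auto
    have e: "{0<..ts ! j} \<union> {ts ! j<..ts ! Suc j} = {0<..ts ! Suc j}" using j by auto
    have "(LINT x:{0<..ts ! Suc j}|lebesgue. (g x)\<^sup>2) = (LINT x:{0<..ts ! j}|lebesgue. (g x)\<^sup>2) + (LINT x:{ts ! j<..ts ! Suc j}|lebesgue. (g x)\<^sup>2)"
      unfolding e[symmetric] by (rule set_integral_Un) (auto intro: int)
    then show "(LINT x:{ts ! j<..ts ! Suc j}|lebesgue. g x)\<^sup>2 / (ts ! Suc j - ts ! j) \<le> 
      (LINT x:{0<..ts ! Suc j}|lebesgue. (g x)\<^sup>2) - (LINT x:{0<..ts ! j}|lebesgue. (g x)\<^sup>2)"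
      using interval_Cauchy_Schwarz[OF g j(2)] by simp
  qed
  also have "\<dots> = (LINT x:{0<..1}|lebesgue. (g x)\<^sup>2)"
    using sum_lessThan_telescope[of "\<lambda>j. LINT x:{0<..ts ! j}|lebesgue. (g x)\<^sup>2" "length ts - 1"] is_partitionD[OF ts]
    by (simp add: set_lebesgue_integral_def)
  also have "\<dots> \<le> (LINT x|lebesgue. (g x)\<^sup>2)"
    unfolding set_lebesgue_integral_def
    using int[of 0 1] g(2) by (intro integral_mono) (auto simp: set_integrable_def indicator_def)
  finally show ?thesis .
qed

lemma partition_overlap:
  assumes "is_partition ts" "k < length ts - 1" "l < length ts - 1"
  shows "overlap (ts ! k) (ts ! Suc k) (ts ! l) (ts ! Suc l) = (if k = l then ts ! Suc k - ts ! k else 0)"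
proof (cases k l rule: linorder_cases)
  case less
  then have "ts ! Suc k \<le> ts ! l" using assms by (intro partition_mono) auto
  then show ?thesis using less assms by (simp add: overlap_disjoint partition_interval less_imp_le)
next
  case equal
  then show ?thesis using assms by (simp add: overlap_self partition_interval less_imp_le)
next
  case greater
  then have "ts ! Suc l \<le> ts ! k" using assms by (intro partition_mono) auto
  then show ?thesis using greater assms 
    by (subst overlap_commute) (simp add: overlap_disjoint partition_interval less_imp_le)
qed

text \<open>The off-diagonal part of the bound comes from the symmetrization of the sheets.\<close>

definition cov_bound :: "real list \<Rightarrow> nat \<Rightarrow> nat \<Rightarrow> real" where
  "cov_bound ts k l = (if k = l then ts ! Suc k - ts ! k else 0) + (ts ! Suc k - ts ! k) * (ts ! Suc l - ts ! l)"

lemma partition_length_le_1: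
  assumes "is_partition ts" "k < length ts - 1"
  shows "ts ! Suc k - ts ! k \<le> 1"
  using partition_interval[OF assms] by linarith

lemma cov_bound_nonneg:
  assumes "is_partition ts" "k < length ts - 1" "l < length ts - 1"
  shows "0 \<le> cov_bound ts k l"
  using assms unfolding cov_bound_def by (simp add: partition_interval less_imp_le)

lemma cov_bound_le_mesh:
  assumes "is_partition ts" "k < length ts - 1" "l < length ts - 1"
  shows "cov_bound ts k l \<le> 2 * mesh ts"
proof -
  have "(ts ! Suc k - ts ! k) * (ts ! Suc l - ts ! l) \<le> mesh ts * 1"
    using assms mesh_bounds[OF assms(1)]
    by (intro mult_mono partition_le_mesh partition_length_le_1) (auto simp: partition_interval less_imp_le)
  then show ?thesis using partition_le_mesh[OF assms(1,2)] mesh_bounds[OF assms(1)]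
    unfolding cov_bound_def by (cases "k = l") simp_all
qed

text \<open>The diagonal part contributes the total length 1, the product part the square of the
  total length.\<close>

lemma sum_cov_bound:
  assumes "is_partition ts"
  shows "(\<Sum>k<length ts - 1. \<Sum>l<length ts - 1. cov_bound ts k l) = 2"
proof -
  have "(\<Sum>k<length ts - 1. \<Sum>l<length ts - 1. cov_bound ts k l) =
    (\<Sum>k<length ts - 1. ts ! Suc k - ts ! k) + (\<Sum>k<length ts - 1. ts ! Suc k - ts ! k) * (\<Sum>l<length ts - 1. ts ! Suc l - ts ! l)"
    unfolding cov_bound_def by (simp only: sum.distrib sum_product) simp
  then show ?thesis using partition_sum_lengths[OF assms] by simp
qed

text \<open>The largest entry, at most twice the mesh, times the total mass 2. Variances of the
  quadratic variations are of order mesh for this reason.\<close>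

lemma sum_cov_bound_square:
  assumes "is_partition ts"
  shows "(\<Sum>k<length ts - 1. \<Sum>l<length ts - 1. (cov_bound ts k l)\<^sup>2) \<le> 4 * mesh ts"
proof -
  have "(\<Sum>k<length ts - 1. \<Sum>l<length ts - 1. (cov_bound ts k l)\<^sup>2) \<le>
    (\<Sum>k<length ts - 1. \<Sum>l<length ts - 1. 2 * mesh ts * cov_bound ts k l)"
    unfolding power2_eq_square using cov_bound_le_mesh[OF assms] cov_bound_nonneg[OF assms]
    by (intro sum_mono mult_right_mono) auto
  also have "\<dots> = 4 * mesh ts" by (simp only: sum_distrib_left[symmetric] sum_cov_bound[OF assms])
  finally show ?thesis .
qed

lemma sum_lengths_square_le:
  assumes "is_partition ts"
  shows "(\<Sum>k<length ts - 1. (ts ! Suc k - ts ! k)\<^sup>2) \<le> mesh ts"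
proof -
  have "(\<Sum>k<length ts - 1. (ts ! Suc k - ts ! k)\<^sup>2) \<le> (\<Sum>k<length ts - 1. mesh ts * (ts ! Suc k - ts ! k))"
    unfolding power2_eq_square using assms
    by (intro sum_mono mult_right_mono partition_le_mesh) (auto simp: partition_interval less_imp_le)
  also have "\<dots> = mesh ts" by (simp only: sum_distrib_left[symmetric] partition_sum_lengths[OF assms] mult_1_right)
  finally show ?thesis .
qed

text \<open>At most one interval of the partition contains e in its interior. It bounds the error
  made by cells that an endpoint of a given interval cuts.\<close>

lemma sum_lengths_around_point_le:
  assumes ts: "is_partition ts"
  shows "(\<Sum>k<length ts - 1. if ts ! k < e \<and> e < ts ! Suc k then ts ! Suc k - ts ! k else 0) \<le> mesh ts"
proof (cases "\<exists>k<length ts - 1. ts ! k < e \<and> e < ts ! Suc k")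
  case False
  then have "(\<Sum>k<length ts - 1. if ts ! k < e \<and> e < ts ! Suc k then ts ! Suc k - ts ! k else 0) = 0"
    by (intro sum.neutral) auto
  then show ?thesis using mesh_bounds[OF ts] by simp
next
  case True
  then obtain k where k: "k < length ts - 1" "ts ! k < e" "e < ts ! Suc k" by blast
  have uniq: "l = k" if l: "l < length ts - 1" "ts ! l < e" "e < ts ! Suc l" for l
  proof (rule ccontr)
    assume "l \<noteq> k"
    then consider "Suc l \<le> k" | "Suc k \<le> l" by linarith
    moreover have "k < length ts" "l < length ts" using k l by auto
    ultimately show False using partition_mono[OF ts, of "Suc l" k] partition_mono[OF ts, of "Suc k" l] k l by cases auto
  qed
  have "(\<Sum>l<length ts - 1. if ts ! l < e \<and> e < ts ! Suc l then ts ! Suc l - ts ! l else 0)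
    = (\<Sum>l<length ts - 1. if l = k then ts ! Suc k - ts ! k else 0)"
  proof (rule sum.cong[OF refl])
    fix l assume l: "l \<in> {..<length ts - 1}"
    have "(ts ! l < e \<and> e < ts ! Suc l) = (l = k)" using uniq l k by blast
    then show "(if ts ! l < e \<and> e < ts ! Suc l then ts ! Suc l - ts ! l else 0) = (if l = k then ts ! Suc k - ts ! k else 0)"
      by simp
  qed
  also have "\<dots> \<le> mesh ts" using k partition_le_mesh[OF ts k(1)] by simp
  finally show ?thesis .
qed

text \<open>Away from the endpoints of the two intervals both averages are 0 or 1 on each interval of the partition.\<close>

lemma sum_overlap_products:
  assumes ts: "is_partition ts" and uv: "0 \<le> u" "u \<le> v" "v \<le> 1" and pq: "0 \<le> p" "p \<le> q" "q \<le> 1"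
  shows "\<bar>(\<Sum>k<length ts - 1. overlap (ts ! k) (ts ! Suc k) u v * overlap (ts ! k) (ts ! Suc k) p q / (ts ! Suc k - ts ! k))
    - overlap u v p q\<bar> \<le> 4 * mesh ts"
proof -
  define lo where "lo = max u p"
  \<comment> \<open>The maximum with \<open>lo\<close> makes the intersection an empty interval at
    \<open>lo\<close>, and not a reversed one, when the two intervals are disjoint.\<close>
  define up where "up = max lo (min v q)"
  let ?D = "\<lambda>k. ts ! Suc k - ts ! k"
  let ?p = "\<lambda>k. overlap (ts ! k) (ts ! Suc k) u v * overlap (ts ! k) (ts ! Suc k) p q / ?D k"
  let ?t = "\<lambda>k. overlap (ts ! k) (ts ! Suc k) lo up"
  let ?i = "\<lambda>e k. if ts ! k < e \<and> e < ts ! Suc k then ?D k else 0"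
  have lu: "0 \<le> lo" "lo \<le> up" "up \<le> 1" using uv pq by (auto simp: lo_def up_def)
  have tel: "(\<Sum>k<length ts - 1. ?t k) = overlap u v p q"
  proof -
    have "(\<Sum>k<length ts - 1. ?t k) = (\<Sum>k<length ts - 1. (min (ts ! Suc k) up - min (ts ! Suc k) lo) - (min (ts ! k) up - min (ts ! k) lo))"
      by (intro sum.cong) (auto simp: overlap_def)
    also have "\<dots> = (min 1 up - min 1 lo) - (min 0 up - min 0 lo)"
      using sum_lessThan_telescope[of "\<lambda>k. min (ts ! k) up - min (ts ! k) lo" "length ts - 1"] is_partitionD[OF ts] by simp
    also have "\<dots> = up - lo" using lu by simp
    also have "\<dots> = overlap u v p q" using uv pq by (auto simp: overlap_eq up_def lo_def max_def min_def)
    finally show ?thesis .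
  qed
  have err: "\<bar>?p k - ?t k\<bar> \<le> ?i u k + ?i v k + ?i p k + ?i q k" if k: "k < length ts - 1" for k
  proof -
    let ?s = "ts ! k" and ?e = "ts ! Suc k"
    have d: "?s < ?e" using partition_interval[OF ts k] by simp
    show ?thesis
    proof (cases "(?s < u \<and> u < ?e) \<or> (?s < v \<and> v < ?e) \<or> (?s < p \<and> p < ?e) \<or> (?s < q \<and> q < ?e)")
      case True
      have "0 \<le> ?p k" "?p k \<le> ?D k" "0 \<le> ?t k" "?t k \<le> ?D k"
      proof -
        have o: "0 \<le> overlap ?s ?e u v" "overlap ?s ?e u v \<le> ?e - ?s" "0 \<le> overlap ?s ?e p q" "overlap ?s ?e p q \<le> ?e - ?s"
          using overlap_bounds[of ?s ?e] d uv pq by auto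
        then show "0 \<le> ?p k" using d by simp
        have "overlap ?s ?e u v * overlap ?s ?e p q \<le> (?e - ?s) * (?e - ?s)" using o by (intro mult_mono) auto
        then show "?p k \<le> ?D k" using d by (simp add: divide_le_eq)
        show "0 \<le> ?t k" "?t k \<le> ?D k" using overlap_bounds[of ?s ?e lo up] d lu by auto
      qed
      then have "\<bar>?p k - ?t k\<bar> \<le> ?D k" by linarith
      also have "\<dots> \<le> ?i u k + ?i v k + ?i p k + ?i q k" using True d by auto
      finally show ?thesis .
    next
      case False
      have cases: "overlap ?s ?e x y = (if x \<le> ?s \<and> ?e \<le> y then ?e - ?s else 0)"
        if "x \<le> y" "\<not> (?s < x \<and> x < ?e)" "\<not> (?s < y \<and> y < ?e)" for x y
        using that d by (auto simp: overlap_def min_def)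
      have "\<not> (?s < lo \<and> lo < ?e)" "\<not> (?s < up \<and> up < ?e)"
        using False by (auto simp: lo_def up_def max_def min_def)
      from cases[OF lu(2) this] cases[of u v] cases[of p q] False uv pq d
      have "?p k = ?t k" by (auto simp: lo_def up_def)
      then show ?thesis using d by auto
    qed
  qed
  have "(\<Sum>k<length ts - 1. ?p k) - overlap u v p q = (\<Sum>k<length ts - 1. ?p k - ?t k)"
    unfolding sum_subtractf tel ..
  then have "\<bar>(\<Sum>k<length ts - 1. ?p k) - overlap u v p q\<bar> = \<bar>\<Sum>k<length ts - 1. ?p k - ?t k\<bar>"
    by (rule arg_cong)
  also have "\<dots> \<le> (\<Sum>k<length ts - 1. ?i u k + ?i v k + ?i p k + ?i q k)"
    by (intro order_trans[OF sum_abs] sum_mono err) simp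
  also have "\<dots> = sum (?i u) {..<length ts - 1} + sum (?i v) {..<length ts - 1} + sum (?i p) {..<length ts - 1} + sum (?i q) {..<length ts - 1}"
    by (simp only: sum.distrib)
  also have "\<dots> \<le> mesh ts + mesh ts + mesh ts + mesh ts"
    by (intro add_mono sum_lengths_around_point_le ts)
  also have "\<dots> = 4 * mesh ts" by simp
  finally show ?thesis .
qed

lemma integral_double_sum:
  fixes f :: "'i \<Rightarrow> 'j \<Rightarrow> 'a \<Rightarrow> real"
  assumes "\<And>k l. k \<in> A \<Longrightarrow> l \<in> C \<Longrightarrow> integrable M (f k l)"
  shows "integrable M (\<lambda>\<omega>. \<Sum>k\<in>A. \<Sum>l\<in>C. f k l \<omega>)"
    and "(LINT \<omega>|M. (\<Sum>k\<in>A. \<Sum>l\<in>C. f k l \<omega>)) = (\<Sum>k\<in>A. \<Sum>l\<in>C. LINT \<omega>|M. f k l \<omega>)"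
proof -
  show "integrable M (\<lambda>\<omega>. \<Sum>k\<in>A. \<Sum>l\<in>C. f k l \<omega>)"
    using assms by (intro Bochner_Integration.integrable_sum)
  have "(LINT \<omega>|M. (\<Sum>k\<in>A. \<Sum>l\<in>C. f k l \<omega>)) = (\<Sum>k\<in>A. LINT \<omega>|M. (\<Sum>l\<in>C. f k l \<omega>))"
    using assms by (intro Bochner_Integration.integral_sum Bochner_Integration.integrable_sum)
  also have "\<dots> = (\<Sum>k\<in>A. \<Sum>l\<in>C. LINT \<omega>|M. f k l \<omega>)"
    using assms by (intro sum.cong refl Bochner_Integration.integral_sum)
  finally show "(LINT \<omega>|M. (\<Sum>k\<in>A. \<Sum>l\<in>C. f k l \<omega>)) = (\<Sum>k\<in>A. \<Sum>l\<in>C. LINT \<omega>|M. f k l \<omega>)" .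
qed

section \<open>Gram matrix of the generators\<close>

context sheets
begin

abbreviation "gn \<equiv> gen B a b"

definition ov :: "nat \<Rightarrow> nat \<Rightarrow> real" where
  "ov i j = overlap (a i) (b i) (a j) (b j)"

lemma ov_bounds: "0 \<le> ov i j" "ov i j \<le> 1"
  using overlap_bounds[of "a i" "b i" "a j" "b j"] endpoints[of i] endpoints[of j] unfolding ov_def by linarith+

lemma gen_pos: "m \<ge> 1 \<Longrightarrow> gn m i s t \<omega> = incr m i s t \<omega> / sqrt (t - s)"
  by (simp add: gen_def d_over_sqrt_dx_def incr_def)

lemma gen_0: "s < t \<Longrightarrow> gn 0 i s t \<omega> = overlap s t (a i) (b i) / (t - s)"
  using endpoints[of i] by (simp add: gen_def ind_sf_def average_sf_indicator)

lemma incr_measurable: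
  assumes "m \<ge> 1" "s \<in> {0..1}" "t \<in> {0..1}"
  shows "incr m i s t \<in> borel_measurable M"
proof -
  interpret gaussian_space M "sheet_lin m" by (rule gaussian_sheet_lin) fact
  show ?thesis by (rule measurable_V[OF incr_in_lin[OF assms]])
qed

lemma random_gen: "random_setfun M (gn m i)"
proof (cases "m = 0")
  case True
  then show ?thesis by (simp add: random_setfun_def gen_0 cong: measurable_cong)
next
  case False
  then have "gn m i s t = (\<lambda>\<omega>. incr m i s t \<omega> / sqrt (t - s))" for s t by (simp add: gen_pos fun_eq_iff)
  then show ?thesis using incr_measurable[of m] False
    by (auto simp: random_setfun_def intro!: borel_measurable_divide)
qed

lemma cov_partition_bound:
  assumes ts: "is_partition ts" and k: "k < length ts - 1" and l: "l < length ts - 1"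
  shows "\<bar>cov m i (ts ! k) (ts ! Suc k) n j (ts ! l) (ts ! Suc l)\<bar> \<le> cov_bound ts k l"
proof (cases "m = n")
  case False
  then show ?thesis using cov_bound_nonneg[OF ts k l] by (simp add: cov_def)
next
  case True
  have I: "ts ! k \<le> ts ! Suc k" "ts ! l \<le> ts ! Suc l" using partition_interval[OF ts] k l by (auto simp: less_imp_le)
  have o: "0 \<le> overlap (ts ! k) (ts ! Suc k) (a j) (b j)" "overlap (ts ! k) (ts ! Suc k) (a j) (b j) \<le> ts ! Suc k - ts ! k"
    "0 \<le> overlap (ts ! l) (ts ! Suc l) (a i) (b i)" "overlap (ts ! l) (ts ! Suc l) (a i) (b i) \<le> ts ! Suc l - ts ! l"
    using overlap_bounds[OF I(1), of "a j" "b j"] overlap_bounds[OF I(2), of "a i" "b i"] endpoints[of i] endpoints[of j] by auto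
  define D where "D = (if k = l then ts ! Suc k - ts ! k else 0)"
  have "D * ov i j \<le> D" "0 \<le> D * ov i j"
    unfolding D_def using I ov_bounds[of i j] mult_left_mono[of "ov i j" 1 "ts ! Suc k - ts ! k"] by auto
  moreover have "overlap (ts ! k) (ts ! Suc k) (a j) (b j) * overlap (ts ! l) (ts ! Suc l) (a i) (b i)
    \<le> (ts ! Suc k - ts ! k) * (ts ! Suc l - ts ! l)" using o by (intro mult_mono) auto
  moreover have "0 \<le> overlap (ts ! k) (ts ! Suc k) (a j) (b j) * overlap (ts ! l) (ts ! Suc l) (a i) (b i)"
    using o by simp
  ultimately show ?thesis using True
    unfolding cov_def cov_bound_def partition_overlap[OF ts k l] ov_def[symmetric] D_def[symmetric]
    by (simp only: simp_thms if_True)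
qed

lemma partition_point:
  assumes "is_partition ts" "k < length ts - 1"
  shows "ts ! k \<in> {0..1}" "ts ! Suc k \<in> {0..1}"
  using partition_interval[OF assms] by auto

text \<open>The mean square deviation splits into a squared bias and the two crossed Wick pairings.
  The bias comes from symmetrization and is at most the sum of the squared lengths, hence at most
  the mesh; each pairing sums to at most 4 times the mesh. This gives the constant 9 = 1 +
  8.\<close>

lemma has_inner_gen_pos:
  assumes mn: "m \<ge> 1" "n \<ge> 1" and r: "r = (if m = n then ov i j else 0)"
  shows "has_inner M (gn m i) (gn n j) (\<lambda>_. r)"
proof (rule has_inner_of_mesh_bound[OF random_gen random_gen])
  fix ts assume ts: "is_partition ts"
  let ?N = "length ts - 1"
  let ?I = "\<lambda>m i k. incr m i (ts ! k) (ts ! Suc k)"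
  let ?D = "\<lambda>k \<omega>. ?I m i k \<omega> * ?I n j k \<omega>"
  let ?c = "\<lambda>m i k n j l. cov m i (ts ! k) (ts ! Suc k) n j (ts ! l) (ts ! Suc l)"
  have P: "partition_sum (gn m i) (gn n j) ts \<omega> = (\<Sum>k<?N. ?D k \<omega>)" for \<omega>
    unfolding partition_sum_def
  proof (intro sum.cong refl)
    fix k assume "k \<in> {..<?N}"
    then have "ts ! Suc k - ts ! k > 0" using partition_interval[OF ts] by auto
    then have "sqrt (ts ! Suc k - ts ! k) * sqrt (ts ! Suc k - ts ! k) = ts ! Suc k - ts ! k" "ts ! Suc k - ts ! k \<noteq> 0" by auto
    then show "gn m i (ts ! k) (ts ! Suc k) \<omega> * gn n j (ts ! k) (ts ! Suc k) \<omega> * (ts ! Suc k - ts ! k) = ?D k \<omega>"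
      using mn by (simp add: gen_pos)
  qed
  have E1: "expectation (?D k) = ?c m i k n j k" "integrable M (?D k)" if "k < ?N" for k
    using cov_incr[OF mn] partition_point[OF ts that] by auto
  have E2: "expectation (\<lambda>\<omega>. ?D k \<omega> * ?D l \<omega>) = ?c m i k n j k * ?c m i l n j l + ?c m i k m i l * ?c n j k n j l + ?c m i k n j l * ?c n j k m i l"
    "integrable M (\<lambda>\<omega>. ?D k \<omega> * ?D l \<omega>)" if "k < ?N" "l < ?N" for k l
    using expectation_incr4[OF mn] partition_point[OF ts that(1)] partition_point[OF ts that(2)] by auto
  have sq: "(partition_sum (gn m i) (gn n j) ts \<omega> - r)\<^sup>2 = (\<Sum>k<?N. \<Sum>l<?N. ?D k \<omega> * ?D l \<omega>) - 2 * r * (\<Sum>k<?N. ?D k \<omega>) + r\<^sup>2" for \<omega>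
    unfolding P power2_diff power2_eq_square[of "sum _ _"] sum_product by (simp add: algebra_simps)
  have int: "integrable M (\<lambda>\<omega>. (\<Sum>k<?N. \<Sum>l<?N. ?D k \<omega> * ?D l \<omega>))" "integrable M (\<lambda>\<omega>. 2 * r * (\<Sum>k<?N. ?D k \<omega>))"
    using E1 E2 by (intro Bochner_Integration.integrable_sum integrable_mult_right; simp)+
  show "integrable M (\<lambda>\<omega>. (partition_sum (gn m i) (gn n j) ts \<omega> - r)\<^sup>2)"
    unfolding sq using int by (intro Bochner_Integration.integrable_add Bochner_Integration.integrable_diff) auto
  have "expectation (\<lambda>\<omega>. (partition_sum (gn m i) (gn n j) ts \<omega> - r)\<^sup>2) =
    (\<Sum>k<?N. \<Sum>l<?N. ?c m i k n j k * ?c m i l n j l + ?c m i k m i l * ?c n j k n j l + ?c m i k n j l * ?c n j k m i l)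
     - 2 * r * (\<Sum>k<?N. ?c m i k n j k) + r\<^sup>2"
  proof -
    have "expectation (\<lambda>\<omega>. (\<Sum>k<?N. \<Sum>l<?N. ?D k \<omega> * ?D l \<omega>)) = (\<Sum>k<?N. \<Sum>l<?N. expectation (\<lambda>\<omega>. ?D k \<omega> * ?D l \<omega>))"
      using E2(2) by (intro integral_double_sum) auto
    moreover have "expectation (\<lambda>\<omega>. 2 * r * (\<Sum>k<?N. ?D k \<omega>)) = 2 * r * (\<Sum>k<?N. expectation (?D k))"
      using E1(2) by (simp add: Bochner_Integration.integral_sum)
    moreover have "(\<Sum>k<?N. \<Sum>l<?N. expectation (\<lambda>\<omega>. ?D k \<omega> * ?D l \<omega>)) =
      (\<Sum>k<?N. \<Sum>l<?N. ?c m i k n j k * ?c m i l n j l + ?c m i k m i l * ?c n j k n j l + ?c m i k n j l * ?c n j k m i l)"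
      by (intro sum.cong refl E2(1)) auto
    moreover have "(\<Sum>k<?N. expectation (?D k)) = (\<Sum>k<?N. ?c m i k n j k)"
      by (intro sum.cong refl E1(1)) auto
    moreover have "expectation (\<lambda>\<omega>. (\<Sum>k<?N. \<Sum>l<?N. ?D k \<omega> * ?D l \<omega>) - 2 * r * (\<Sum>k<?N. ?D k \<omega>) + r\<^sup>2) =
      expectation (\<lambda>\<omega>. (\<Sum>k<?N. \<Sum>l<?N. ?D k \<omega> * ?D l \<omega>)) - expectation (\<lambda>\<omega>. 2 * r * (\<Sum>k<?N. ?D k \<omega>)) + r\<^sup>2"
    proof -
      have "expectation (\<lambda>\<omega>. (X \<omega> - Y \<omega>) + r\<^sup>2) = expectation X - expectation Y + r\<^sup>2"
        if "integrable M X" "integrable M Y" for X Y using that by (simp add: prob_space)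
      from this[OF int] show ?thesis .
    qed
    ultimately show ?thesis unfolding sq by (simp only:)
  qed
  \<comment> \<open>The Wick pairing of k with k and l with l is a product of two means; summed over
    k and l it combines with the remaining terms to the squared bias.\<close>
  also have "\<dots> = ((\<Sum>k<?N. ?c m i k n j k) - r)\<^sup>2 + (\<Sum>k<?N. \<Sum>l<?N. ?c m i k m i l * ?c n j k n j l + ?c m i k n j l * ?c n j k m i l)"
    by (simp add: power2_diff power2_eq_square[of "sum _ _"] sum_product sum.distrib algebra_simps)
  also have "\<dots> \<le> mesh ts + 8 * mesh ts"
  proof (rule add_mono)
    have "0 \<le> (\<Sum>k<?N. ?c m i k n j k) - r \<and> (\<Sum>k<?N. ?c m i k n j k) - r \<le> mesh ts"
    proof (cases "m = n")
      case False
      then show ?thesis using mesh_bounds[OF ts] by (simp add: cov_def r)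
    next
      case True
      let ?p = "\<lambda>k. overlap (ts ! k) (ts ! Suc k) (a j) (b j) * overlap (ts ! k) (ts ! Suc k) (a i) (b i)"
      have p: "0 \<le> ?p k" "?p k \<le> (ts ! Suc k - ts ! k)\<^sup>2" if "k < ?N" for k
      proof -
        have "0 \<le> overlap (ts ! k) (ts ! Suc k) (a j) (b j)" "overlap (ts ! k) (ts ! Suc k) (a j) (b j) \<le> ts ! Suc k - ts ! k" for j
          using overlap_bounds[of "ts ! k" "ts ! Suc k" "a j" "b j"] partition_interval[OF ts that] endpoints[of j] by auto
        then show "0 \<le> ?p k" "?p k \<le> (ts ! Suc k - ts ! k)\<^sup>2" unfolding power2_eq_square
          by (auto intro!: mult_mono mult_nonneg_nonneg less_imp_le[OF partition_interval(2)[OF ts that]])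
      qed
      have "(\<Sum>k<?N. ?c m i k n j k) = (\<Sum>k<?N. (ts ! Suc k - ts ! k) * ov i j + ?p k)"
        using True by (intro sum.cong) (auto simp: cov_def partition_overlap[OF ts] ov_def)
      also have "\<dots> = ov i j + (\<Sum>k<?N. ?p k)"
        by (simp only: sum.distrib sum_distrib_right[symmetric] partition_sum_lengths[OF ts])
      finally show ?thesis unfolding r using True p sum_nonneg[of "{..<?N}" ?p] 
          order_trans[OF sum_mono[of "{..<?N}" ?p "\<lambda>k. (ts ! Suc k - ts ! k)\<^sup>2"] sum_lengths_square_le[OF ts]]
        by auto
    qed
    then have "((\<Sum>k<?N. ?c m i k n j k) - r)\<^sup>2 \<le> (mesh ts)\<^sup>2" by (intro power_mono) auto
    also have "\<dots> \<le> mesh ts" using mesh_bounds[OF ts] by (simp add: power2_eq_square mult_left_le_one_le)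
    finally show "((\<Sum>k<?N. ?c m i k n j k) - r)\<^sup>2 \<le> mesh ts" .
    have "(\<Sum>k<?N. \<Sum>l<?N. ?c m i k m i l * ?c n j k n j l + ?c m i k n j l * ?c n j k m i l) \<le>
      (\<Sum>k<?N. \<Sum>l<?N. (cov_bound ts k l)\<^sup>2 + (cov_bound ts k l)\<^sup>2)"
    proof (intro sum_mono add_mono)
      fix k l assume "k \<in> {..<?N}" "l \<in> {..<?N}"
      then have k: "k < ?N" and l: "l < ?N" by auto
      have pr: "x * y \<le> e\<^sup>2" if "\<bar>x\<bar> \<le> e" "\<bar>y\<bar> \<le> e" for x y e :: real
        using mult_mono[OF that] that abs_ge_self[of "x * y"] by (simp add: abs_mult power2_eq_square)
      show "?c m i k m i l * ?c n j k n j l \<le> (cov_bound ts k l)\<^sup>2" "?c m i k n j l * ?c n j k m i l \<le> (cov_bound ts k l)\<^sup>2"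
        by (intro pr cov_partition_bound[OF ts k l])+
    qed
    also have "\<dots> \<le> 8 * mesh ts" using sum_cov_bound_square[OF ts] unfolding sum.distrib by linarith
    finally show "(\<Sum>k<?N. \<Sum>l<?N. ?c m i k m i l * ?c n j k n j l + ?c m i k n j l * ?c n j k m i l) \<le> 8 * mesh ts" .
  qed
  finally show "expectation (\<lambda>\<omega>. (partition_sum (gn m i) (gn n j) ts \<omega> - r)\<^sup>2) \<le> 9 * mesh ts" by simp
qed

text \<open>The partition sum is a linear combination of centered increments with weights at most
  sqrt(mesh), so its second moment is at most the mesh times the total mass of
  \<open>cov_bound\<close>.\<close>

lemma has_inner_gen_mixed:
  assumes m: "m \<ge> 1"
  shows "has_inner M (gn 0 i) (gn m j) (\<lambda>_. 0)"
proof (rule has_inner_of_mesh_bound[OF random_gen random_gen])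
  fix ts assume ts: "is_partition ts"
  let ?N = "length ts - 1"
  let ?I = "\<lambda>k. incr m j (ts ! k) (ts ! Suc k)"
  let ?w = "\<lambda>k. overlap (ts ! k) (ts ! Suc k) (a i) (b i) / sqrt (ts ! Suc k - ts ! k)"
  let ?c = "\<lambda>k l. cov m j (ts ! k) (ts ! Suc k) m j (ts ! l) (ts ! Suc l)"
  have P: "partition_sum (gn 0 i) (gn m j) ts \<omega> = (\<Sum>k<?N. ?w k * ?I k \<omega>)" for \<omega>
    unfolding partition_sum_def
    using m partition_interval[OF ts] by (intro sum.cong) (auto simp: gen_pos gen_0)
  have E: "expectation (\<lambda>\<omega>. ?I k \<omega> * ?I l \<omega>) = ?c k l" "integrable M (\<lambda>\<omega>. ?I k \<omega> * ?I l \<omega>)" if "k < ?N" "l < ?N" for k l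
    using cov_incr[OF m m] partition_point[OF ts that(1)] partition_point[OF ts that(2)] by auto
  have sq: "(partition_sum (gn 0 i) (gn m j) ts \<omega> - 0)\<^sup>2 = (\<Sum>k<?N. \<Sum>l<?N. (?w k * ?w l) * (?I k \<omega> * ?I l \<omega>))" for \<omega>
    unfolding P power2_eq_square diff_zero sum_product by (simp add: mult_ac)
  show "integrable M (\<lambda>\<omega>. (partition_sum (gn 0 i) (gn m j) ts \<omega> - 0)\<^sup>2)"
    unfolding sq using E(2) by (intro Bochner_Integration.integrable_sum integrable_mult_right) auto
  have "expectation (\<lambda>\<omega>. (partition_sum (gn 0 i) (gn m j) ts \<omega> - 0)\<^sup>2) = (\<Sum>k<?N. \<Sum>l<?N. (?w k * ?w l) * ?c k l)"
    unfolding sq using E by (subst integral_double_sum) (auto intro!: sum.cong)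
  also have "\<dots> \<le> (\<Sum>k<?N. \<Sum>l<?N. mesh ts * cov_bound ts k l)"
  proof (intro sum_mono)
    fix k l assume "k \<in> {..<?N}" "l \<in> {..<?N}"
    then have k: "k < ?N" and l: "l < ?N" by auto
    have w: "0 \<le> ?w k \<and> ?w k \<le> sqrt (mesh ts)" if k: "k < ?N" for k
    proof -
      let ?d = "ts ! Suc k - ts ! k"
      have d: "?d > 0" using partition_interval[OF ts k] by simp
      have o: "0 \<le> overlap (ts ! k) (ts ! Suc k) (a i) (b i)" "overlap (ts ! k) (ts ! Suc k) (a i) (b i) \<le> ?d"
        using overlap_bounds[of "ts ! k" "ts ! Suc k" "a i" "b i"] d endpoints[of i] by auto
      then have "?w k \<le> ?d / sqrt ?d" using d by (intro divide_right_mono) auto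
      also have "\<dots> = sqrt ?d" using d by (simp add: real_div_sqrt)
      also have "\<dots> \<le> sqrt (mesh ts)" using partition_le_mesh[OF ts k] by simp
      finally show ?thesis using o d by simp
    qed
    have "?w k * ?w l \<le> sqrt (mesh ts) * sqrt (mesh ts)" using w[OF k] w[OF l] mesh_bounds[OF ts] by (intro mult_mono) auto
    then have ww: "?w k * ?w l \<le> mesh ts" using mesh_bounds[OF ts] by simp
    have "(?w k * ?w l) * ?c k l \<le> (?w k * ?w l) * cov_bound ts k l"
      using cov_partition_bound[OF ts k l, of m j m j] w[OF k] w[OF l] by (intro mult_left_mono mult_nonneg_nonneg) auto
    also have "\<dots> \<le> mesh ts * cov_bound ts k l" by (intro mult_right_mono ww cov_bound_nonneg[OF ts k l])
    finally show "(?w k * ?w l) * ?c k l \<le> mesh ts * cov_bound ts k l" .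
  qed
  also have "\<dots> = 2 * mesh ts" by (simp only: sum_distrib_left[symmetric] sum_cov_bound[OF ts] mult.commute)
  finally show "expectation (\<lambda>\<omega>. (partition_sum (gn 0 i) (gn m j) ts \<omega> - 0)\<^sup>2) \<le> 2 * mesh ts" .
qed

lemma has_inner_gen_0: "has_inner M (gn 0 i) (gn 0 j) (\<lambda>_. ov i j)"
proof (rule has_inner_of_mesh_bound[OF random_gen random_gen])
  fix ts assume ts: "is_partition ts"
  have P: "partition_sum (gn 0 i) (gn 0 j) ts \<omega> = (\<Sum>k<length ts - 1. 
      overlap (ts ! k) (ts ! Suc k) (a i) (b i) * overlap (ts ! k) (ts ! Suc k) (a j) (b j) / (ts ! Suc k - ts ! k))" for \<omega>
    unfolding partition_sum_def
    using partition_interval[OF ts] by (intro sum.cong) (auto simp: gen_0)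
  show "integrable M (\<lambda>\<omega>. (partition_sum (gn 0 i) (gn 0 j) ts \<omega> - ov i j)\<^sup>2)" unfolding P by simp
  let ?S = "(\<Sum>k<length ts - 1. 
      overlap (ts ! k) (ts ! Suc k) (a i) (b i) * overlap (ts ! k) (ts ! Suc k) (a j) (b j) / (ts ! Suc k - ts ! k)) - ov i j"
  have "\<bar>?S\<bar> \<le> 4 * mesh ts"
    unfolding ov_def using endpoints[of i] endpoints[of j] by (intro sum_overlap_products ts) auto
  then have "?S\<^sup>2 \<le> (4 * mesh ts)\<^sup>2" using mesh_bounds[OF ts] by (intro power2_le_iff_abs_le[THEN iffD2]) auto
  also have "\<dots> \<le> 16 * mesh ts" using mesh_bounds[OF ts] by (simp add: power2_eq_square mult_left_le_one_le)
  finally show "expectation (\<lambda>\<omega>. (partition_sum (gn 0 i) (gn 0 j) ts \<omega> - ov i j)\<^sup>2) \<le> 16 * mesh ts"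
    unfolding P by (simp add: prob_space)
qed

lemma has_inner_gen: "has_inner M (gn m i) (gn n j) (\<lambda>_. if m = n then ov i j else 0)"
proof -
  consider "m = 0" "n = 0" | "m = 0" "n \<ge> 1" | "m \<ge> 1" "n = 0" | "m \<ge> 1" "n \<ge> 1" by linarith
  then show ?thesis
  proof cases
    case 1 then show ?thesis using has_inner_gen_0 by simp
  next
    case 2 then show ?thesis using has_inner_gen_mixed by simp
  next
    case 3 then show ?thesis using has_inner_commute[OF has_inner_gen_mixed[OF 3(1)]] by simp
  next
    case 4 then show ?thesis by (rule has_inner_gen_pos) simp
  qed
qed

end

section \<open>The span of the generators\<close>

lemma sf_span_base: "F \<in> S \<Longrightarrow> F \<in> sf_span S"
  unfolding sf_span_def mem_Collect_eq by (intro exI[of _ "{F}"] exI[of _ "\<lambda>_. 1"]) auto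

lemma sf_span_lincomb:
  assumes "F \<in> sf_span S" "G \<in> sf_span S"
  shows "sf_lincomb x F y G \<in> sf_span S"
proof -
  obtain T c where T: "finite T" "T \<subseteq> S" "F = (\<lambda>s t \<omega>. \<Sum>K\<in>T. c K * K s t \<omega>)" using assms(1) by (auto simp: sf_span_def)
  obtain U d where U: "finite U" "U \<subseteq> S" "G = (\<lambda>s t \<omega>. \<Sum>K\<in>U. d K * K s t \<omega>)" using assms(2) by (auto simp: sf_span_def)
  let ?e = "\<lambda>K. x * (if K \<in> T then c K else 0) + y * (if K \<in> U then d K else 0)"
  have "sf_lincomb x F y G s t \<omega> = (\<Sum>K\<in>T \<union> U. ?e K * K s t \<omega>)" for s t \<omega>
  proof -
    have "(\<Sum>K\<in>T. c K * K s t \<omega>) = (\<Sum>K\<in>T \<union> U. (if K \<in> T then c K else 0) * K s t \<omega>)"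
      using T U by (intro sum.mono_neutral_cong_left) auto
    moreover have "(\<Sum>K\<in>U. d K * K s t \<omega>) = (\<Sum>K\<in>T \<union> U. (if K \<in> U then d K else 0) * K s t \<omega>)"
      using T U by (intro sum.mono_neutral_cong_left) auto
    ultimately show ?thesis unfolding sf_lincomb_def T(3) U(3)
      by (simp only: sum_distrib_left sum.distrib[symmetric] distrib_right mult.assoc)
  qed
  then have "sf_lincomb x F y G = (\<lambda>s t \<omega>. \<Sum>K\<in>T \<union> U. ?e K * K s t \<omega>)" by blast
  then show ?thesis unfolding sf_span_def mem_Collect_eq using T(1,2) U(1,2)
    by (intro exI[of _ "T \<union> U"] exI[of _ ?e]) blast
qed

lemma sf_span_minimal:
  assumes "F \<in> sf_span S" and base: "\<And>F. F \<in> S \<Longrightarrow> F \<in> P" and zero: "(\<lambda>s t \<omega>. 0) \<in> P"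
    and lin: "\<And>F G x y. F \<in> P \<Longrightarrow> G \<in> P \<Longrightarrow> sf_lincomb x F y G \<in> P"
  shows "F \<in> P"
proof -
  obtain T c where T: "finite T" "T \<subseteq> S" "F = (\<lambda>s t \<omega>. \<Sum>K\<in>T. c K * K s t \<omega>)" using assms(1) by (auto simp: sf_span_def)
  from T(1,2) have "(\<lambda>s t \<omega>. \<Sum>K\<in>T. c K * K s t \<omega>) \<in> P"
  proof (induction T)
    case empty
    then show ?case using zero by simp
  next
    case (insert K T)
    then have "sf_lincomb (c K) K 1 (\<lambda>s t \<omega>. \<Sum>K\<in>T. c K * K s t \<omega>) \<in> P" by (intro lin) (auto intro: base)
    then show ?case using insert(1,2) by (simp add: sf_lincomb_def)
  qed
  then show ?thesis using T(3) by simp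
qed

text \<open>The family is a parameter so that one coefficient array describes both an element of the
  span (family \<open>gn\<close>) and its image (family \<open>jgen\<close>). The same N bounds both
  indices, so two elements can be brought to a common size.\<close>

definition dsum :: "(nat \<Rightarrow> nat \<Rightarrow> 'w setfun) \<Rightarrow> nat \<Rightarrow> (nat \<Rightarrow> nat \<Rightarrow> real) \<Rightarrow> 'w setfun" where
  "dsum f N c = (\<lambda>s t \<omega>. \<Sum>m<N. \<Sum>i<N. c m i * f m i s t \<omega>)"

text \<open>Padding by zeros. The entries of a coefficient array outside the N by N square are
  arbitrary and have to be removed before N is enlarged or an index is shifted.\<close>

definition trunc :: "nat \<Rightarrow> (nat \<Rightarrow> nat \<Rightarrow> real) \<Rightarrow> nat \<Rightarrow> nat \<Rightarrow> real" where
  "trunc N c m i = (if m < N \<and> i < N then c m i else 0)"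

lemma dsum_trunc:
  assumes "N \<le> N'"
  shows "dsum f N' (trunc N c) = dsum f N c"
proof -
  have "(\<Sum>m<N'. \<Sum>i<N'. trunc N c m i * f m i s t \<omega>) = (\<Sum>m<N. \<Sum>i<N. c m i * f m i s t \<omega>)" for s t \<omega>
  proof -
    have "(\<Sum>m<N'. \<Sum>i<N'. trunc N c m i * f m i s t \<omega>) = (\<Sum>m<N. \<Sum>i<N'. trunc N c m i * f m i s t \<omega>)"
      using assms by (intro sum.mono_neutral_right) (auto simp: trunc_def)
    also have "\<dots> = (\<Sum>m<N. \<Sum>i<N. c m i * f m i s t \<omega>)"
      using assms by (intro sum.cong refl sum.mono_neutral_cong_right) (auto simp: trunc_def)
    finally show ?thesis .
  qed
  then show ?thesis by (simp add: dsum_def)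
qed

lemma dsum_lincomb: "sf_lincomb x (dsum f N c) y (dsum f N d) = dsum f N (\<lambda>m i. x * c m i + y * d m i)"
  unfolding dsum_def sf_lincomb_def by (simp only: sum_distrib_left sum.distrib[symmetric] distrib_right mult.assoc)

lemma single_eq_dsum: "f m i = dsum f (Suc (max m i)) (\<lambda>n j. if n = m \<and> j = i then 1 else 0)"
proof -
  have "(\<Sum>n<Suc (max m i). \<Sum>j<Suc (max m i). (if n = m \<and> j = i then 1 else 0) * f n j s t \<omega>) = f m i s t \<omega>" for s t \<omega>
  proof -
    have "(\<Sum>n<Suc (max m i). \<Sum>j<Suc (max m i). (if n = m \<and> j = i then 1 else 0) * f n j s t \<omega>)
      = (\<Sum>n<Suc (max m i). if n = m then (\<Sum>j<Suc (max m i). if j = i then f n j s t \<omega> else 0) else 0)"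
      by (intro sum.cong refl) (simp add: mult_delta_left)
    also have "\<dots> = f m i s t \<omega>" by (simp add: less_Suc_eq_le)
    finally show ?thesis .
  qed
  then show ?thesis by (simp add: dsum_def fun_eq_iff)
qed

lemma (in prob_space) has_inner_dsum_left:
  assumes "\<And>m i. has_inner M (f m i) G (\<lambda>_. r m i)" "random_setfun M G"
  shows "has_inner M (dsum f N c) G (\<lambda>_. \<Sum>m<N. \<Sum>i<N. c m i * r m i)"
proof -
  have "has_inner M (\<lambda>s t \<omega>. \<Sum>m\<in>{..<N}. 1 * (\<Sum>i\<in>{..<N}. c m i * f m i s t \<omega>)) G (\<lambda>_. \<Sum>m\<in>{..<N}. 1 * (\<Sum>i\<in>{..<N}. c m i * r m i))"
    by (intro has_inner_sum_left assms) auto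
  then show ?thesis by (simp add: dsum_def)
qed

context sheets
begin

abbreviation "Phi \<equiv> dsum gn"

definition gen_span :: "'w setfun set" where
  "gen_span = {Phi N c | N c. True}"

lemma gen_span_lincomb:
  assumes "F \<in> gen_span" "G \<in> gen_span"
  shows "sf_lincomb x F y G \<in> gen_span"
proof -
  obtain N c N' d where F: "F = Phi N c" and G: "G = Phi N' d" using assms by (auto simp: gen_span_def)
  have "sf_lincomb x F y G = Phi (max N N') (\<lambda>m i. x * trunc N c m i + y * trunc N' d m i)"
    unfolding F G dsum_lincomb[symmetric] by (simp add: dsum_trunc)
  then show ?thesis by (auto simp: gen_span_def)
qed

lemma gen_in_gen_span: "gn m i \<in> gen_span"
  using single_eq_dsum[of gn] unfolding gen_span_def by blast

lemma zero_in_gen_span: "(\<lambda>s t \<omega>. 0) \<in> gen_span"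
  unfolding gen_span_def mem_Collect_eq by (intro exI[of _ 0]) (simp add: dsum_def)

lemma sum_in_gen_span:
  assumes "finite A" "\<And>p. p \<in> A \<Longrightarrow> F p \<in> gen_span"
  shows "(\<lambda>s t \<omega>. \<Sum>p\<in>A. c p * F p s t \<omega>) \<in> gen_span"
  using assms
proof (induction A)
  case empty
  then show ?case using zero_in_gen_span by simp
next
  case (insert p A)
  then have "sf_lincomb (c p) (F p) 1 (\<lambda>s t \<omega>. \<Sum>p\<in>A. c p * F p s t \<omega>) \<in> gen_span" by (intro gen_span_lincomb) auto
  then show ?case using insert(1,2) by (simp add: sf_lincomb_def)
qed

text \<open>The coefficients in \<open>C_sheet\<close> are ballot numbers, those of x^k at the
  Chebyshev polynomials; the term at m = 0 is missing.\<close>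

lemma psi_expand: "\<psi>_sf B a b k i s t \<omega> = (\<Sum>m=1..k. ballot k m * gn m i s t \<omega>)"
proof -
  have C: "C_sheet B k x y \<omega> = (\<Sum>m=1..k. ballot k m * B m x y \<omega>)" for x y
    unfolding C_sheet_def by (rule sum.mono_neutral_cong_left) (auto simp: ballot_def)
  have "\<psi>_sf B a b k i s t \<omega> = (\<Sum>m=1..k. ballot k m * ((((B m t (b i) \<omega> - B m t (a i) \<omega>) + (B m (b i) t \<omega> - B m (a i) t \<omega>)) / sqrt 2 - 
    ((B m s (b i) \<omega> - B m s (a i) \<omega>) + (B m (b i) s \<omega> - B m (a i) s \<omega>)) / sqrt 2) / sqrt (t - s)))"
    unfolding \<psi>_sf_def d_over_sqrt_dx_def \<Gamma>_sheet_def C sum_divide_distrib sum_subtractf[symmetric] sum.distrib[symmetric] sum_distrib_left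
    by (intro sum.cong refl) (simp add: algebra_simps add_divide_distrib diff_divide_distrib)
  also have "\<dots> = (\<Sum>m=1..k. ballot k m * gn m i s t \<omega>)"
    by (intro sum.cong refl) (simp add: gen_pos incr_def sheet_incr_def)
  finally show ?thesis .
qed

lemma psi_expand_fun: "\<psi>_sf B a b k i = (\<lambda>s t \<omega>. \<Sum>m\<in>{1..k}. ballot k m * gn m i s t \<omega>)"
  using psi_expand by blast

text \<open>The expansion of \<open>\<psi>_sf\<close> is triangular with 1 on the diagonal, so it
  can be inverted by induction on the order.\<close>

lemma gen_in_sheet_span: "gn m i \<in> sheet_span B a b"
proof (induction m rule: less_induct)
  case (less m)
  show ?case
  proof (cases "m = 0")
    case True
    then show ?thesis unfolding sheet_span_def by (intro sf_span_base) (simp add: gen_def)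
  next
    case False
    have p: "\<psi>_sf B a b m i \<in> sheet_span B a b"
      unfolding sheet_span_def using False by (intro sf_span_base) (auto intro!: Suc_leI)
    have "(\<lambda>s t \<omega>. \<Sum>l\<in>A. ballot m l * gn l i s t \<omega>) \<in> sheet_span B a b" if "finite A" "A \<subseteq> {..<m}" for A
      using that
    proof (induction A)
      case empty
      have "sf_lincomb 0 (\<psi>_sf B a b m i) 0 (\<psi>_sf B a b m i) \<in> sheet_span B a b"
        using p unfolding sheet_span_def by (intro sf_span_lincomb)
      then show ?case by (simp add: sf_lincomb_def)
    next
      case (insert l A)
      then have "sf_lincomb (ballot m l) (gn l i) 1 (\<lambda>s t \<omega>. \<Sum>l\<in>A. ballot m l * gn l i s t \<omega>) \<in> sheet_span B a b"
        using less unfolding sheet_span_def by (intro sf_span_lincomb) auto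
      then show ?case using insert(1,2) by (simp add: sf_lincomb_def)
    qed
    from this[OF finite_atLeastLessThan, of 1 m] have "(\<lambda>s t \<omega>. \<Sum>l\<in>{1..<m}. ballot m l * gn l i s t \<omega>) \<in> sheet_span B a b" by (simp add: subset_eq)
    then have "sf_lincomb 1 (\<psi>_sf B a b m i) (- 1) (\<lambda>s t \<omega>. \<Sum>l\<in>{1..<m}. ballot m l * gn l i s t \<omega>) \<in> sheet_span B a b"
      using p unfolding sheet_span_def by (intro sf_span_lincomb)
    moreover have "sf_lincomb 1 (\<psi>_sf B a b m i) (- 1) (\<lambda>s t \<omega>. \<Sum>l\<in>{1..<m}. ballot m l * gn l i s t \<omega>) = gn m i"
    proof -
      have "{1..m} = insert m {1..<m}" using False by auto
      then show ?thesis by (simp add: sf_lincomb_def psi_expand ballot_self fun_eq_iff)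
    qed
    ultimately show ?thesis by simp
  qed
qed

lemma sheet_span_eq: "sheet_span B a b = gen_span"
proof (intro equalityI subsetI)
  fix F assume "F \<in> sheet_span B a b"
  then show "F \<in> gen_span" unfolding sheet_span_def
  proof (rule sf_span_minimal)
    fix F assume "F \<in> range (ind_sf a b) \<union> {\<psi>_sf B a b k i |k i. 1 \<le> k}"
    then consider i where "F = ind_sf a b i" | k i where "F = \<psi>_sf B a b k i" by auto
    then show "F \<in> gen_span"
    proof cases
      case 1 then show ?thesis using gen_in_gen_span[of 0] by (simp add: gen_def)
    next
      case 2 then show ?thesis unfolding 2 psi_expand_fun by (intro sum_in_gen_span gen_in_gen_span) auto
    qed
  qed (auto intro: zero_in_gen_span gen_span_lincomb)
next
  fix F assume "F \<in> gen_span"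
  then obtain N c where F: "F = Phi N c" by (auto simp: gen_span_def)
  have z: "(\<lambda>s t \<omega>. 0) \<in> sheet_span B a b"
    using sf_span_lincomb[of "gn 0 0" _ "gn 0 0" 0 0] gen_in_sheet_span[of 0 0]
    unfolding sheet_span_def sf_lincomb_def by simp
  have sum_in: "(\<lambda>s t \<omega>. \<Sum>p\<in>A. c p * K p s t \<omega>) \<in> sheet_span B a b" if "finite A" "\<And>p. p \<in> A \<Longrightarrow> K p \<in> sheet_span B a b"
    for A :: "nat set" and c and K :: "nat \<Rightarrow> 'w setfun"
    using that
  proof (induction A)
    case empty then show ?case using z by simp
  next
    case (insert p A)
    then have "sf_lincomb (c p) (K p) 1 (\<lambda>s t \<omega>. \<Sum>p\<in>A. c p * K p s t \<omega>) \<in> sheet_span B a b"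
      unfolding sheet_span_def by (intro sf_span_lincomb) auto
    then show ?case using insert(1,2) by (simp add: sf_lincomb_def)
  qed
  have "(\<lambda>s t \<omega>. \<Sum>m\<in>{..<N}. 1 * (\<Sum>i\<in>{..<N}. c m i * gn m i s t \<omega>)) \<in> sheet_span B a b"
    by (intro sum_in gen_in_sheet_span) auto
  then show "F \<in> sheet_span B a b" unfolding F dsum_def by simp
qed

lemma random_Phi: "random_setfun M (Phi N c)"
  using random_gen unfolding random_setfun_def dsum_def
  by (auto intro!: borel_measurable_sum borel_measurable_times)

lemma has_inner_flip: "has_inner M F G Z \<longleftrightarrow> has_inner M G F Z"
  using has_inner_commute by blast

lemma has_inner_gen_Phi: "has_inner M (gn m i) (Phi N d) (\<lambda>_. if m < N then \<Sum>j<N. d m j * ov i j else 0)"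
proof -
  have "has_inner M (Phi N d) (gn m i) (\<lambda>_. \<Sum>n<N. \<Sum>j<N. d n j * (if n = m then ov j i else 0))"
    by (intro has_inner_dsum_left has_inner_gen random_gen)
  moreover have "(\<Sum>n<N. \<Sum>j<N. d n j * (if n = m then ov j i else 0)) = (\<Sum>n<N. if n = m then \<Sum>j<N. d n j * ov i j else 0)"
    by (intro sum.cong refl) (auto simp: ov_def overlap_commute)
  ultimately show ?thesis by (subst has_inner_flip) simp
qed

definition form :: "nat \<Rightarrow> (nat \<Rightarrow> real) \<Rightarrow> (nat \<Rightarrow> real) \<Rightarrow> real" where
  "form N u v = (\<Sum>i<N. \<Sum>j<N. u i * v j * ov i j)"

lemma has_inner_Phi: "has_inner M (Phi N c) (Phi N d) (\<lambda>_. \<Sum>m<N. form N (c m) (d m))"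
proof -
  have "has_inner M (Phi N c) (Phi N d) (\<lambda>_. \<Sum>m<N. \<Sum>i<N. c m i * (if m < N then \<Sum>j<N. d m j * ov i j else 0))"
    by (intro has_inner_dsum_left has_inner_gen_Phi random_Phi)
  moreover have "(\<Sum>m<N. \<Sum>i<N. c m i * (if m < N then \<Sum>j<N. d m j * ov i j else 0)) = (\<Sum>m<N. form N (c m) (d m))"
    by (intro sum.cong refl) (simp add: form_def sum_distrib_left mult.assoc)
  ultimately show ?thesis by simp
qed

definition stepf :: "nat \<Rightarrow> (nat \<Rightarrow> real) \<Rightarrow> real \<Rightarrow> real" where
  "stepf N u x = (\<Sum>i<N. u i * indicator {a i<..b i} x)"

section \<open>Step functions and the uniform second moment bound\<close>

lemma indicator_integrable [simp]: "integrable lebesgue (\<lambda>x. indicator {s<..t::real} x :: real)"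
  by (cases "s \<le> t") (auto intro!: integrable_real_indicator)

lemma indicator_product_integral:
  "(LINT x|lebesgue. indicator {a i<..b i} x * indicator {a j<..b j} x) = ov i j"
  using set_integral_indicator_overlap[of "a i" "b i" "a j" "b j"] endpoints[of i] endpoints[of j]
  by (simp add: set_lebesgue_integral_def ov_def)

lemma indicator_product_integrable:
  "integrable lebesgue (\<lambda>x. indicator {s<..t::real} x * indicator {u<..v} x :: real)"
  by (simp add: indicator_inter_arith[symmetric] Int_greaterThanAtMost)

lemma stepf_measurable: "stepf N u \<in> borel_measurable lebesgue"
  unfolding stepf_def[abs_def] by (intro borel_measurable_sum borel_measurable_times borel_measurable_indicator) auto

lemma stepf_square: "(stepf N u x)\<^sup>2 = (\<Sum>i<N. \<Sum>j<N. u i * u j * (indicator {a i<..b i} x * indicator {a j<..b j} x))"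
  unfolding stepf_def power2_eq_square sum_product by (simp add: mult_ac)

lemma stepf_square_integrable: "integrable lebesgue (\<lambda>x. (stepf N u x)\<^sup>2)"
  and stepf_square_integral: "(LINT x|lebesgue. (stepf N u x)\<^sup>2) = form N u u"
proof -
  have int: "integrable lebesgue (\<lambda>x. u i * u j * (indicator {a i<..b i} x * indicator {a j<..b j} x) :: real)" for i j
    by (intro integrable_mult_right indicator_product_integrable)
  show "integrable lebesgue (\<lambda>x. (stepf N u x)\<^sup>2)"
    unfolding stepf_square using int by (rule integral_double_sum(1))
  have "(LINT x|lebesgue. (stepf N u x)\<^sup>2) = (\<Sum>i<N. \<Sum>j<N. LINT x|lebesgue. u i * u j * (indicator {a i<..b i} x * indicator {a j<..b j} x))"
    unfolding stepf_square using int by (rule integral_double_sum(2))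
  also have "\<dots> = form N u u" by (simp add: indicator_product_integral form_def)
  finally show "(LINT x|lebesgue. (stepf N u x)\<^sup>2) = form N u u" .
qed

lemma set_integral_stepf:
  assumes "s \<le> t"
  shows "(LINT x:{s<..t}|lebesgue. stepf N u x) = (\<Sum>i<N. u i * overlap s t (a i) (b i))"
proof -
  have "(LINT x:{s<..t}|lebesgue. stepf N u x) = (LINT x|lebesgue. (\<Sum>i<N. u i * (indicator {s<..t} x * indicator {a i<..b i} x)))"
    unfolding set_lebesgue_integral_def stepf_def real_scaleR_def sum_distrib_left
    by (simp only: mult.left_commute mult.assoc)
  also have "\<dots> = (\<Sum>i<N. u i * (LINT x|lebesgue. indicator {s<..t} x * indicator {a i<..b i} x))"
    using indicator_product_integrable by (subst Bochner_Integration.integral_sum) auto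
  also have "\<dots> = (\<Sum>i<N. u i * overlap s t (a i) (b i))"
    using set_integral_indicator_overlap[OF assms less_imp_le[OF endpoints(2)]]
    by (simp add: set_lebesgue_integral_def)
  finally show ?thesis .
qed

text \<open>Positivity is not visible in the overlap matrix; it comes from reading the form as the
  squared L^2 norm of a step function.\<close>

lemma form_nonneg: "0 \<le> form N u u"
  unfolding stepf_square_integral[symmetric] by (intro integral_nonneg_AE) auto

text \<open>The inner sum is the integral of the step function over the cell, so this is the
  contraction property of averaging.\<close>

lemma sum_overlap_form_le:
  assumes "is_partition ts"
  shows "(\<Sum>k<length ts - 1. (\<Sum>i<N. u i * overlap (ts ! k) (ts ! Suc k) (a i) (b i))\<^sup>2 / (ts ! Suc k - ts ! k)) \<le> form N u u"
proof -
  have "(\<Sum>k<length ts - 1. (\<Sum>i<N. u i * overlap (ts ! k) (ts ! Suc k) (a i) (b i))\<^sup>2 / (ts ! Suc k - ts ! k))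
    = (\<Sum>k<length ts - 1. (LINT x:{ts ! k<..ts ! Suc k}|lebesgue. stepf N u x)\<^sup>2 / (ts ! Suc k - ts ! k))"
  proof (rule sum.cong[OF refl])
    fix k assume "k \<in> {..<length ts - 1}"
    then have "ts ! k \<le> ts ! Suc k" using partition_interval(2)[OF assms, of k] by simp
    then show "(\<Sum>i<N. u i * overlap (ts ! k) (ts ! Suc k) (a i) (b i))\<^sup>2 / (ts ! Suc k - ts ! k) =
      (LINT x:{ts ! k<..ts ! Suc k}|lebesgue. stepf N u x)\<^sup>2 / (ts ! Suc k - ts ! k)"
      by (simp add: set_integral_stepf)
  qed
  also have "\<dots> \<le> form N u u"
    using sum_average_squares_le[OF stepf_measurable stepf_square_integrable assms] by (simp only: stepf_square_integral)
  finally show ?thesis .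
qed

text \<open>One formula for deterministic and random generators. For m = 0 the variance term is
  absent and the averages produce the divisor t - s; for positive order the overlap term comes from
  symmetrization and has divisor 1.\<close>

lemma expectation_gen_product:
  assumes st: "0 \<le> s" "s < t" "t \<le> 1"
  shows "integrable M (\<lambda>\<omega>. gn m i s t \<omega> * gn n j s t \<omega>)"
    and "expectation (\<lambda>\<omega>. gn m i s t \<omega> * gn n j s t \<omega>) * (t - s) = (if m = n then (if m = 0 then 0 else (t - s) * ov i j)
      + overlap s t (a i) (b i) * overlap s t (a j) (b j) / (if m = 0 then t - s else 1) else 0)"
proof -
  have I: "s \<in> {0..1}" "t \<in> {0..1}" using st by auto
  have sq: "sqrt (t - s) * sqrt (t - s) = t - s" "t - s \<noteq> 0" using st by auto
  have mixed: "integrable M (incr m i s t) \<and> expectation (incr m i s t) = 0" if "m \<ge> 1" for m i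
  proof -
    interpret gaussian_space M "sheet_lin m" by (rule gaussian_sheet_lin) fact
    show ?thesis using integrable_V mean_V incr_in_lin[OF that I] by blast
  qed
  consider "m = 0" "n = 0" | "m = 0" "n \<ge> 1" | "m \<ge> 1" "n = 0" | "m \<ge> 1" "n \<ge> 1" by linarith
  then have "integrable M (\<lambda>\<omega>. gn m i s t \<omega> * gn n j s t \<omega>) \<and>
    expectation (\<lambda>\<omega>. gn m i s t \<omega> * gn n j s t \<omega>) * (t - s) = (if m = n then (if m = 0 then 0 else (t - s) * ov i j)
      + overlap s t (a i) (b i) * overlap s t (a j) (b j) / (if m = 0 then t - s else 1) else 0)"
  proof cases
    case 1
    then show ?thesis using st by (simp add: gen_0 prob_space)
  next
    case 2
    then show ?thesis using st mixed[of n j] by (simp add: gen_0 gen_pos)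
  next
    case 3
    then show ?thesis using st mixed[of m i] by (simp add: gen_0 gen_pos)
  next
    case 4
    have "(\<lambda>\<omega>. gn m i s t \<omega> * gn n j s t \<omega>) = (\<lambda>\<omega>. (incr m i s t \<omega> * incr n j s t \<omega>) / (t - s))"
      using 4 sq by (simp add: gen_pos)
    then show ?thesis using cov_incr[OF 4 I I, of i j] st 4
      by (auto simp: cov_def ov_def overlap_self)
  qed
  then show "integrable M (\<lambda>\<omega>. gn m i s t \<omega> * gn n j s t \<omega>)"
    "expectation (\<lambda>\<omega>. gn m i s t \<omega> * gn n j s t \<omega>) * (t - s) = (if m = n then (if m = 0 then 0 else (t - s) * ov i j)
      + overlap s t (a i) (b i) * overlap s t (a j) (b j) / (if m = 0 then t - s else 1) else 0)" by auto
qed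

lemma expectation_Phi_square:
  assumes st: "0 \<le> s" "s < t" "t \<le> 1"
  shows "integrable M (\<lambda>\<omega>. Phi N c s t \<omega> * Phi N c s t \<omega>)"
    and "expectation (\<lambda>\<omega>. Phi N c s t \<omega> * Phi N c s t \<omega>) * (t - s) \<le>
      (\<Sum>m<N. (t - s) * form N (c m) (c m) + (\<Sum>i<N. c m i * overlap s t (a i) (b i))\<^sup>2 / (t - s))"
proof -
  let ?A = "{..<N} \<times> {..<N}"
  let ?c = "\<lambda>p. c (fst p) (snd p)" and ?g = "\<lambda>p. gn (fst p) (snd p) s t"
  have Phi: "Phi N c s t \<omega> = (\<Sum>p\<in>?A. ?c p * ?g p \<omega>)" for \<omega>
    unfolding dsum_def by (simp add: sum.cartesian_product case_prod_beta)
  have sq: "(\<lambda>\<omega>. Phi N c s t \<omega> * Phi N c s t \<omega>) = (\<lambda>\<omega>. \<Sum>p\<in>?A. \<Sum>q\<in>?A. ?c p * ?c q * (?g p \<omega> * ?g q \<omega>))"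
    unfolding Phi sum_product by (simp add: mult_ac)
  have int: "integrable M (\<lambda>\<omega>. ?c p * ?c q * (?g p \<omega> * ?g q \<omega>))" for p q
    by (intro integrable_mult_right expectation_gen_product[OF st])
  show "integrable M (\<lambda>\<omega>. Phi N c s t \<omega> * Phi N c s t \<omega>)"
    unfolding sq using int by (rule integral_double_sum(1))
  let ?o = "\<lambda>i. overlap s t (a i) (b i)"
  let ?k = "\<lambda>m i j. (if m = 0 then 0 else (t - s) * ov i j) + ?o i * ?o j / (if m = 0 then t - s else 1)"
  have "expectation (\<lambda>\<omega>. Phi N c s t \<omega> * Phi N c s t \<omega>) = (\<Sum>p\<in>?A. \<Sum>q\<in>?A. expectation (\<lambda>\<omega>. ?c p * ?c q * (?g p \<omega> * ?g q \<omega>)))"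
    unfolding sq using int by (rule integral_double_sum(2))
  then have "expectation (\<lambda>\<omega>. Phi N c s t \<omega> * Phi N c s t \<omega>) * (t - s) = 
    (\<Sum>p\<in>?A. \<Sum>q\<in>?A. ?c p * ?c q * (expectation (\<lambda>\<omega>. ?g p \<omega> * ?g q \<omega>) * (t - s)))"
    by (simp add: sum_distrib_right mult.assoc)
  also have "\<dots> = (\<Sum>p\<in>?A. \<Sum>q\<in>?A. ?c p * ?c q * (if fst p = fst q then ?k (fst p) (snd p) (snd q) else 0))"
    by (simp only: expectation_gen_product(2)[OF st])
  also have "\<dots> = (\<Sum>m<N. \<Sum>i<N. \<Sum>n<N. \<Sum>j<N. c m i * c n j * (if m = n then ?k m i j else 0))"
  proof -
    have pair: "(\<Sum>p\<in>?A. h (fst p) (snd p)) = (\<Sum>m<N. \<Sum>i<N. h m i)" for h :: "nat \<Rightarrow> nat \<Rightarrow> real"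
      by (simp add: sum.cartesian_product case_prod_beta)
    have "(\<Sum>q\<in>?A. c m i * ?c q * (if m = fst q then ?k m i (snd q) else 0)) =
      (\<Sum>n<N. \<Sum>j<N. c m i * c n j * (if m = n then ?k m i j else 0))" for m i
      by (rule pair[of "\<lambda>n j. c m i * c n j * (if m = n then ?k m i j else 0)"])
    then show ?thesis
      using pair[of "\<lambda>m i. \<Sum>q\<in>?A. c m i * ?c q * (if m = fst q then ?k m i (snd q) else 0)"] by (simp only:)
  qed
  also have "\<dots> = (\<Sum>m<N. \<Sum>i<N. \<Sum>n<N. if m = n then \<Sum>j<N. c m i * c m j * ?k m i j else 0)"
    by (intro sum.cong refl) auto
  also have "\<dots> = (\<Sum>m<N. \<Sum>i<N. \<Sum>j<N. c m i * c m j * ?k m i j)"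
    by (rule sum.cong[OF refl], rule sum.cong[OF refl]) simp
  also have "\<dots> = (\<Sum>m<N. (if m = 0 then 0 else (t - s) * form N (c m) (c m)) + (\<Sum>i<N. c m i * ?o i)\<^sup>2 / (if m = 0 then t - s else 1))"
  proof (rule sum.cong[OF refl])
    fix m
    have *: "(\<Sum>i<N. \<Sum>j<N. u i * u j * (e * ov i j + ?o i * ?o j / w)) = e * form N u u + (\<Sum>i<N. u i * ?o i)\<^sup>2 / w" for u e w
    proof -
      have 1: "(\<Sum>i<N. u i * ?o i)\<^sup>2 / w = (\<Sum>i<N. \<Sum>j<N. (u i * ?o i) * (u j * ?o j) / w)"
        by (simp only: power2_eq_square sum_product sum_divide_distrib)
      have 2: "e * form N u u = (\<Sum>i<N. \<Sum>j<N. e * (u i * u j * ov i j))" by (simp only: form_def sum_distrib_left)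
      show ?thesis unfolding 1 2 sum.distrib[symmetric]
        by (rule sum.cong[OF refl], rule sum.cong[OF refl]) (simp add: algebra_simps)
    qed
    show "(\<Sum>i<N. \<Sum>j<N. c m i * c m j * ?k m i j) = (if m = 0 then 0 else (t - s) * form N (c m) (c m))
        + (\<Sum>i<N. c m i * ?o i)\<^sup>2 / (if m = 0 then t - s else 1)"
      using *[of "c m" 0 "t - s"] *[of "c m" "t - s" 1] by (cases "m = 0") simp_all
  qed
  \<comment> \<open>As t - s is at most 1, the divisor 1 may be replaced by t - s. The overlap term
    of each random order then has the shape of an average and can be summed by the contraction
    property.\<close>
  also have "\<dots> \<le> (\<Sum>m<N. (t - s) * form N (c m) (c m) + (\<Sum>i<N. c m i * ?o i)\<^sup>2 / (t - s))"
  proof (intro sum_mono add_mono)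
    fix m
    show "(if m = 0 then 0 else (t - s) * form N (c m) (c m)) \<le> (t - s) * form N (c m) (c m)"
      using st mult_nonneg_nonneg[OF _ form_nonneg[of N "c m"], of "t - s"] by auto
    show "(\<Sum>i<N. c m i * ?o i)\<^sup>2 / (if m = 0 then t - s else 1) \<le> (\<Sum>i<N. c m i * ?o i)\<^sup>2 / (t - s)"
      using st by (intro divide_left_mono) auto
  qed
  finally show "expectation (\<lambda>\<omega>. Phi N c s t \<omega> * Phi N c s t \<omega>) * (t - s) \<le>
      (\<Sum>m<N. (t - s) * form N (c m) (c m) + (\<Sum>i<N. c m i * ?o i)\<^sup>2 / (t - s))" .
qed

text \<open>Summed over the cells, the variance terms give the squared norm once, because the
  lengths add up to 1, and the squared averages give it at most once more; this is the factor
  2.\<close>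

lemma second_moment_Phi:
  assumes ts: "is_partition ts"
  shows "(\<integral>\<^sup>+\<omega>. ennreal (partition_sum (Phi N c) (Phi N c) ts \<omega>) \<partial>M) \<le> ennreal (2 * (\<Sum>m<N. form N (c m) (c m)))"
proof -
  let ?n = "length ts - 1"
  let ?f = "\<lambda>k \<omega>. Phi N c (ts ! k) (ts ! Suc k) \<omega> * Phi N c (ts ! k) (ts ! Suc k) \<omega> * (ts ! Suc k - ts ! k)"
  have int: "integrable M (?f k)" if "k < ?n" for k
    using expectation_Phi_square(1)[OF partition_interval[OF ts that]] by (intro integrable_mult_left)
  have "integrable M (partition_sum (Phi N c) (Phi N c) ts)"
    unfolding partition_sum_def[abs_def] using int by (intro Bochner_Integration.integrable_sum) auto
  then have nn: "(\<integral>\<^sup>+\<omega>. ennreal (partition_sum (Phi N c) (Phi N c) ts \<omega>) \<partial>M) = ennreal (expectation (partition_sum (Phi N c) (Phi N c) ts))"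
    by (intro nn_integral_eq_integral AE_I2 partition_sum_nonneg[OF ts])
  have "expectation (partition_sum (Phi N c) (Phi N c) ts) = (\<Sum>k<?n. expectation (?f k))"
    unfolding partition_sum_def[abs_def] using int by (intro Bochner_Integration.integral_sum) auto
  also have "\<dots> \<le> (\<Sum>k<?n. \<Sum>m<N. (ts ! Suc k - ts ! k) * form N (c m) (c m) 
      + (\<Sum>i<N. c m i * overlap (ts ! k) (ts ! Suc k) (a i) (b i))\<^sup>2 / (ts ! Suc k - ts ! k))"
    using expectation_Phi_square(2)[OF partition_interval[OF ts]] by (intro sum_mono) simp
  also have "\<dots> = (\<Sum>m<N. \<Sum>k<?n. (ts ! Suc k - ts ! k) * form N (c m) (c m) 
      + (\<Sum>i<N. c m i * overlap (ts ! k) (ts ! Suc k) (a i) (b i))\<^sup>2 / (ts ! Suc k - ts ! k))"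
    by (rule sum.swap)
  also have "\<dots> = (\<Sum>m<N. (\<Sum>k<?n. ts ! Suc k - ts ! k) * form N (c m) (c m) 
      + (\<Sum>k<?n. (\<Sum>i<N. c m i * overlap (ts ! k) (ts ! Suc k) (a i) (b i))\<^sup>2 / (ts ! Suc k - ts ! k)))"
    by (rule sum.cong[OF refl]) (simp only: sum.distrib sum_distrib_right)
  also have "\<dots> \<le> (\<Sum>m<N. 1 * form N (c m) (c m) + form N (c m) (c m))"
    unfolding partition_sum_lengths[OF ts] using sum_overlap_form_le[OF ts] by (intro sum_mono add_left_mono)
  also have "\<dots> = 2 * (\<Sum>m<N. form N (c m) (c m))" by (simp add: sum_distrib_left)
  finally show ?thesis unfolding nn by (rule ennreal_leI)
qed

sublocale SC: span_closure M gen_span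
proof
  show "gen_span \<noteq> {}" using zero_in_gen_span by blast
  show "random_setfun M F" if "F \<in> gen_span" for F using that random_Phi by (auto simp: gen_span_def)
  show "sf_lincomb c F d G \<in> gen_span" if "F \<in> gen_span" "G \<in> gen_span" for F G c d using that by (rule gen_span_lincomb)
  show "\<exists>r. has_inner M F G (\<lambda>_. r)" if FG: "F \<in> gen_span" "G \<in> gen_span" for F G
  proof -
    obtain N c N' d where F: "F = Phi N c" and G: "G = Phi N' d" using FG by (auto simp: gen_span_def)
    show ?thesis
      using has_inner_Phi[of "max N N'" "trunc N c" "trunc N' d"] unfolding F G by (auto simp: dsum_trunc)
  qed
  show "(\<integral>\<^sup>+\<omega>. ennreal (partition_sum F F ts \<omega>) \<partial>M) \<le> ennreal (2 * const_ip M F F)"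
    if F: "F \<in> gen_span" and ts: "is_partition ts" for F ts
  proof -
    obtain N c where F: "F = Phi N c" using F by (auto simp: gen_span_def)
    show ?thesis unfolding F const_ip_eqI[OF has_inner_Phi] by (rule second_moment_Phi[OF ts])
  qed
qed

lemma sheet_space_eq: "sheet_space M B a b = SC.H"
  by (simp add: sheet_space_def SC.H_def sheet_span_eq)

end

section \<open>The operator\<close>

text \<open>Applying the Jacobi matrix to the expansion of x^k gives that of x^(k+1): the recursion
  of the ballot numbers after a shift of the summation index.\<close>

lemma sum_ballot_Suc:
  "(\<Sum>m\<le>k. ballot k m * (g (Suc m) + (if m = 0 then 0 else g (m - 1)))) = (\<Sum>m\<le>Suc k. ballot (Suc k) m * g m)"
proof -
  let ?h = "\<lambda>m. ballot k m * (if m = 0 then 0 else g (m - 1))"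
  have "(\<Sum>m\<le>Suc k. ballot (Suc k) m * g m) = 
    (\<Sum>m\<le>Suc k. ballot k (Suc m) * g m) + (\<Sum>m\<le>Suc k. (if m = 0 then 0 else ballot k (m - 1)) * g m)"
    by (simp only: ballot_Suc distrib_right sum.distrib)
  also have "(\<Sum>m\<le>Suc k. (if m = 0 then 0 else ballot k (m - 1)) * g m) = (\<Sum>m\<le>k. ballot k m * g (Suc m))"
    by (subst sum.atMost_Suc_shift) simp
  also have "(\<Sum>m\<le>Suc k. ballot k (Suc m) * g m) = (\<Sum>m\<le>Suc (Suc k). ?h m)"
    by (subst sum.atMost_Suc_shift[of ?h]) simp
  also have "(\<Sum>m\<le>Suc (Suc k). ?h m) = (\<Sum>m\<le>k. ?h m)"
    by (simp add: ballot_eq_0)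
  finally show ?thesis by (simp only: sum.distrib[symmetric] distrib_left add.commute)
qed

context sheets
begin

abbreviation "ip \<equiv> const_ip M"
abbreviation "nrm \<equiv> const_nrm M"

text \<open>The operator is the free Jacobi matrix in the first index of the generators.\<close>

definition jgen :: "nat \<Rightarrow> nat \<Rightarrow> 'w setfun" where
  "jgen m i = (\<lambda>s t \<omega>. gn (Suc m) i s t \<omega> + (if m = 0 then 0 else gn (m - 1) i s t \<omega>))"

abbreviation "Psi \<equiv> dsum jgen"

text \<open>A relation, since the coefficients are not determined by the set function: indicators of
  overlapping rational intervals are linearly dependent. That the image is determined modulo null
  vectors follows later from the norm bound.\<close>

definition jac :: "'w setfun \<Rightarrow> 'w setfun \<Rightarrow> bool" where
  "jac F G \<longleftrightarrow> (\<exists>N c. F = Phi N c \<and> G = Psi N c)"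

lemma jac_common:
  assumes "jac F G" "jac F' G'"
  obtains N c d where "F = Phi N c" "G = Psi N c" "F' = Phi N d" "G' = Psi N d"
proof -
  obtain N c N' d where "F = Phi N c" "G = Psi N c" "F' = Phi N' d" "G' = Psi N' d" using assms by (auto simp: jac_def)
  then show ?thesis using that[of "max N N'" "trunc N c" "trunc N' d"] by (simp add: dsum_trunc)
qed

lemma jac_lincomb:
  assumes "jac F G" "jac F' G'"
  shows "jac (sf_lincomb x F y F') (sf_lincomb x G y G')"
proof -
  obtain N c d where e: "F = Phi N c" "G = Psi N c" "F' = Phi N d" "G' = Psi N d" using assms by (rule jac_common)
  show ?thesis unfolding e dsum_lincomb jac_def by blast
qed

lemma jac_zero: "jac (\<lambda>s t \<omega>. 0) (\<lambda>s t \<omega>. 0)"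
  unfolding jac_def by (intro exI[of _ 0]) (simp add: dsum_def)

lemma jac_sum:
  assumes "finite A" "\<And>p. p \<in> A \<Longrightarrow> jac (F p) (G p)"
  shows "jac (\<lambda>s t \<omega>. \<Sum>p\<in>A. c p * F p s t \<omega>) (\<lambda>s t \<omega>. \<Sum>p\<in>A. c p * G p s t \<omega>)"
  using assms
proof (induction A)
  case empty
  then show ?case using jac_zero by simp
next
  case (insert p A)
  then have "jac (sf_lincomb (c p) (F p) 1 (\<lambda>s t \<omega>. \<Sum>p\<in>A. c p * F p s t \<omega>)) (sf_lincomb (c p) (G p) 1 (\<lambda>s t \<omega>. \<Sum>p\<in>A. c p * G p s t \<omega>))"
    by (intro jac_lincomb) auto
  then show ?case using insert(1,2) by (simp add: sf_lincomb_def)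
qed

lemma jac_gen: "jac (gn m i) (jgen m i)"
  unfolding jac_def using single_eq_dsum[of gn m i] single_eq_dsum[of jgen m i] by blast

lemma has_inner_jgen:
  "has_inner M (jgen m i) (gn n j) (\<lambda>_. (if Suc m = n then ov i j else 0) + (if m = Suc n then ov i j else 0))"
proof (cases "m = 0")
  case True
  then have "jgen m i = gn 1 i" by (simp add: jgen_def)
  then show ?thesis using has_inner_gen[of 1 i n j] True by (simp cong: if_cong)
next
  case False
  then have "jgen m i = sf_lincomb 1 (gn (Suc m) i) 1 (gn (m - 1) i)" by (simp add: jgen_def sf_lincomb_def)
  moreover have "m - 1 = n \<longleftrightarrow> m = Suc n" using False by auto
  ultimately show ?thesis 
    using has_inner_lincomb_left[OF has_inner_gen[of "Suc m" i n j] has_inner_gen[of "m - 1" i n j], of 1 1] by simp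
qed

lemma random_jgen: "random_setfun M (jgen m i)"
  using has_inner_jgen[of m i 0 0] by (simp add: has_inner_def)

lemma jgen_in_span: "jgen m i \<in> gen_span"
proof (cases "m = 0")
  case True
  then have "jgen m i = gn 1 i" by (simp add: jgen_def)
  then show ?thesis using gen_in_gen_span by simp
next
  case False
  then have "jgen m i = sf_lincomb 1 (gn (Suc m) i) 1 (gn (m - 1) i)" by (simp add: jgen_def sf_lincomb_def)
  then show ?thesis using gen_span_lincomb[OF gen_in_gen_span gen_in_gen_span] by simp
qed

lemma jac_in_span:
  assumes "jac F G"
  shows "F \<in> gen_span" "G \<in> gen_span"
proof -
  obtain N c where F: "F = Phi N c" and G: "G = Psi N c" using assms by (auto simp: jac_def)
  show "F \<in> gen_span" unfolding F gen_span_def by blast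
  have "(\<lambda>s t \<omega>. \<Sum>m\<in>{..<N}. 1 * (\<Sum>i\<in>{..<N}. c m i * jgen m i s t \<omega>)) \<in> gen_span"
    by (intro sum_in_gen_span jgen_in_span) auto
  then show "G \<in> gen_span" unfolding G dsum_def by simp
qed

text \<open>The matrix is symmetric: it links neighbouring orders with equal weight in both
  directions, and the overlap of two intervals is symmetric.\<close>

lemma jac_symmetric:
  assumes "jac F G" "jac F' G'"
  shows "ip G F' = ip F G'"
proof -
  obtain N c d where e: "F = Phi N c" "G = Psi N c" "F' = Phi N d" "G' = Psi N d" using assms by (rule jac_common)
  define r where "r m i n j = (if Suc m = n then ov i j else 0) + (if m = Suc n then ov i j else 0)" for m i n j
  have r_sym: "r m i n j = r n j m i" for m i n j by (simp add: r_def ov_def overlap_commute)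
  have jg: "has_inner M (jgen m i) (gn n j) (\<lambda>_. r m i n j)" for m i n j unfolding r_def by (rule has_inner_jgen)
  have gj: "has_inner M (gn m i) (jgen n j) (\<lambda>_. r m i n j)" for m i n j
    using has_inner_commute[OF jg[of n j m i]] by (simp add: r_sym[of m i n j])
  have "has_inner M (Phi N d) (jgen m i) (\<lambda>_. \<Sum>n<N. \<Sum>j<N. d n j * r n j m i)" for m i
    by (intro has_inner_dsum_left gj random_jgen)
  then have "has_inner M (jgen m i) (Phi N d) (\<lambda>_. \<Sum>n<N. \<Sum>j<N. d n j * r n j m i)" for m i by (rule has_inner_commute)
  then have 1: "has_inner M (Psi N c) (Phi N d) (\<lambda>_. \<Sum>m<N. \<Sum>i<N. c m i * (\<Sum>n<N. \<Sum>j<N. d n j * r n j m i))"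
    by (intro has_inner_dsum_left random_Phi)
  have "has_inner M (Psi N d) (gn m i) (\<lambda>_. \<Sum>n<N. \<Sum>j<N. d n j * r n j m i)" for m i
    by (intro has_inner_dsum_left jg random_gen)
  then have "has_inner M (gn m i) (Psi N d) (\<lambda>_. \<Sum>n<N. \<Sum>j<N. d n j * r n j m i)" for m i by (rule has_inner_commute)
  moreover have "random_setfun M (Psi N d)" using jac_in_span(2)[OF assms(2)] SC.random e(4) by simp
  ultimately have 2: "has_inner M (Phi N c) (Psi N d) (\<lambda>_. \<Sum>m<N. \<Sum>i<N. c m i * (\<Sum>n<N. \<Sum>j<N. d n j * r n j m i))"
    by (intro has_inner_dsum_left)
  show ?thesis unfolding e const_ip_eqI[OF 1] const_ip_eqI[OF 2] ..
qed

lemma nrm_Phi: "nrm (Phi N c) = sqrt (\<Sum>m<N. form N (c m) (c m))"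
  by (simp add: const_nrm_def const_ip_eqI[OF has_inner_Phi])

lemma form_extend:
  assumes "N \<le> N'" "\<And>i. i < N \<Longrightarrow> u' i = u i" "\<And>i. \<not> i < N \<Longrightarrow> u' i = 0"
  shows "form N' u' u' = form N u u"
proof -
  have "(\<Sum>i<N'. \<Sum>j<N'. u' i * u' j * ov i j) = (\<Sum>i<N. \<Sum>j<N'. u' i * u' j * ov i j)"
    using assms by (intro sum.mono_neutral_right) auto
  also have "\<dots> = (\<Sum>i<N. \<Sum>j<N. u i * u j * ov i j)"
    using assms by (intro sum.cong refl sum.mono_neutral_cong_right) auto
  finally show ?thesis by (simp add: form_def)
qed

text \<open>The shift in the order is an isometry because layers of different order are orthogonal
  and all carry the same form.\<close>

lemma nrm_shift_up: "nrm (Phi (Suc N) (\<lambda>m i. if m = 0 then 0 else trunc N c (m - 1) i)) = nrm (Phi N c)"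
proof -
  have "(\<Sum>m<Suc N. form (Suc N) (\<lambda>i. if m = 0 then 0 else trunc N c (m - 1) i) (\<lambda>i. if m = 0 then 0 else trunc N c (m - 1) i))
    = (\<Sum>m<N. form (Suc N) (trunc N c m) (trunc N c m))"
    by (subst sum.lessThan_Suc_shift) (simp add: form_def)
  also have "\<dots> = (\<Sum>m<N. form N (c m) (c m))"
    by (intro sum.cong refl form_extend) (auto simp: trunc_def)
  finally show ?thesis by (simp add: nrm_Phi)
qed

text \<open>The adjoint of the shift loses the layer of order 0, whose form is nonnegative; hence
  only an inequality.\<close>

lemma nrm_shift_down: "nrm (Phi N (\<lambda>m. trunc N c (Suc m))) \<le> nrm (Phi N c)"
proof -
  have "(\<Sum>m<N. form N (trunc N c (Suc m)) (trunc N c (Suc m))) \<le> 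
    form N (trunc N c 0) (trunc N c 0) + (\<Sum>m<N. form N (trunc N c (Suc m)) (trunc N c (Suc m)))"
    using form_nonneg by simp
  also have "\<dots> = (\<Sum>m<Suc N. form N (trunc N c m) (trunc N c m))" by (subst sum.lessThan_Suc_shift) simp
  also have "\<dots> = (\<Sum>m<N. form N (trunc N c m) (trunc N c m))" by (simp add: form_def trunc_def)
  also have "\<dots> = (\<Sum>m<N. form N (c m) (c m))" by (intro sum.cong refl form_extend) (auto simp: trunc_def)
  finally show ?thesis by (simp add: nrm_Phi)
qed

lemma Psi_eq_shifts: "Psi N c = sf_lincomb 1 (Phi (Suc N) (\<lambda>m i. if m = 0 then 0 else trunc N c (m - 1) i)) 
    1 (Phi N (\<lambda>m. trunc N c (Suc m)))"
proof -
  have "Psi N c s t \<omega> = Phi (Suc N) (\<lambda>m i. if m = 0 then 0 else trunc N c (m - 1) i) s t \<omega> + Phi N (\<lambda>m. trunc N c (Suc m)) s t \<omega>" for s t \<omega>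
  proof -
    let ?g = "\<lambda>m i. gn m i s t \<omega>"
    let ?f = "\<lambda>m. \<Sum>i<N. trunc N c m i * (if m = 0 then 0 else ?g (m - 1) i)"
    have "Phi (Suc N) (\<lambda>m i. if m = 0 then 0 else trunc N c (m - 1) i) s t \<omega> = (\<Sum>m<N. \<Sum>i<N. c m i * ?g (Suc m) i)"
      unfolding dsum_def by (subst sum.lessThan_Suc_shift) (simp add: trunc_def)
    moreover have "Phi N (\<lambda>m. trunc N c (Suc m)) s t \<omega> = (\<Sum>m<Suc N. ?f m)"
      unfolding dsum_def by (subst sum.lessThan_Suc_shift) simp
    moreover have "(\<Sum>m<Suc N. ?f m) = (\<Sum>m<N. \<Sum>i<N. c m i * (if m = 0 then 0 else ?g (m - 1) i))"
      by (simp add: trunc_def)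
    ultimately show ?thesis unfolding dsum_def jgen_def by (simp only: distrib_left sum.distrib)
  qed
  then show ?thesis by (simp add: sf_lincomb_def fun_eq_iff)
qed

text \<open>The Jacobi matrix is the sum of the shift and its adjoint, each of norm at most
  1.\<close>

lemma jac_bound:
  assumes "jac F G"
  shows "nrm G \<le> 2 * nrm F"
proof -
  obtain N c where F: "F = Phi N c" and G: "G = Psi N c" using assms by (auto simp: jac_def)
  have "Phi N' d \<in> gen_span" for N' d by (auto simp: gen_span_def)
  then have "nrm G \<le> nrm (Phi (Suc N) (\<lambda>m i. if m = 0 then 0 else trunc N c (m - 1) i)) + nrm (Phi N (\<lambda>m. trunc N c (Suc m)))"
    unfolding G Psi_eq_shifts by (intro SC.nrm_triangle)
  then show ?thesis using nrm_shift_down[of N c] unfolding F nrm_shift_up by simp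
qed

text \<open>The closure of the graph of \<open>jac\<close>. Both limits are required, so that bounds
  and symmetry pass to it by continuity.\<close>

definition Jac :: "'w setfun \<Rightarrow> 'w setfun \<Rightarrow> bool" where
  "Jac F G \<longleftrightarrow> F \<in> SC.H \<and> G \<in> SC.H \<and> (\<exists>X Y. (\<forall>n. jac (X n) (Y n)) \<and> 
     (\<lambda>n. nrm (sf_diff (X n) F)) \<longlonglongrightarrow> 0 \<and> (\<lambda>n. nrm (sf_diff (Y n) G)) \<longlonglongrightarrow> 0)"

lemma JacE:
  assumes "Jac F G"
  obtains X Y where "F \<in> SC.H" "G \<in> SC.H" "\<And>n. jac (X n) (Y n)" "\<And>n. X n \<in> SC.H" "\<And>n. Y n \<in> SC.H"
     "(\<lambda>n. nrm (sf_diff (X n) F)) \<longlonglongrightarrow> 0" "(\<lambda>n. nrm (sf_diff (Y n) G)) \<longlonglongrightarrow> 0"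
  using assms jac_in_span SC.S_subset_H unfolding Jac_def by blast

lemma jac_imp_Jac: "jac F G \<Longrightarrow> Jac F G"
  unfolding Jac_def using jac_in_span[of F G] SC.S_subset_H SC.HH.nrm_diff_self
  by (intro conjI exI[of _ "\<lambda>_. F"] exI[of _ "\<lambda>_. G"]) auto

lemma nrm_tendsto:
  assumes "\<And>n. X n \<in> SC.H" "F \<in> SC.H" "(\<lambda>n. nrm (sf_diff (X n) F)) \<longlonglongrightarrow> 0"
  shows "(\<lambda>n. nrm (X n)) \<longlonglongrightarrow> nrm F"
  using SC.HH.ip_continuous[OF assms(1,2) assms(1,2) assms(3) assms(3)] unfolding const_nrm_def by (rule tendsto_real_sqrt)

lemma Jac_bound:
  assumes "Jac F G"
  shows "nrm G \<le> 2 * nrm F"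
proof -
  obtain X Y where J: "F \<in> SC.H" "G \<in> SC.H" "\<And>n. jac (X n) (Y n)" "\<And>n. X n \<in> SC.H" "\<And>n. Y n \<in> SC.H"
     "(\<lambda>n. nrm (sf_diff (X n) F)) \<longlonglongrightarrow> 0" "(\<lambda>n. nrm (sf_diff (Y n) G)) \<longlonglongrightarrow> 0" using assms by (rule JacE) blast
  show ?thesis
  proof (rule LIMSEQ_le)
    show "(\<lambda>n. nrm (Y n)) \<longlonglongrightarrow> nrm G" using J by (intro nrm_tendsto)
    show "(\<lambda>n. 2 * nrm (X n)) \<longlonglongrightarrow> 2 * nrm F" using J by (intro tendsto_mult_left nrm_tendsto)
    show "\<exists>N. \<forall>n\<ge>N. nrm (Y n) \<le> 2 * nrm (X n)" using jac_bound J(3) by blast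
  qed
qed

lemma Jac_symmetric:
  assumes "Jac F G" "Jac F' G'"
  shows "ip G F' = ip F G'"
proof -
  obtain X Y where J: "F \<in> SC.H" "G \<in> SC.H" "\<And>n. jac (X n) (Y n)" "\<And>n. X n \<in> SC.H" "\<And>n. Y n \<in> SC.H"
     "(\<lambda>n. nrm (sf_diff (X n) F)) \<longlonglongrightarrow> 0" "(\<lambda>n. nrm (sf_diff (Y n) G)) \<longlonglongrightarrow> 0" using assms(1) by (rule JacE) blast
  obtain X' Y' where J': "F' \<in> SC.H" "G' \<in> SC.H" "\<And>n. jac (X' n) (Y' n)" "\<And>n. X' n \<in> SC.H" "\<And>n. Y' n \<in> SC.H"
     "(\<lambda>n. nrm (sf_diff (X' n) F')) \<longlonglongrightarrow> 0" "(\<lambda>n. nrm (sf_diff (Y' n) G')) \<longlonglongrightarrow> 0" using assms(2) by (rule JacE) blast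
  have "(\<lambda>n. ip (Y n) (X' n)) \<longlonglongrightarrow> ip G F'" using J J' by (intro SC.HH.ip_continuous)
  moreover have "(\<lambda>n. ip (X n) (Y' n)) \<longlonglongrightarrow> ip F G'" using J J' by (intro SC.HH.ip_continuous)
  ultimately show ?thesis using jac_symmetric[OF J(3) J'(3)] LIMSEQ_unique by simp
qed

lemma Jac_lincomb:
  assumes "Jac F G" "Jac F' G'"
  shows "Jac (sf_lincomb x F y F') (sf_lincomb x G y G')"
proof -
  obtain X Y where J: "F \<in> SC.H" "G \<in> SC.H" "\<And>n. jac (X n) (Y n)" "\<And>n. X n \<in> SC.H" "\<And>n. Y n \<in> SC.H"
     "(\<lambda>n. nrm (sf_diff (X n) F)) \<longlonglongrightarrow> 0" "(\<lambda>n. nrm (sf_diff (Y n) G)) \<longlonglongrightarrow> 0" using assms(1) by (rule JacE) blast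
  obtain X' Y' where J': "F' \<in> SC.H" "G' \<in> SC.H" "\<And>n. jac (X' n) (Y' n)" "\<And>n. X' n \<in> SC.H" "\<And>n. Y' n \<in> SC.H"
     "(\<lambda>n. nrm (sf_diff (X' n) F')) \<longlonglongrightarrow> 0" "(\<lambda>n. nrm (sf_diff (Y' n) G')) \<longlonglongrightarrow> 0" using assms(2) by (rule JacE) blast
  have lim: "(\<lambda>n. nrm (sf_diff (sf_lincomb x (U n) y (U' n)) (sf_lincomb x K y K'))) \<longlonglongrightarrow> 0"
    if U: "\<And>n. U n \<in> SC.H" "\<And>n. U' n \<in> SC.H" "K \<in> SC.H" "K' \<in> SC.H" 
      and l: "(\<lambda>n. nrm (sf_diff (U n) K)) \<longlonglongrightarrow> 0" "(\<lambda>n. nrm (sf_diff (U' n) K')) \<longlonglongrightarrow> 0" for U U' K K'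
  proof (rule Lim_null_comparison, rule always_eventually, rule allI)
    fix n
    have e: "sf_diff (sf_lincomb x (U n) y (U' n)) (sf_lincomb x K y K') = sf_lincomb x (sf_diff (U n) K) y (sf_diff (U' n) K')"
      by (simp add: sf_diff_def sf_lincomb_def algebra_simps)
    show "norm (nrm (sf_diff (sf_lincomb x (U n) y (U' n)) (sf_lincomb x K y K'))) \<le> \<bar>x\<bar> * nrm (sf_diff (U n) K) + \<bar>y\<bar> * nrm (sf_diff (U' n) K')"
      unfolding e using SC.HH.nrm_lincomb_le[of "sf_diff (U n) K" "sf_diff (U' n) K'" x y] U
        SC.HH.nrm_nonneg[of "sf_lincomb x (sf_diff (U n) K) y (sf_diff (U' n) K')"]
      by (simp add: SC.HH.diff SC.HH.lincomb)
  next
    have "(\<lambda>n. \<bar>x\<bar> * nrm (sf_diff (U n) K) + \<bar>y\<bar> * nrm (sf_diff (U' n) K')) \<longlonglongrightarrow> \<bar>x\<bar> * 0 + \<bar>y\<bar> * 0"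
      by (intro tendsto_intros l)
    then show "(\<lambda>n. \<bar>x\<bar> * nrm (sf_diff (U n) K) + \<bar>y\<bar> * nrm (sf_diff (U' n) K')) \<longlonglongrightarrow> 0" by simp
  qed
  show ?thesis unfolding Jac_def
  proof (intro conjI exI allI)
    show "sf_lincomb x F y F' \<in> SC.H" "sf_lincomb x G y G' \<in> SC.H" using J J' by (auto intro: SC.H_lincomb)
    show "jac (sf_lincomb x (X n) y (X' n)) (sf_lincomb x (Y n) y (Y' n))" for n using J(3) J'(3) by (rule jac_lincomb)
    show "(\<lambda>n. nrm (sf_diff (sf_lincomb x (X n) y (X' n)) (sf_lincomb x F y F'))) \<longlonglongrightarrow> 0" using J J' by (intro lim)
    show "(\<lambda>n. nrm (sf_diff (sf_lincomb x (Y n) y (Y' n)) (sf_lincomb x G y G'))) \<longlonglongrightarrow> 0" using J J' by (intro lim)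
  qed
qed

text \<open>By linearity the norm bound applies to differences. The relation is therefore
  single-valued modulo null vectors and Lipschitz continuous.\<close>

lemma Jac_diff_bound:
  assumes "Jac F G" "Jac F' G'"
  shows "nrm (sf_diff G G') \<le> 2 * nrm (sf_diff F F')"
  unfolding sf_diff_lincomb by (rule Jac_bound[OF Jac_lincomb[OF assms]])

text \<open>The images of an approximating sequence are Cauchy by the norm bound, and completeness
  provides their limit.\<close>

lemma Jac_total:
  assumes F: "F \<in> SC.H"
  shows "\<exists>G. Jac F G"
proof -
  obtain X where X: "\<And>n. X n \<in> gen_span" "(\<lambda>n. nrm (sf_diff (X n) F)) \<longlonglongrightarrow> 0" using SC.H_approx[OF F] by blast
  have "\<exists>Y. jac (X n) Y" for n using X(1)[of n] by (auto simp: gen_span_def jac_def)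
  then obtain Y where Y: "\<And>n. jac (X n) (Y n)" by metis
  have XH: "X n \<in> SC.H" for n using X(1) SC.S_subset_H by blast
  have "\<exists>N. \<forall>m\<ge>N. \<forall>n\<ge>N. nrm (sf_diff (Y m) (Y n)) < e" if e: "e > 0" for e
  proof -
    obtain N where N: "\<And>n. n \<ge> N \<Longrightarrow> nrm (sf_diff (X n) F) < e / 4"
      using order_tendstoD(2)[OF X(2), of "e / 4"] e unfolding eventually_sequentially by auto
    have "nrm (sf_diff (Y m) (Y n)) < e" if "m \<ge> N" "n \<ge> N" for m n
    proof -
      have "nrm (sf_diff (Y m) (Y n)) \<le> 2 * nrm (sf_diff (X m) (X n))" by (intro Jac_diff_bound jac_imp_Jac Y)
      moreover have "nrm (sf_diff (X m) (X n)) \<le> nrm (sf_diff (X m) F) + nrm (sf_diff F (X n))"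
        by (intro SC.HH.nrm_diff_triangle XH F)
      moreover have "nrm (sf_diff F (X n)) = nrm (sf_diff (X n) F)" by (rule SC.HH.nrm_diff_commute[OF F XH])
      ultimately show ?thesis using N[OF that(1)] N[OF that(2)] by simp
    qed
    then show ?thesis by blast
  qed
  from SC.S_complete[OF jac_in_span(2)[OF Y] this] obtain G where "G \<in> SC.H" "(\<lambda>n. nrm (sf_diff (Y n) G)) \<longlonglongrightarrow> 0" by blast
  then show ?thesis unfolding Jac_def using F X(2) Y by blast
qed

text \<open>The counterpart of the indicator of the i-th interval times x^k, including the part at
  U_0 that \<open>\<psi>_sf\<close> lacks. On these elements the operator raises k by 1.\<close>

definition chi :: "nat \<Rightarrow> nat \<Rightarrow> 'w setfun" where
  "chi k i = (\<lambda>s t \<omega>. \<Sum>m\<in>{..k}. ballot k m * gn m i s t \<omega>)"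

lemma jac_chi: "jac (chi k i) (chi (Suc k) i)"
proof -
  have "jac (\<lambda>s t \<omega>. \<Sum>m\<in>{..k}. ballot k m * gn m i s t \<omega>) (\<lambda>s t \<omega>. \<Sum>m\<in>{..k}. ballot k m * jgen m i s t \<omega>)"
    by (intro jac_sum jac_gen) simp
  moreover have "(\<Sum>m\<in>{..k}. ballot k m * jgen m i s t \<omega>) = (\<Sum>m\<in>{..Suc k}. ballot (Suc k) m * gn m i s t \<omega>)" for s t \<omega>
    unfolding jgen_def by (rule sum_ballot_Suc)
  ultimately show ?thesis by (simp only: chi_def)
qed

lemma psi_eq_chi: "\<psi>_sf B a b k i = sf_lincomb 1 (chi k i) (- \<beta> k) (gn 0 i)"
proof -
  have "{..k} = insert 0 {1..k}" by auto
  then show ?thesis by (simp add: sf_lincomb_def chi_def psi_expand \<beta>_ballot fun_eq_iff)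
qed

lemma psi_1: "\<psi>_sf B a b 1 i = gn 1 i"
  by (simp add: psi_expand_fun ballot_self)

text \<open>In terms of polynomials: x (x^k - \<beta> k) = (x^(k+1) - \<beta> (k+1)) + \<beta> (k+1)
  - \<beta> k x, and x corresponds to \<open>\<psi>_sf\<close> of order 1. This is where the three
  terms of the rule for W come from.\<close>

lemma jac_psi:
  "jac (\<psi>_sf B a b k i) (\<lambda>s t \<omega>. \<beta> (k + 1) * ind_sf a b i s t \<omega> + \<psi>_sf B a b (k + 1) i s t \<omega> - \<beta> k * \<psi>_sf B a b 1 i s t \<omega>)"
proof -
  have "jac (sf_lincomb 1 (chi k i) (- \<beta> k) (gn 0 i)) (sf_lincomb 1 (chi (Suc k) i) (- \<beta> k) (jgen 0 i))"
    by (intro jac_lincomb jac_chi jac_gen)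
  moreover have "sf_lincomb 1 (chi (Suc k) i) (- \<beta> k) (jgen 0 i) = 
    (\<lambda>s t \<omega>. \<beta> (k + 1) * ind_sf a b i s t \<omega> + \<psi>_sf B a b (k + 1) i s t \<omega> - \<beta> k * \<psi>_sf B a b 1 i s t \<omega>)"
    unfolding psi_eq_chi[of "k + 1"] psi_1 by (simp add: sf_lincomb_def jgen_def gen_def)
  ultimately show ?thesis unfolding psi_eq_chi[of k] by simp
qed

lemma jac_ind: "jac (ind_sf a b i) (\<psi>_sf B a b 1 i)"
  using jac_gen[of 0 i] unfolding psi_1 by (simp add: jgen_def gen_def)

text \<open>On the generators the rule prescribes a \<open>jac\<close> image; linearity carries this
  to the span, and the approximation clause of \<open>is_W\<close> to the closed span. Boundedness
  and symmetry of W are thereby inherited from the closed relation.\<close>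

lemma is_W_Jac:
  assumes W: "is_W M B a b W" and F: "F \<in> SC.H"
  shows "Jac F (W F)"
proof -
  have WH: "W F \<in> SC.H" if "F \<in> SC.H" for F using W that unfolding is_W_def sheet_space_eq by blast
  have Wlin: "nrm (sf_diff (W (sf_lincomb c F d G)) (sf_lincomb c (W F) d (W G))) = 0" if "F \<in> SC.H" "G \<in> SC.H" for F G c d
  proof -
    have "sf_equiv M (W (sf_lincomb c F d G)) (sf_lincomb c (W F) d (W G))"
      using W that unfolding is_W_def sheet_space_eq by blast
    then show ?thesis using SC.HH.sf_equiv_iff that by (simp add: WH SC.H_lincomb)
  qed
  have gen: "\<exists>G. jac F G \<and> nrm (sf_diff G (W F)) = 0" if "jac F G" "sf_equiv M (W F) G" for F G
  proof -
    have H: "F \<in> SC.H" "G \<in> SC.H" using jac_in_span[OF that(1)] SC.S_subset_H by auto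
    then have "nrm (sf_diff (W F) G) = 0" using SC.HH.sf_equiv_iff[OF WH[OF H(1)] H(2)] that(2) by simp
    then show ?thesis using that(1) SC.HH.nrm_diff_commute[OF WH[OF H(1)] H(2)] by auto
  qed
  have span: "\<exists>G. jac F G \<and> nrm (sf_diff G (W F)) = 0" if "F \<in> sheet_span B a b" for F
  proof -
    \<comment> \<open>W is prescribed only modulo identification, so the property carried through
      the span is that some \<open>jac\<close> image lies at distance 0 from the value of W.\<close>
    have "F \<in> {F. \<exists>G. jac F G \<and> nrm (sf_diff G (W F)) = 0}"
      using that unfolding sheet_span_def
    proof (rule sf_span_minimal)
      have lin: "sf_lincomb x F y F' \<in> {F. \<exists>G. jac F G \<and> nrm (sf_diff G (W F)) = 0}"
        if J: "jac F G" "nrm (sf_diff G (W F)) = 0" "jac F' G'" "nrm (sf_diff G' (W F')) = 0" for F F' G G' x y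
      proof -
        have H: "F \<in> SC.H" "G \<in> SC.H" "F' \<in> SC.H" "G' \<in> SC.H"
          using jac_in_span[OF J(1)] jac_in_span[OF J(3)] SC.S_subset_H by auto
        note HW = H WH[OF H(1)] WH[OF H(3)] WH[OF SC.H_lincomb[OF H(1,3)]]
        have e: "sf_diff (sf_lincomb x G y G') (sf_lincomb x (W F) y (W F')) = sf_lincomb x (sf_diff G (W F)) y (sf_diff G' (W F'))"
          by (simp add: sf_diff_def sf_lincomb_def algebra_simps)
        have "nrm (sf_diff (sf_lincomb x G y G') (W (sf_lincomb x F y F'))) \<le>
          nrm (sf_diff (sf_lincomb x G y G') (sf_lincomb x (W F) y (W F'))) + nrm (sf_diff (sf_lincomb x (W F) y (W F')) (W (sf_lincomb x F y F')))"
          using HW by (intro SC.HH.nrm_diff_triangle SC.H_lincomb)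
        also have "nrm (sf_diff (sf_lincomb x (W F) y (W F')) (W (sf_lincomb x F y F'))) = 0"
          using Wlin[OF H(1,3), of x y] SC.HH.nrm_diff_commute[of "sf_lincomb x (W F) y (W F')" "W (sf_lincomb x F y F')"] HW
          by (simp add: SC.H_lincomb)
        also have "nrm (sf_diff (sf_lincomb x G y G') (sf_lincomb x (W F) y (W F'))) \<le> \<bar>x\<bar> * nrm (sf_diff G (W F)) + \<bar>y\<bar> * nrm (sf_diff G' (W F'))"
          unfolding e using HW by (intro SC.HH.nrm_lincomb_le SC.HH.diff)
        finally have "nrm (sf_diff (sf_lincomb x G y G') (W (sf_lincomb x F y F'))) \<le> 0" using J(2,4) by simp
        moreover have "0 \<le> nrm (sf_diff (sf_lincomb x G y G') (W (sf_lincomb x F y F')))"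
          using HW by (intro SC.HH.nrm_nonneg SC.HH.diff SC.H_lincomb)
        ultimately show ?thesis using jac_lincomb[OF J(1,3)] by auto
      qed
      show "sf_lincomb x F y F' \<in> {F. \<exists>G. jac F G \<and> nrm (sf_diff G (W F)) = 0}"
        if "F \<in> {F. \<exists>G. jac F G \<and> nrm (sf_diff G (W F)) = 0}" "F' \<in> {F. \<exists>G. jac F G \<and> nrm (sf_diff G (W F)) = 0}" for F F' x y
        using that lin by blast
      have ind: "\<exists>G. jac (ind_sf a b i) G \<and> nrm (sf_diff G (W (ind_sf a b i))) = 0" for i
        using W by (intro gen[OF jac_ind]) (auto simp: is_W_def)
      show "F \<in> {F. \<exists>G. jac F G \<and> nrm (sf_diff G (W F)) = 0}" if "F \<in> range (ind_sf a b) \<union> {\<psi>_sf B a b k i |k i. 1 \<le> k}" for F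
      proof -
        have "\<exists>G. jac (\<psi>_sf B a b k i) G \<and> nrm (sf_diff G (W (\<psi>_sf B a b k i))) = 0" if "k \<ge> 1" for k i
          using W that unfolding is_W_def by (intro gen[OF jac_psi]) blast
        then show ?thesis using that ind by auto
      qed
      obtain G where "jac (ind_sf a b 0) G" "nrm (sf_diff G (W (ind_sf a b 0))) = 0" using ind by blast
      from lin[OF this this, of 0 0] show "(\<lambda>s t \<omega>. 0) \<in> {F. \<exists>G. jac F G \<and> nrm (sf_diff G (W F)) = 0}"
        by (simp add: sf_lincomb_def)
    qed
    then show ?thesis by simp
  qed
  obtain X where X: "\<And>n. X n \<in> sheet_span B a b" "sf_tendsto M X F" "sf_tendsto M (\<lambda>n. W (X n)) (W F)"
    using W F unfolding is_W_def sheet_space_eq by meson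
  have XH: "X n \<in> SC.H" for n using X(1)[of n] SC.S_subset_H by (simp add: sheet_span_eq)
  have lim: "(\<lambda>n. nrm (sf_diff (X n) F)) \<longlonglongrightarrow> 0" "(\<lambda>n. nrm (sf_diff (W (X n)) (W F))) \<longlonglongrightarrow> 0"
    using SC.HH.sf_tendsto_iff[of X F] SC.HH.sf_tendsto_iff[of "\<lambda>n. W (X n)" "W F"] X XH WH F by auto
  obtain Y where Y: "\<And>n. jac (X n) (Y n)" "\<And>n. nrm (sf_diff (Y n) (W (X n))) = 0" using span[OF X(1)] by metis
  have YH: "Y n \<in> SC.H" for n using jac_in_span(2)[OF Y(1)] SC.S_subset_H by blast
  have "(\<lambda>n. nrm (sf_diff (Y n) (W F))) \<longlonglongrightarrow> 0"
  proof (rule Lim_null_comparison[OF _ lim(2)], rule always_eventually, rule allI)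
    fix n show "norm (nrm (sf_diff (Y n) (W F))) \<le> nrm (sf_diff (W (X n)) (W F))"
      using SC.HH.nrm_diff_triangle[OF YH[of n] WH[OF XH[of n]] WH[OF F]] Y(2)[of n] SC.HH.nrm_nonneg[OF SC.HH.diff[OF YH[of n] WH[OF F]]]
      by simp
  qed
  then show ?thesis unfolding Jac_def using F WH Y(1) lim(1) by blast
qed

text \<open>Every selection from the closed relation satisfies the specification: single-valuedness
  modulo null vectors gives the equations, and the Lipschitz bound gives the approximation clause.
  Existence of W follows by choice.\<close>

lemma Jac_is_W:
  assumes J: "\<And>F. F \<in> SC.H \<Longrightarrow> Jac F (W F)"
  shows "is_W M B a b W"
proof -
  have WH: "W F \<in> SC.H" if "F \<in> SC.H" for F using J[OF that] by (simp add: Jac_def)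
  have uniq: "sf_equiv M (W F) G" if "Jac F' G" "nrm (sf_diff F F') = 0" "F \<in> SC.H" for F F' G
  proof -
    have "nrm (sf_diff (W F) G) \<le> 0" using Jac_diff_bound[OF J[OF that(3)] that(1)] that(2) by simp
    moreover have GH: "G \<in> SC.H" using that by (simp add: Jac_def)
    ultimately have "nrm (sf_diff (W F) G) = 0" using SC.HH.nrm_nonneg[OF SC.HH.diff[OF WH[OF that(3)] GH]] by simp
    then show ?thesis using SC.HH.sf_equiv_iff[OF WH[OF that(3)] GH] by simp
  qed
  show ?thesis unfolding is_W_def sheet_space_eq
  proof (intro conjI ballI allI impI)
    show "W F \<in> SC.H" if "F \<in> SC.H" for F using that by (rule WH)
    show "sf_equiv M (W F) (W G)" if "F \<in> SC.H" "G \<in> SC.H" "sf_equiv M F G" for F G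
      using that SC.HH.sf_equiv_iff[OF that(1,2)] by (intro uniq[OF J[OF that(2)]]) auto
    show "sf_equiv M (W (sf_lincomb c F d G)) (sf_lincomb c (W F) d (W G))" if "F \<in> SC.H" "G \<in> SC.H" for F G c d
      by (intro uniq[OF Jac_lincomb[OF J[OF that(1)] J[OF that(2)]]] SC.HH.nrm_diff_self SC.H_lincomb that)
    have j: "sf_equiv M (W F) G" if "jac F G" for F G
      using jac_in_span(1)[OF that] SC.S_subset_H by (intro uniq[OF jac_imp_Jac[OF that]] SC.HH.nrm_diff_self) auto
    show "sf_equiv M (W (ind_sf a b i)) (\<psi>_sf B a b 1 i)" for i by (rule j[OF jac_ind])
    show "sf_equiv M (W (\<psi>_sf B a b k i)) (\<lambda>s t \<omega>. \<beta> (k + 1) * ind_sf a b i s t \<omega> + \<psi>_sf B a b (k + 1) i s t \<omega> - \<beta> k * \<psi>_sf B a b 1 i s t \<omega>)" for k i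
      by (rule j[OF jac_psi])
    fix F assume F: "F \<in> SC.H"
    obtain X where X: "\<And>n. X n \<in> gen_span" "(\<lambda>n. nrm (sf_diff (X n) F)) \<longlonglongrightarrow> 0" using SC.H_approx[OF F] by blast
    have XH: "X n \<in> SC.H" for n using X(1) SC.S_subset_H by blast
    have "(\<lambda>n. nrm (sf_diff (W (X n)) (W F))) \<longlonglongrightarrow> 0"
    proof (rule Lim_null_comparison, rule always_eventually, rule allI)
      fix n show "norm (nrm (sf_diff (W (X n)) (W F))) \<le> 2 * nrm (sf_diff (X n) F)"
        using Jac_diff_bound[OF J[OF XH[of n]] J[OF F]] SC.HH.nrm_nonneg[OF SC.HH.diff[OF WH[OF XH[of n]] WH[OF F]]] by simp
    next
      show "(\<lambda>n. 2 * nrm (sf_diff (X n) F)) \<longlonglongrightarrow> 0" using tendsto_mult_right_zero[OF X(2)] .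
    qed
    then show "\<exists>X. (\<forall>n. X n \<in> sheet_span B a b) \<and> sf_tendsto M X F \<and> sf_tendsto M (\<lambda>n. W (X n)) (W F)"
      using X XH WH F SC.HH.sf_tendsto_iff[of X F] SC.HH.sf_tendsto_iff[of "\<lambda>n. W (X n)" "W F"] unfolding sheet_span_eq by blast
  qed
qed

lemma ex_is_W: "\<exists>W. is_W M B a b W"
proof -
  have "\<forall>F. \<exists>G. F \<in> SC.H \<longrightarrow> Jac F G" using Jac_total by blast
  then obtain W where "\<And>F. F \<in> SC.H \<Longrightarrow> Jac F (W F)" by metis
  then show ?thesis using Jac_is_W by blast
qed

end

section \<open>Functions and their moments\<close>

lemma integral_square_triangle:
  fixes f g :: "real \<Rightarrow> real"
  assumes "f \<in> borel_measurable N" "g \<in> borel_measurable N" "integrable N (\<lambda>x. (f x)\<^sup>2)" "integrable N (\<lambda>x. (g x)\<^sup>2)"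
  shows "integrable N (\<lambda>x. (f x + g x)\<^sup>2)"
    and "(LINT x|N. (f x + g x)\<^sup>2) \<le> 2 * (LINT x|N. (f x)\<^sup>2) + 2 * (LINT x|N. (g x)\<^sup>2)"
proof -
  have le: "(y + z)\<^sup>2 \<le> 2 * y\<^sup>2 + 2 * z\<^sup>2" for y z :: real
    using sum_squares_bound[of y z] by (simp add: power2_sum)
  have s: "integrable N (\<lambda>x. 2 * (f x)\<^sup>2 + 2 * (g x)\<^sup>2)" using assms by auto
  show i: "integrable N (\<lambda>x. (f x + g x)\<^sup>2)"
  proof (rule Bochner_Integration.integrable_bound[OF s])
    show "(\<lambda>x. (f x + g x)\<^sup>2) \<in> borel_measurable N" using assms(1,2) by measurable
    show "AE x in N. norm ((f x + g x)\<^sup>2) \<le> norm (2 * (f x)\<^sup>2 + 2 * (g x)\<^sup>2)"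
      using le by (intro AE_I2) simp
  qed
  have "(LINT x|N. (f x + g x)\<^sup>2) \<le> (LINT x|N. 2 * (f x)\<^sup>2 + 2 * (g x)\<^sup>2)"
    using i s le by (intro integral_mono) auto
  then show "(LINT x|N. (f x + g x)\<^sup>2) \<le> 2 * (LINT x|N. (f x)\<^sup>2) + 2 * (LINT x|N. (g x)\<^sup>2)"
    using assms by simp
qed

section \<open>Density of step functions over rational intervals\<close>

context sheets
begin

definition approximable :: "(real \<Rightarrow> real) \<Rightarrow> bool" where
  "approximable g \<longleftrightarrow> g \<in> borel_measurable lebesgue \<and> integrable lebesgue (\<lambda>x. (g x)\<^sup>2) \<and>
     (\<forall>e>0. \<exists>N u. (LINT x|lebesgue. (stepf N u x - g x)\<^sup>2) < e)"

lemma square_integrable_diff: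
  fixes f g :: "real \<Rightarrow> real"
  assumes "f \<in> borel_measurable lebesgue" "g \<in> borel_measurable lebesgue" 
    "integrable lebesgue (\<lambda>x. (f x)\<^sup>2)" "integrable lebesgue (\<lambda>x. (g x)\<^sup>2)"
  shows "integrable lebesgue (\<lambda>x. (f x - g x)\<^sup>2)"
  using integral_square_triangle(1)[of f lebesgue "\<lambda>x. - g x"] assms by simp

lemma approximable_limit:
  assumes g: "g \<in> borel_measurable lebesgue" "integrable lebesgue (\<lambda>x. (g x)\<^sup>2)"
    and h: "\<And>n. approximable (h n)" and lim: "(\<lambda>n. LINT x|lebesgue. (h n x - g x)\<^sup>2) \<longlonglongrightarrow> 0"
  shows "approximable g"
  unfolding approximable_def
proof (intro conjI allI impI g)
  fix e :: real assume e: "e > 0"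
  obtain n where n: "(LINT x|lebesgue. (h n x - g x)\<^sup>2) < e / 4"
    using order_tendstoD(2)[OF lim, of "e / 4"] e unfolding eventually_sequentially by auto
  have hn: "h n \<in> borel_measurable lebesgue" "integrable lebesgue (\<lambda>x. (h n x)\<^sup>2)" using h[of n] by (auto simp: approximable_def)
  obtain N u where u: "(LINT x|lebesgue. (stepf N u x - h n x)\<^sup>2) < e / 4"
    using h[of n] e unfolding approximable_def by (meson zero_less_divide_iff zero_less_numeral)
  have "(LINT x|lebesgue. ((stepf N u x - h n x) + (h n x - g x))\<^sup>2) \<le>
    2 * (LINT x|lebesgue. (stepf N u x - h n x)\<^sup>2) + 2 * (LINT x|lebesgue. (h n x - g x)\<^sup>2)"
    using stepf_measurable hn g stepf_square_integrable
    by (intro integral_square_triangle(2) square_integrable_diff borel_measurable_diff)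
  also have "\<dots> < e" using n u by linarith
  finally show "\<exists>N u. (LINT x|lebesgue. (stepf N u x - g x)\<^sup>2) < e" by (intro exI[of _ N] exI[of _ u]) simp
qed

lemma ex_index:
  assumes "p \<in> \<rat>" "r \<in> \<rat>" "0 \<le> p" "p < r" "r \<le> 1"
  shows "\<exists>i. a i = p \<and> b i = r"
proof -
  have "(p, r) \<in> (\<lambda>i. (a i, b i)) ` UNIV" using bij_betw_imp_surj_on[OF enum] assms by auto
  then show ?thesis by auto
qed

lemma rational_step_is_stepf:
  assumes "n > 0"
  shows "\<exists>N u. \<forall>x. stepf N u x = (\<Sum>k<n. v k * indicator {real k / real n<..real (Suc k) / real n} x)"
proof -
  have "\<exists>i. a i = real k / real n \<and> b i = real (Suc k) / real n" if "k < n" for k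
    using that assms by (intro ex_index) (auto simp: divide_strict_right_mono)
  then obtain idx where idx: "\<And>k. k < n \<Longrightarrow> a (idx k) = real k / real n" "\<And>k. k < n \<Longrightarrow> b (idx k) = real (Suc k) / real n"
    by metis
  define N where "N = Suc (Max (idx ` {..<n}))"
  have lt: "idx k < N" if "k < n" for k
    unfolding N_def using that by (intro le_imp_less_Suc Max_ge) auto
  \<comment> \<open>The coefficient at i collects the values of all cells k whose interval has index
    i in the enumeration.\<close>
  have "stepf N (\<lambda>i. \<Sum>k<n. if idx k = i then v k else 0) x = (\<Sum>k<n. v k * indicator {real k / real n<..real (Suc k) / real n} x)" for x
  proof -
    have "stepf N (\<lambda>i. \<Sum>k<n. if idx k = i then v k else 0) x = (\<Sum>i<N. \<Sum>k<n. (if idx k = i then v k * indicator {a i<..b i} x else 0))"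
      unfolding stepf_def sum_distrib_right by (intro sum.cong refl) simp
    also have "\<dots> = (\<Sum>k<n. \<Sum>i<N. (if idx k = i then v k * indicator {a i<..b i} x else 0))" by (rule sum.swap)
    also have "\<dots> = (\<Sum>k<n. v k * indicator {real k / real n<..real (Suc k) / real n} x)"
      by (rule sum.cong[OF refl]) (simp add: lt idx)
    finally show ?thesis .
  qed
  then show ?thesis by blast
qed

text \<open>Uniform continuity on the unit interval: the step function takes on each of n equal
  cells the value of h at the right endpoint. All cells have rational endpoints and therefore occur
  in the enumeration.\<close>

lemma approximable_continuous:
  assumes h: "continuous_on UNIV (h :: real \<Rightarrow> real)"
  shows "approximable (\<lambda>x. indicator {0<..1} x * h x)"
proof -
  have "compact (h ` {0..1})" using h by (intro compact_continuous_image continuous_on_subset[OF h]) auto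
  then obtain C where C: "\<And>x. x \<in> {0..1} \<Longrightarrow> \<bar>h x\<bar> \<le> C" using compact_imp_bounded bounded_iff by (metis image_eqI real_norm_def)
  have hm: "h \<in> borel_measurable lebesgue"
    using h borel_measurable_continuous_onI measurable_completion by (metis measurable_lborel2)
  have meas: "(\<lambda>x. indicator {0<..1} x * h x) \<in> borel_measurable lebesgue"
    using hm by (intro borel_measurable_times borel_measurable_indicator) auto
  have C0: "0 \<le> C" using C[of 0] by simp
  have "integrable lebesgue (\<lambda>x::real. C\<^sup>2 * indicator {0<..1} x)"
    by (intro integrable_mult_right indicator_integrable)
  then have int: "integrable lebesgue (\<lambda>x. (indicator {0<..1} x * h x)\<^sup>2)"
  proof (rule Bochner_Integration.integrable_bound)
    show "(\<lambda>x. (indicator {0<..1} x * h x)\<^sup>2) \<in> borel_measurable lebesgue" using meas by measurable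
    have "\<bar>h x\<bar> \<le> \<bar>C\<bar>" if "0 < x" "x \<le> 1" for x using C[of x] C0 that by simp
    then show "AE x in lebesgue. norm ((indicator {0<..1} x * h x)\<^sup>2) \<le> norm (C\<^sup>2 * indicator {0<..1} x)"
      by (intro AE_I2) (auto simp: indicator_def abs_le_square_iff)
  qed
  show ?thesis unfolding approximable_def
  proof (intro conjI meas int allI impI)
    fix e :: real assume e: "e > 0"
    define d where "d = sqrt (e / 2)"
    have d: "d > 0" "d\<^sup>2 = e / 2" using e by (auto simp: d_def)
    have "uniformly_continuous_on {0..1} h"
      using h by (intro compact_uniformly_continuous continuous_on_subset[OF h]) auto
    then obtain \<delta> where \<delta>: "\<delta> > 0" "\<And>x y. x \<in> {0..1} \<Longrightarrow> y \<in> {0..1} \<Longrightarrow> dist y x < \<delta> \<Longrightarrow> dist (h y) (h x) < d"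
      unfolding uniformly_continuous_on_def using d(1) by metis
    obtain m :: nat where m: "1 / real (Suc m) < \<delta>" using \<delta>(1) nat_approx_posE by metis
    define n where "n = Suc m"
    have n: "n > 0" "1 / real n < \<delta>" using m by (auto simp: n_def)
    obtain N u where u: "\<And>x. stepf N u x = (\<Sum>k<n. h (real (Suc k) / real n) * indicator {real k / real n<..real (Suc k) / real n} x)"
      using rational_step_is_stepf[OF n(1), of "\<lambda>k. h (real (Suc k) / real n)"] by blast
    have pt: "(stepf N u x - indicator {0<..1} x * h x)\<^sup>2 \<le> d\<^sup>2 * indicator {0<..1} x" for x
    proof (cases "x \<in> {0<..1}")
      case False
      have "x \<notin> {real k / real n<..real (Suc k) / real n}" if "k < n" for k
      proof
        assume "x \<in> {real k / real n<..real (Suc k) / real n}"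
        then have "real k / real n < x" "x \<le> real (Suc k) / real n" by auto
        moreover have "0 \<le> real k / real n" "real (Suc k) / real n \<le> 1" using that by auto
        ultimately have "0 < x \<and> x \<le> 1" by linarith
        then show False using False by simp
      qed
      then have "stepf N u x = 0" unfolding u by (intro sum.neutral) auto
      then show ?thesis using False by simp
    next
      case True
      \<comment> \<open>The cells are open on the left and closed on the right, so the cell of x has
        index one below the ceiling of n x.\<close>
      define k where "k = nat (\<lceil>x * real n\<rceil> - 1)"
      have "x * real n > 0" using True n by simp
      then have ck: "real k < x * real n" "x * real n \<le> real (Suc k)"
        unfolding k_def by linarith+
      have "x * real n \<le> real n" using True by (simp add: mult_left_le_one_le)
      then have kn: "k < n" using ck by linarith
      have xk: "x \<in> {real k / real n<..real (Suc k) / real n}" using ck n by (auto simp: field_simps)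
      have "indicator {real l / real n<..real (Suc l) / real n} x = (if l = k then 1 else (0::real))" if "l < n" for l
      proof (cases "l = k")
        case False
        have "x \<notin> {real l / real n<..real (Suc l) / real n}"
        proof
          assume "x \<in> {real l / real n<..real (Suc l) / real n}"
          then have "real l < x * real n" "x * real n \<le> real (Suc l)" using n by (auto simp: field_simps)
          then show False using ck False by linarith
        qed
        then show ?thesis using False by simp
      qed (use xk in simp)
      then have "stepf N u x = (\<Sum>l<n. if l = k then h (real (Suc k) / real n) else 0)"
        unfolding u by (intro sum.cong refl) auto
      then have s: "stepf N u x = h (real (Suc k) / real n)" using kn by simp
      have "dist (real (Suc k) / real n) x < \<delta>"
      proof -
        have "real (Suc k) / real n - x < 1 / real n" using xk by (simp add: add_divide_distrib)
        then show ?thesis using xk n by (simp add: dist_real_def)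
      qed
      moreover have "real (Suc k) / real n \<in> {0..1}" using kn by auto
      ultimately have "dist (h (real (Suc k) / real n)) (h x) < d" using True by (intro \<delta>(2)) auto
      then have "(h (real (Suc k) / real n) - h x)\<^sup>2 \<le> d\<^sup>2" using d(1) by (intro power2_le_iff_abs_le[THEN iffD2]) (auto simp: dist_real_def)
      then show ?thesis using True s by simp
    qed
    have "(LINT x|lebesgue. (stepf N u x - indicator {0<..1} x * h x)\<^sup>2) \<le> (LINT x|lebesgue. d\<^sup>2 * indicator {0<..1} (x::real))"
      using pt by (intro integral_mono square_integrable_diff stepf_measurable meas stepf_square_integrable int) auto
    also have "\<dots> = d\<^sup>2" by simp
    also have "\<dots> < e" using e d by simp
    finally show "\<exists>N u. (LINT x|lebesgue. (stepf N u x - indicator {0<..1} x * h x)\<^sup>2) < e" by blast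
  qed
qed

text \<open>A measurable function is almost everywhere a limit of continuous ones. Clipping these at
  K keeps the convergence, since |g| is at most K, and provides a dominating function.\<close>

lemma approximable_bounded:
  assumes g: "g \<in> borel_measurable lebesgue" and bd: "\<And>x. \<bar>g x\<bar> \<le> K" and supp: "\<And>x. x \<notin> {0..1} \<Longrightarrow> g x = 0"
  shows "approximable g"
proof -
  have "g measurable_on UNIV" using g by (intro lebesgue_measurable_imp_measurable_on_real) auto
  then obtain Z h where Z: "negligible Z" and h: "\<And>n. continuous_on UNIV (h n)" 
    and lim: "\<And>x. x \<notin> Z \<Longrightarrow> (\<lambda>n. h n x) \<longlonglongrightarrow> g x"
    unfolding measurable_on_def by auto
  define c where "c n x = max (- K) (min K (h n x))" for n x
  have K: "K \<ge> 0" using bd[of 0] by linarith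
  have cb: "\<bar>c n x\<bar> \<le> K" for n x using K by (auto simp: c_def)
  have cc: "continuous_on UNIV (c n)" for n unfolding c_def[abs_def] by (intro continuous_intros h)
  let ?k = "\<lambda>n x. indicator {0<..1} x * c n x"
  have apx: "approximable (?k n)" for n by (rule approximable_continuous[OF cc])
  have km: "?k n \<in> borel_measurable lebesgue" for n using apx[of n] by (simp add: approximable_def)
  have dom: "integrable lebesgue (\<lambda>x. (2 * K)\<^sup>2 * indicator {0..1::real} x)"
    by (intro integrable_mult_right integrable_real_indicator) auto
  show ?thesis
  proof (rule approximable_limit[OF g _ apx])
    show "integrable lebesgue (\<lambda>x. (g x)\<^sup>2)"
    proof (rule Bochner_Integration.integrable_bound[OF dom])
      show "(\<lambda>x. (g x)\<^sup>2) \<in> borel_measurable lebesgue" using g by measurable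
      have "\<bar>g x\<bar> \<le> \<bar>2 * K\<bar>" for x using bd[of x] K by linarith
      then have "(g x)\<^sup>2 \<le> (2 * K)\<^sup>2" for x by (simp only: abs_le_square_iff)
      then show "AE x in lebesgue. norm ((g x)\<^sup>2) \<le> norm ((2 * K)\<^sup>2 * indicator {0..1} x)"
        using supp by (intro AE_I2) (auto simp: indicator_def)
    qed
    have "(\<lambda>n. LINT x|lebesgue. (?k n x - g x)\<^sup>2) \<longlonglongrightarrow> (LINT x|(lebesgue :: real measure). (0::real))"
    proof (rule integral_dominated_convergence[where w = "\<lambda>x. (2 * K)\<^sup>2 * indicator {0..1} x"])
      show "(\<lambda>x. (?k n x - g x)\<^sup>2) \<in> borel_measurable lebesgue" for n using km[of n] g by measurable
      \<comment> \<open>The point 0 joins the null set because the approximants vanish there: they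
        are supported on the half-open unit interval, while g may be nonzero at 0.\<close>
      have "AE x in lebesgue. x \<notin> Z \<union> {0}"
        using negligible_Un[OF Z negligible_sing[of 0]] by (intro AE_not_in) (simp add: negligible_iff_null_sets)
      then show "AE x in lebesgue. (\<lambda>n. (?k n x - g x)\<^sup>2) \<longlonglongrightarrow> 0"
      proof eventually_elim
        case (elim x)
        have "(\<lambda>n. ?k n x) \<longlonglongrightarrow> g x"
        proof (cases "x \<in> {0<..1}")
          case False
          then have "g x = 0" using elim supp[of x] by auto
          then show ?thesis using False by simp
        next
          case True
          have "(\<lambda>n. c n x) \<longlonglongrightarrow> max (- K) (min K (g x))"
            unfolding c_def by (intro tendsto_intros lim) (use elim in auto)
          moreover have "max (- K) (min K (g x)) = g x" using bd[of x] by (auto simp: abs_le_iff max_def min_def)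
          ultimately show ?thesis using True by simp
        qed
        then have "(\<lambda>n. (?k n x - g x)\<^sup>2) \<longlonglongrightarrow> (g x - g x)\<^sup>2" by (intro tendsto_intros)
        then show ?case by simp
      qed
      show "AE x in lebesgue. norm ((?k n x - g x)\<^sup>2) \<le> (2 * K)\<^sup>2 * indicator {0..1} x" for n
      proof (intro AE_I2)
        fix x :: real
        show "norm ((?k n x - g x)\<^sup>2) \<le> (2 * K)\<^sup>2 * indicator {0..1} x"
        proof (cases "x \<in> {0..1}")
          case True
          have "\<bar>?k n x\<bar> \<le> K" using cb[of n x] K by (auto simp: indicator_def)
          then have "\<bar>?k n x - g x\<bar> \<le> \<bar>2 * K\<bar>" using bd[of x] K by linarith
          then have "(?k n x - g x)\<^sup>2 \<le> (2 * K)\<^sup>2" by (simp only: abs_le_square_iff)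
          then show ?thesis using True by simp
        next
          case False
          then show ?thesis using supp[of x] by auto
        qed
      qed
    qed (use dom in auto)
    then show "(\<lambda>n. LINT x|lebesgue. (?k n x - g x)\<^sup>2) \<longlonglongrightarrow> 0" by simp
  qed
qed

text \<open>Truncation at the level n equals g from some n on at each point, and the squared error
  is dominated by g^2.\<close>

lemma approximable_square_integrable:
  assumes g: "g \<in> borel_measurable lebesgue" and int: "integrable lebesgue (\<lambda>x. (g x)\<^sup>2)" and supp: "\<And>x. x \<notin> {0..1} \<Longrightarrow> g x = 0"
  shows "approximable g"
proof (rule approximable_limit[OF g int])
  let ?h = "\<lambda>n x. max (- real n) (min (real n) (g x))"
  have hm: "?h n \<in> borel_measurable lebesgue" for n using g by measurable
  show "approximable (?h n)" for n
    by (rule approximable_bounded[OF hm, of n "real n"]) (auto simp: supp)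
  have "(\<lambda>n. LINT x|lebesgue. (?h n x - g x)\<^sup>2) \<longlonglongrightarrow> (LINT x|(lebesgue :: real measure). (0::real))"
  proof (rule integral_dominated_convergence[where w = "\<lambda>x. (g x)\<^sup>2"])
    show "(\<lambda>x. (?h n x - g x)\<^sup>2) \<in> borel_measurable lebesgue" for n using hm g by measurable
    show "AE x in lebesgue. (\<lambda>n. (?h n x - g x)\<^sup>2) \<longlonglongrightarrow> 0"
    proof (intro AE_I2)
      fix x
      obtain m :: nat where m: "\<bar>g x\<bar> \<le> real m" using real_arch_simple by blast
      have "\<forall>\<^sub>F n in sequentially. (?h n x - g x)\<^sup>2 = 0"
        using eventually_ge_at_top[of m]
      proof eventually_elim
        case (elim n)
        then have "\<bar>g x\<bar> \<le> real n" using m by linarith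
        then have "?h n x = g x" by (auto simp: max_def min_def abs_le_iff)
        then show ?case by simp
      qed
      then show "(\<lambda>n. (?h n x - g x)\<^sup>2) \<longlonglongrightarrow> 0" by (rule tendsto_eventually)
    qed
    show "AE x in lebesgue. norm ((?h n x - g x)\<^sup>2) \<le> (g x)\<^sup>2" for n
    proof (intro AE_I2)
      fix x
      have "\<bar>?h n x - g x\<bar> \<le> \<bar>g x\<bar>" by (auto simp: max_def min_def)
      then show "norm ((?h n x - g x)\<^sup>2) \<le> (g x)\<^sup>2" by (simp add: abs_le_square_iff)
    qed
  qed (use int in auto)
  then show "(\<lambda>n. LINT x|lebesgue. (?h n x - g x)\<^sup>2) \<longlonglongrightarrow> 0" by simp
qed

section \<open>Moments of the operator at functions of the first factor\<close>

definition chi_comb :: "nat \<Rightarrow> nat \<Rightarrow> (nat \<Rightarrow> real) \<Rightarrow> 'w setfun" where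
  "chi_comb l N u = (\<lambda>s t \<omega>. \<Sum>i\<in>{..<N}. u i * chi l i s t \<omega>)"

lemma chi_0: "chi 0 i = gn 0 i"
  by (simp add: chi_def ballot_self)

lemma jac_chi_comb: "jac (chi_comb l N u) (chi_comb (Suc l) N u)"
  unfolding chi_comb_def by (intro jac_sum jac_chi) simp

lemma chi_comb_in_H: "chi_comb l N u \<in> SC.H"
  using jac_in_span(1)[OF jac_chi_comb] SC.S_subset_H by blast

text \<open>Here \<open>chi_comb l N u\<close> stands for a step function times x^l. Against the
  layer of order 0 only the coefficient of x^l at U_0 survives, and that is the l-th moment.\<close>

lemma ip_chi_comb: "ip (chi_comb 0 N u) (chi_comb l N u) = \<beta> l * form N u u"
proof -
  have "has_inner M (gn 0 i) (chi l j) (\<lambda>_. \<Sum>m\<in>{..l}. ballot l m * (if 0 = m then ov i j else 0))" for i j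
    unfolding chi_def by (intro has_inner_sum_right has_inner_gen random_gen) simp
  moreover have "(\<Sum>m\<in>{..l}. ballot l m * (if 0 = m then ov i j else 0)) = \<beta> l * ov i j" for i j
  proof -
    have "(\<Sum>m\<in>{..l}. ballot l m * (if 0 = m then ov i j else 0)) = (\<Sum>m\<in>{..l}. if 0 = m then ballot l 0 * ov i j else 0)"
      by (intro sum.cong refl) auto
    then show ?thesis by (simp add: \<beta>_ballot)
  qed
  ultimately have 1: "has_inner M (gn 0 i) (chi l j) (\<lambda>_. \<beta> l * ov i j)" for i j by simp
  have "has_inner M (gn 0 i) (chi_comb l N u) (\<lambda>_. \<Sum>j\<in>{..<N}. u j * (\<beta> l * ov i j))" for i
    unfolding chi_comb_def by (intro has_inner_sum_right 1 random_gen) simp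
  then have "has_inner M (chi_comb 0 N u) (chi_comb l N u) (\<lambda>_. \<Sum>i\<in>{..<N}. u i * (\<Sum>j\<in>{..<N}. u j * (\<beta> l * ov i j)))"
    unfolding chi_comb_def[of 0] chi_0 using SC.HH.random[OF chi_comb_in_H[of l N u]] by (intro has_inner_sum_left) auto
  then have "ip (chi_comb 0 N u) (chi_comb l N u) = (\<Sum>i<N. u i * (\<Sum>j<N. u j * (\<beta> l * ov i j)))" by (rule const_ip_eqI)
  also have "\<dots> = \<beta> l * form N u u" by (simp add: form_def sum_distrib_left mult_ac)
  finally show ?thesis .
qed

lemma average_stepf:
  assumes "s < t"
  shows "chi_comb 0 N u s t \<omega> = average_sf (stepf N u) s t \<omega>"
  using assms set_integral_stepf[of s t N u]
  by (simp add: chi_comb_def chi_0 gen_0 average_sf_def sum_divide_distrib)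

text \<open>The set functions involved are deterministic, and by the contraction property their
  partition sums are bounded by the squared L^2 error for every partition and every sample point.
  The exceptional events are therefore empty for large n.\<close>

lemma average_approximation:
  assumes g: "g \<in> borel_measurable lebesgue" "integrable lebesgue (\<lambda>x. (g x)\<^sup>2)" and supp: "\<And>x. x \<notin> {0..1} \<Longrightarrow> g x = 0"
    and fg: "\<And>x. x \<in> {0..1} \<Longrightarrow> f x = g x"
  obtains N u where "average_sf f \<in> SC.H" "(\<lambda>n. nrm (sf_diff (chi_comb 0 (N n) (u n)) (average_sf f))) \<longlonglongrightarrow> 0"
    "(\<lambda>n. LINT x|lebesgue. (stepf (N n) (u n) x - g x)\<^sup>2) \<longlonglongrightarrow> 0"
proof -
  have "approximable g" by (rule approximable_square_integrable[OF g supp])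
  then have "\<exists>N u. (LINT x|lebesgue. (stepf N u x - g x)\<^sup>2) < inverse (real (Suc n))" for n
    unfolding approximable_def by simp
  then obtain N u where Nu: "\<And>n. (LINT x|lebesgue. (stepf (N n) (u n) x - g x)\<^sup>2) < inverse (real (Suc n))" by metis
  have lim: "(\<lambda>n. LINT x|lebesgue. (stepf (N n) (u n) x - g x)\<^sup>2) \<longlonglongrightarrow> 0"
  proof (rule Lim_null_comparison[OF _ LIMSEQ_inverse_real_of_nat], rule always_eventually, rule allI)
    fix n
    have "0 \<le> (LINT x|lebesgue. (stepf (N n) (u n) x - g x)\<^sup>2)" by (intro integral_nonneg_AE) auto
    then show "norm (LINT x|lebesgue. (stepf (N n) (u n) x - g x)\<^sup>2) \<le> inverse (real (Suc n))" using Nu[of n] by simp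
  qed
  have r: "random_setfun M (average_sf f)" by (simp add: random_setfun_def average_sf_def)
  let ?X = "\<lambda>n. chi_comb 0 (N n) (u n)"
  have X: "?X n \<in> gen_span" for n using jac_in_span(1)[OF jac_chi_comb] .
  have bound: "partition_sum (sf_diff (?X n) (average_sf f)) (sf_diff (?X n) (average_sf f)) ts \<omega>
    \<le> (LINT x|lebesgue. (stepf (N n) (u n) x - g x)\<^sup>2)" if ts: "is_partition ts" for n ts \<omega>
  proof -
    let ?d = "\<lambda>x. stepf (N n) (u n) x - g x"
    have "partition_sum (sf_diff (?X n) (average_sf f)) (sf_diff (?X n) (average_sf f)) ts \<omega> =
      (\<Sum>j<length ts - 1. (LINT x:{ts ! j<..ts ! Suc j}|lebesgue. ?d x)\<^sup>2 / (ts ! Suc j - ts ! j))"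
      unfolding partition_sum_def
    proof (rule sum.cong[OF refl])
      fix j assume "j \<in> {..<length ts - 1}"
      then have j: "0 \<le> ts ! j" "ts ! j < ts ! Suc j" "ts ! Suc j \<le> 1" using partition_interval[OF ts] by auto
      let ?J = "{ts ! j<..ts ! Suc j}"
      have "(LINT x:?J|lebesgue. f x) = (LINT x:?J|lebesgue. g x)"
        unfolding set_lebesgue_integral_def using j fg by (intro Bochner_Integration.integral_cong) (auto simp: indicator_def)
      moreover have "(LINT x:?J|lebesgue. ?d x) = (LINT x:?J|lebesgue. stepf (N n) (u n) x) - (LINT x:?J|lebesgue. g x)"
        by (intro set_integral_diff square_integrable_imp_set_integrable g stepf_measurable stepf_square_integrable)
      ultimately have "sf_diff (?X n) (average_sf f) (ts ! j) (ts ! Suc j) \<omega> = (LINT x:?J|lebesgue. ?d x) / (ts ! Suc j - ts ! j)"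
        by (simp add: sf_diff_def average_stepf[OF j(2)] average_sf_def diff_divide_distrib)
      then show "sf_diff (?X n) (average_sf f) (ts ! j) (ts ! Suc j) \<omega> * sf_diff (?X n) (average_sf f) (ts ! j) (ts ! Suc j) \<omega> * (ts ! Suc j - ts ! j)
        = (LINT x:?J|lebesgue. ?d x)\<^sup>2 / (ts ! Suc j - ts ! j)" using j(2) by (simp add: power2_eq_square)
    qed
    also have "\<dots> \<le> (LINT x|lebesgue. (?d x)\<^sup>2)"
      by (intro sum_average_squares_le borel_measurable_diff square_integrable_diff stepf_measurable stepf_square_integrable g ts)
    finally show ?thesis .
  qed
  have conv: "prob_conv M ?X (average_sf f)"
    unfolding prob_conv_def
  proof (intro allI impI)
    fix \<delta> \<eta> :: real assume d: "\<delta> > 0" and e: "\<eta> > 0"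
    obtain K where K: "\<And>n. n \<ge> K \<Longrightarrow> (LINT x|lebesgue. (stepf (N n) (u n) x - g x)\<^sup>2) < \<delta>"
      using order_tendstoD(2)[OF lim d] unfolding eventually_sequentially by auto
    show "\<exists>K. \<forall>n\<ge>K. \<forall>\<^sub>F ts in partition_filter. prob {\<omega> \<in> space M. 
      \<delta> < partition_sum (sf_diff (?X n) (average_sf f)) (sf_diff (?X n) (average_sf f)) ts \<omega>} < \<eta>"
    proof (intro exI[of _ K] allI impI eventually_mono[OF eventually_is_partition])
      fix n ts assume n: "n \<ge> K" and ts: "is_partition ts"
      have "\<not> \<delta> < partition_sum (sf_diff (?X n) (average_sf f)) (sf_diff (?X n) (average_sf f)) ts \<omega>" for \<omega>
        using bound[OF ts, of n \<omega>] K[OF n] by linarith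
      then have "{\<omega> \<in> space M. \<delta> < partition_sum (sf_diff (?X n) (average_sf f)) (sf_diff (?X n) (average_sf f)) ts \<omega>} = {}" by blast
      then show "prob {\<omega> \<in> space M. \<delta> < partition_sum (sf_diff (?X n) (average_sf f)) (sf_diff (?X n) (average_sf f)) ts \<omega>} < \<eta>"
        using e by (simp only: measure_empty)
    qed
  qed
  have H: "average_sf f \<in> SC.H" using X r conv by (rule SC.prob_conv_in_H)
  moreover have "(\<lambda>n. nrm (sf_diff (?X n) (average_sf f))) \<longlonglongrightarrow> 0"
    using SC.prob_conv_imp_H[OF X r conv] SC.HH.sf_tendsto_iff[of ?X "average_sf f"] chi_comb_in_H H by blast
  ultimately show ?thesis using that lim by blast
qed

lemma power_diff_bound:
  assumes J: "\<And>F. F \<in> SC.H \<Longrightarrow> Jac F (W F)" and FG: "F \<in> SC.H" "G \<in> SC.H"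
  shows "(W ^^ l) F \<in> SC.H \<and> (W ^^ l) G \<in> SC.H \<and> nrm (sf_diff ((W ^^ l) F) ((W ^^ l) G)) \<le> 2 ^ l * nrm (sf_diff F G)"
proof (induction l)
  case 0
  then show ?case using FG by simp
next
  case (Suc l)
  let ?F = "(W ^^ l) F" and ?G = "(W ^^ l) G"
  have "Jac ?F (W ?F)" "Jac ?G (W ?G)" using Suc J by auto
  then have "W ?F \<in> SC.H" "W ?G \<in> SC.H" "nrm (sf_diff (W ?F) (W ?G)) \<le> 2 * nrm (sf_diff ?F ?G)"
    using Jac_diff_bound by (auto simp: Jac_def)
  then show ?case using Suc by (auto simp: mult.assoc)
qed

text \<open>Each application of W multiplies by x. Equality is at distance 0 only, because W is
  fixed modulo identification; the norm bound keeps this distance 0 under iteration.\<close>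

lemma power_chi_comb:
  assumes J: "\<And>F. F \<in> SC.H \<Longrightarrow> Jac F (W F)"
  shows "(W ^^ l) (chi_comb 0 N u) \<in> SC.H \<and> nrm (sf_diff ((W ^^ l) (chi_comb 0 N u)) (chi_comb l N u)) = 0"
proof (induction l)
  case 0
  then show ?case using chi_comb_in_H SC.HH.nrm_diff_self by simp
next
  case (Suc l)
  let ?F = "(W ^^ l) (chi_comb 0 N u)"
  have JF: "Jac ?F (W ?F)" using Suc J by auto
  then have WH: "W ?F \<in> SC.H" by (simp add: Jac_def)
  have "nrm (sf_diff (W ?F) (chi_comb (Suc l) N u)) \<le> 0"
    using Jac_diff_bound[OF JF jac_imp_Jac[OF jac_chi_comb[of l N u]]] Suc by simp
  then have "nrm (sf_diff (W ?F) (chi_comb (Suc l) N u)) = 0"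
    using SC.HH.nrm_nonneg[OF SC.HH.diff[OF WH chi_comb_in_H[of "Suc l" N u]]] by simp
  then show ?case using WH by simp
qed

lemma moment_chi_comb:
  assumes J: "\<And>F. F \<in> SC.H \<Longrightarrow> Jac F (W F)"
  shows "ip (chi_comb 0 N u) ((W ^^ l) (chi_comb 0 N u)) = \<beta> l * form N u u"
proof -
  let ?F = "chi_comb 0 N u" and ?G = "(W ^^ l) (chi_comb 0 N u)"
  have H: "?F \<in> SC.H" "?G \<in> SC.H" "chi_comb l N u \<in> SC.H" using chi_comb_in_H power_chi_comb[OF J] by auto
  have "\<bar>ip ?F (sf_diff ?G (chi_comb l N u))\<bar> \<le> nrm ?F * nrm (sf_diff ?G (chi_comb l N u))"
    using H by (intro SC.HH.ip_CS SC.HH.diff)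
  then have "ip ?F (sf_diff ?G (chi_comb l N u)) = 0" using power_chi_comb[OF J] by simp
  then show ?thesis using H by (simp add: SC.HH.ip_diff_right ip_chi_comb)
qed

text \<open>The moment identity is known for step functions and passes to the limit, as powers of W
  are Lipschitz and the inner product is continuous.\<close>

lemma moments_average:
  assumes J: "\<And>F. F \<in> SC.H \<Longrightarrow> Jac F (W F)"
    and g: "g \<in> borel_measurable lebesgue" "integrable lebesgue (\<lambda>x. (g x)\<^sup>2)" and supp: "\<And>x. x \<notin> {0..1} \<Longrightarrow> g x = 0"
    and fg: "\<And>x. x \<in> {0..1} \<Longrightarrow> f x = g x" and nz: "\<not> (AE x in lebesgue. g x = 0)"
  shows "average_sf f \<in> SC.H" "ip (average_sf f) (average_sf f) \<noteq> 0"
    "ip (average_sf f) ((W ^^ l) (average_sf f)) = \<beta> l * ip (average_sf f) (average_sf f)"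
proof -
  let ?F = "average_sf f"
  obtain N u where F: "?F \<in> SC.H" and X: "(\<lambda>n. nrm (sf_diff (chi_comb 0 (N n) (u n)) ?F)) \<longlonglongrightarrow> 0"
    and L2: "(\<lambda>n. LINT x|lebesgue. (stepf (N n) (u n) x - g x)\<^sup>2) \<longlonglongrightarrow> 0"
    using average_approximation[OF g supp fg] by blast
  let ?X = "\<lambda>n. chi_comb 0 (N n) (u n)"
  show "?F \<in> SC.H" by (rule F)
  have XH: "?X n \<in> SC.H" for n by (rule chi_comb_in_H)
  have ipX: "ip (?X n) (?X n) = form (N n) (u n) (u n)" for n using ip_chi_comb[of "N n" "u n" 0] by (simp add: \<beta>_0)
  have lim0: "(\<lambda>n. form (N n) (u n) (u n)) \<longlonglongrightarrow> ip ?F ?F"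
    using SC.HH.ip_continuous[OF XH F XH F X X] by (simp only: ipX)
  show "ip ?F ?F \<noteq> 0"
  proof
    assume z: "ip ?F ?F = 0"
    \<comment> \<open>If the norm were 0, the approximating step functions would tend to 0 in L^2 as
      well as to g, so g would vanish almost everywhere.\<close>
    have "(LINT x|lebesgue. (g x)\<^sup>2) \<le> 0"
    proof (rule LIMSEQ_le_const)
      show "(\<lambda>n. 2 * (LINT x|lebesgue. (stepf (N n) (u n) x - g x)\<^sup>2) + 2 * form (N n) (u n) (u n)) \<longlonglongrightarrow> 0"
        using tendsto_add[OF tendsto_mult_right_zero[OF L2, of 2] tendsto_mult_right_zero[OF lim0[unfolded z], of 2]] by simp
      have "(LINT x|lebesgue. (g x)\<^sup>2) \<le> 2 * (LINT x|lebesgue. (stepf (N n) (u n) x - g x)\<^sup>2) + 2 * form (N n) (u n) (u n)" for n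
      proof -
        let ?s = "stepf (N n) (u n)"
        have "(LINT x|lebesgue. ((g x - ?s x) + ?s x)\<^sup>2) \<le> 2 * (LINT x|lebesgue. (g x - ?s x)\<^sup>2) + 2 * (LINT x|lebesgue. (?s x)\<^sup>2)"
          by (intro integral_square_triangle borel_measurable_diff square_integrable_diff stepf_measurable stepf_square_integrable g)
        then show ?thesis by (simp add: stepf_square_integral power2_commute[of "g _"])
      qed
      then show "\<exists>K. \<forall>n\<ge>K. (LINT x|lebesgue. (g x)\<^sup>2) \<le> 2 * (LINT x|lebesgue. (stepf (N n) (u n) x - g x)\<^sup>2) + 2 * form (N n) (u n) (u n)" by blast
    qed
    moreover have "0 \<le> (LINT x|lebesgue. (g x)\<^sup>2)" by (intro integral_nonneg_AE) auto
    ultimately have "(LINT x|lebesgue. (g x)\<^sup>2) = 0" by simp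
    then have "AE x in lebesgue. (g x)\<^sup>2 = 0" using integral_nonneg_eq_0_iff_AE[OF g(2)] by simp
    then show False using nz by simp
  qed
  have "(\<lambda>n. nrm (sf_diff ((W ^^ l) (?X n)) ((W ^^ l) ?F))) \<longlonglongrightarrow> 0"
  proof (rule Lim_null_comparison, rule always_eventually, rule allI)
    fix n show "norm (nrm (sf_diff ((W ^^ l) (?X n)) ((W ^^ l) ?F))) \<le> 2 ^ l * nrm (sf_diff (?X n) ?F)"
      using power_diff_bound[OF J XH F, of l n] SC.HH.nrm_nonneg[OF SC.HH.diff, of "(W ^^ l) (?X n)" "(W ^^ l) ?F"] by simp
  next
    show "(\<lambda>n. 2 ^ l * nrm (sf_diff (?X n) ?F)) \<longlonglongrightarrow> 0" by (rule tendsto_mult_right_zero[OF X])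
  qed
  then have "(\<lambda>n. ip (?X n) ((W ^^ l) (?X n))) \<longlonglongrightarrow> ip ?F ((W ^^ l) ?F)"
    using power_diff_bound[OF J XH F] by (intro SC.HH.ip_continuous XH F X) auto
  then have "(\<lambda>n. \<beta> l * form (N n) (u n) (u n)) \<longlonglongrightarrow> ip ?F ((W ^^ l) ?F)" by (simp only: moment_chi_comb[OF J])
  moreover have "(\<lambda>n. \<beta> l * form (N n) (u n) (u n)) \<longlonglongrightarrow> \<beta> l * ip ?F ?F" by (intro tendsto_mult_left lim0)
  ultimately show "ip ?F ((W ^^ l) ?F) = \<beta> l * ip ?F ?F" by (rule LIMSEQ_unique)
qed

text \<open>After division by the squared norm, which is not 0, the prescribed moments are those of
  the semicircular law, and these determine it.\<close>

lemma spectral_measure_iff: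
  assumes "F \<in> SC.H" "ip F F \<noteq> 0" "\<And>l. ip F ((W ^^ l) F) = \<beta> l * ip F F"
  shows "is_spectral_measure ip W F \<mu> \<longleftrightarrow> \<mu> = semicircle_law"
proof
  assume s: "is_spectral_measure ip W F \<mu>"
  then show "\<mu> = semicircle_law"
    using assms(2,3) unfolding is_spectral_measure_def by (intro semicircle_moments_unique) auto
next
  assume "\<mu> = semicircle_law"
  then show "is_spectral_measure ip W F \<mu>"
    using assms(2,3) prob_space_semicircle semicircle_integrable unfolding is_spectral_measure_def
    by (auto simp: \<beta>_def)
qed

end

theorem theorem6:
  fixes M :: "'w measure"
    and B :: "nat \<Rightarrow> real \<Rightarrow> real \<Rightarrow> 'w \<Rightarrow> real"
    and a b :: "nat \<Rightarrow> real"
  assumes "prob_space M"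
    and "\<forall>m\<ge>1. brownian_sheet M (B m)"
    and "independent_sheets M B"
    and "bij_betw (\<lambda>i. (a i, b i)) UNIV {(p, r). p \<in> \<rat> \<and> r \<in> \<rat> \<and> 0 \<le> p \<and> p < r \<and> r \<le> 1}"
  shows "\<exists>q :: 'w setfun \<Rightarrow> 'w setfun \<Rightarrow> 'w \<Rightarrow> real.
    (\<forall>F\<in>sheet_space M B a b. \<forall>G\<in>sheet_space M B a b. has_inner M F G (q F G)) \<and>
    (AE \<omega> in M. hilbert_space_on (sheet_space M B a b) (sf_equiv M) (\<lambda>F G. q F G \<omega>)) \<and>
    (\<exists>W. is_W M B a b W) \<and>
    (\<forall>W. is_W M B a b W \<longrightarrow>
      (AE \<omega> in M. bounded_operator_on (sheet_space M B a b) (\<lambda>F G. q F G \<omega>) W \<and>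
                  self_adjoint_on (sheet_space M B a b) (\<lambda>F G. q F G \<omega>) W) \<and>
      (\<forall>f :: real \<Rightarrow> real.
         f \<in> borel_measurable (lebesgue_on {0..1}) \<and>
         integrable (lebesgue_on {0..1}) (\<lambda>x. (f x)\<^sup>2) \<and>
         \<not> (AE x in lebesgue_on {0..1}. f x = 0) \<longrightarrow>
         average_sf f \<in> sheet_space M B a b \<and>
         (AE \<omega> in M. \<forall>\<mu>. is_spectral_measure (\<lambda>F G. q F G \<omega>) W (average_sf f) \<mu> \<longleftrightarrow>
                           \<mu> = semicircle_law)))"
proof -
  interpret prob_space M by fact
  interpret sheets M B a b using assms by unfold_locales auto
  have Jac_W: "Jac F (W F)" if "is_W M B a b W" "F \<in> SC.H" for W F using that by (rule is_W_Jac)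
  show ?thesis
  \<comment> \<open>The form is the same at every sample point, so what is claimed almost surely is
    proved without exceptional set.\<close>
  proof (intro exI[of _ "\<lambda>F G _. const_ip M F G"] conjI ballI allI impI)
    show "has_inner M F G (\<lambda>_. const_ip M F G)" if "F \<in> sheet_space M B a b" "G \<in> sheet_space M B a b" for F G
      using that by (simp add: sheet_space_eq SC.HH.has_inner_ip)
    show "AE \<omega> in M. hilbert_space_on (sheet_space M B a b) (sf_equiv M) (\<lambda>F G. const_ip M F G)"
      using SC.hilbert_space_on_H by (simp add: sheet_space_eq)
    show "\<exists>W. is_W M B a b W" by (rule ex_is_W)
  next
    fix W assume W: "is_W M B a b W"
    have bdd: "bounded_operator_on (sheet_space M B a b) (\<lambda>F G. const_ip M F G) W"
      unfolding bounded_operator_on_def sheet_space_eq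
      using Jac_bound[OF Jac_W[OF W]] by (intro exI[of _ 2]) (simp add: const_nrm_def)
    have sa: "self_adjoint_on (sheet_space M B a b) (\<lambda>F G. const_ip M F G) W"
      unfolding self_adjoint_on_def sheet_space_eq
      using Jac_symmetric[OF Jac_W[OF W] Jac_W[OF W]] by simp
    show "AE \<omega> in M. bounded_operator_on (sheet_space M B a b) (\<lambda>F G. const_ip M F G) W \<and>
      self_adjoint_on (sheet_space M B a b) (\<lambda>F G. const_ip M F G) W"
      using bdd sa by simp
    fix f :: "real \<Rightarrow> real"
    assume f: "f \<in> borel_measurable (lebesgue_on {0..1}) \<and> integrable (lebesgue_on {0..1}) (\<lambda>x. (f x)\<^sup>2) \<and>
      \<not> (AE x in lebesgue_on {0..1}. f x = 0)"
    \<comment> \<open>Integrals are taken over the whole line; f is arbitrary outside the unit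
      interval and is replaced by 0 there.\<close>
    define g where "g x = indicator {0..1} x * f x" for x :: real
    have g: "g \<in> borel_measurable lebesgue" "integrable lebesgue (\<lambda>x. (g x)\<^sup>2)"
    proof -
      show "g \<in> borel_measurable lebesgue"
        using f borel_measurable_restrict_space_iff[of "{0..1}" "lebesgue :: real measure" f] by (simp add: g_def[abs_def])
      have "(\<lambda>x. (g x)\<^sup>2) = (\<lambda>x. indicator {0..1} x *\<^sub>R (f x)\<^sup>2)" by (auto simp: g_def indicator_def)
      then show "integrable lebesgue (\<lambda>x. (g x)\<^sup>2)"
        using f integrable_restrict_space[of "{0..1}" "lebesgue :: real measure" "\<lambda>x. (f x)\<^sup>2"] by simp
    qed
    have nz: "\<not> (AE x in lebesgue. g x = 0)"
    proof
      assume "AE x in lebesgue. g x = 0"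
      then have "AE x in lebesgue. x \<in> {0..1} \<longrightarrow> f x = 0" by eventually_elim (auto simp: g_def)
      then have "AE x in lebesgue_on {0..1}. f x = 0" by (subst AE_restrict_space_iff) auto
      then show False using f by simp
    qed
    have supp: "g x = 0" if "x \<notin> {0..1}" for x using that by (simp add: g_def)
    have fg: "f x = g x" if "x \<in> {0..1}" for x using that by (simp add: g_def)
    note mom = moments_average[OF Jac_W[OF W] g supp fg nz]
    show "average_sf f \<in> sheet_space M B a b" unfolding sheet_space_eq by (rule mom(1))
    show "AE \<omega> in M. \<forall>\<mu>. is_spectral_measure (\<lambda>F G. const_ip M F G) W (average_sf f) \<mu> \<longleftrightarrow> \<mu> = semicircle_law"
      using spectral_measure_iff[OF mom(1,2,3)] by simp
  qed
qed

end
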